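(* Let $m,\mu,\kappa>0$, $a=\sqrt{\kappa/\mu}$, let $\omega>0$, $\omega_0=\omega/a$, and let $F\in C^1(\mathbb{R})$ satisfy $F(y)\to-\infty$ as $y\to+\infty$ and $F(y)\to+\infty$ as $y\to-\infty$. Let $(u_0,u_1)\in\mathcal{H}^\omega$, $y_1\in\mathbb{R}$, and let $p$ be the function $$p(z)=\frac{u_0(z)+u_0(-z)}{2}+\frac1{2a}\int_{-z}^{z}u_1(s)\,ds .$$ Assume that condition (F2) or condition (F3), stated in the context, is true. Then: (i) There exists a unique $\omega_0$-periodic solution $y_p(t)$ of the equation $$m\ddot y(t)=F(y(t))-\frac{2\kappa}{a}\dot y(t)+2\kappa p'(at),\qquad t>0,$$ and for any other solution $y(t)$ of this equation and every $R>0$, $$\int_t^{t+R}|\dot y(s)-\dot y_p(s)|^2ds+\sup_{s\in[t,t+R]}|y(s)-y_p(s)|\to0\quad\text{as }t\to\infty.$$ (ii) For every solution $u(x,t)\in\mathcal{E}$ of the string equation $$(\mu+m\delta(x))\ddot u(x,t)=\kappa u''(x,t)+\delta(x)F(u(x,t)),\quad t\in\mathbb{R},\ x\in\mathbb{R},$$ with initial data $u|_{t=0}=u_0$, $\dot u|_{t=0}=u_1$, $\dot y|_{t=0}=y_1$, where $y(t)=u(0,t)$, there exists a solution $u_p(x,t)\in\mathcal{E}$ of the same string equation such that $u_p(x,t+\omega/a)=u_p(x,t)$ for all $(x,t)\in\mathbb{R}^2$ with $|t|>|x|/a$, and for every $R>0$, $$\int_{|x|<R}\left(|\dot u(x,t)-\dot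 u_p(x,t)|^2+|u'(x,t)-u_p'(x,t)|^2\right)dx+\max_{|x|<R}|u(x,t)-u_p(x,t)|\to0\quad\text{as }t\to\infty.$$
   Context: Notation: $\dot u=\partial u/\partial t$, $u'=\partial u/\partial x$; $\delta$ is the Dirac delta. Put $c=1/m$ and $k=2\kappa/(am)=2\sqrt{\kappa\mu}/m$. The equation for $y$ in (i) is equivalent to the system $$\dot y=v,\qquad \dot v=cF(y)-kv+ka\,p'(at).\qquad( * )$$ Condition (F2): for all $y_1\ne y_2$ in $\mathbb{R}$, $$\frac{k^2}{2}-1\le -c\,\frac{F(y_2)-F(y_1)}{y_2-y_1}\le1,\qquad\text{and}\quad 1<\frac{k^2}{2}\le2 .$$ Condition (F3): here $M,N>0$ are constants such that every solution $(y(t),v(t))$ of $( * )$ satisfies $|y(t)|\le M$, $|v(t)|\le N$ for all sufficiently large $t$. The condition is: $F\in C^2(\mathbb{R})$; $F'(y)<0$ for $|y|\le M$; there exists $\beta>0$ such that $F(y)\,\mathrm{sgn}\,y\le-\beta$ for $|y|\ge M$; and $$k>\frac12\,N\max_{|y|\le M}\frac{|F''(y)|}{|F'(y)|}.$$ Class $P^\omega$: a function $w$ on $\mathbb{R}$ is in $P^\omega$ iff $w(x+\omega)=w(x)$ for $x>0$ and $w(x-\omega)=w(x)$ for $x<0$. Class $\mathcal{H}^\omega$: $(u_0,u_1)\in\mathcal{H}^\omega$ iff $u_0\in C^1(\mathbb{R})$, $u_1\in C(\mathbb{R})$ and $u_0,u_0',u_1\in P^\omega$. (Then $t\mapsto p'(at)$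 is continuous and $\omega/a$-periodic for $t>0$.) Class $\mathcal{E}$: $u\in\mathcal{E}$ iff $u\in C(\mathbb{R}^2)$ and $\dot u,u'\in L^2_{\rm loc}(\mathbb{R}^2)$ (distributional derivatives). Meaning of the string equation: by definition it is equivalent to $\mu\ddot u=\kappa u''$ for $t\in\mathbb{R}$, $x\ne0$, together with $m\ddot y(t)=F(y(t))+\kappa[u'(0+,t)-u'(0-,t)]$, $t\in\mathbb{R}$, where $y(t)=u(0,t)$. The first equation is understood in the sense of distributions in $\{x\neq0\}$, equivalently $u(x,t)=f_\pm(x-at)+g_\pm(x+at)$ for $\pm x>0$, $t\in\mathbb{R}$, with $f_\pm,g_\pm\in C(\mathbb{R})$ (and $f_\pm',g_\pm'\in L^2_{\rm loc}(\mathbb{R})$ when $u\in\mathcal{E}$). In the second, $u'(0\pm,t):=f_\pm'(-at)+g_\pm'(at)$ and $\ddot y$ is a distributional derivative; then $y\in C^1(\mathbb{R})$. The initial conditions for $u$ mean $f_\pm(x)+g_\pm(x)=u_0(x)$ and $-af_\pm'(x)+ag_\pm'(x)=u_1(x)$ for $\pm x>0$. *)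

theory Defs
  imports "HOL-Analysis.Analysis"
begin

definition partial :: "'a \<Rightarrow> ('a::euclidean_space \<Rightarrow> real) \<Rightarrow> 'a \<Rightarrow> real" where
  "partial e f z = frechet_derivative f (at z) e"

text \<open>In finite dimension, a function is of class \<open>C\<^sup>n\<^sup>+\<^sup>1\<close> iff it is differentiable everywhere and
  all its directional derivatives are of class \<open>C\<^sup>n\<close>.\<close>

primrec C_class :: "nat \<Rightarrow> ('a::euclidean_space \<Rightarrow> real) \<Rightarrow> bool" where
  "C_class 0 f \<longleftrightarrow> continuous_on UNIV f"
| "C_class (Suc n) f \<longleftrightarrow> (\<forall>z. f differentiable (at z)) \<and> (\<forall>e. C_class n (partial e f))"

definition test_function :: "'a set \<Rightarrow> ('a::euclidean_space \<Rightarrow> real) \<Rightarrow> bool" where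
  "test_function U \<phi> \<longleftrightarrow> (\<forall>n. C_class n \<phi>)
     \<and> compact (closure {z. \<phi> z \<noteq> 0}) \<and> closure {z. \<phi> z \<noteq> 0} \<subseteq> U"

text \<open>Elements of \<open>L\<^sup>2\<^sub>l\<^sub>o\<^sub>c\<close> are represented by Borel functions; every class contains one.\<close>

definition L2_loc :: "('a::euclidean_space \<Rightarrow> real) \<Rightarrow> bool" where
  "L2_loc w \<longleftrightarrow> w \<in> borel_measurable borel
     \<and> (\<forall>K. compact K \<longrightarrow> set_integrable lborel K (\<lambda>z. (w z)\<^sup>2))"

definition weak_partial ::
    "'a \<Rightarrow> ('a::euclidean_space \<Rightarrow> real) \<Rightarrow> ('a \<Rightarrow> real) \<Rightarrow> bool" where
  "weak_partial e f w \<longleftrightarrow> (\<forall>\<phi>. test_function UNIV \<phi> \<longrightarrow>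
     (LINT z|lborel. f z * partial e \<phi> z) = - (LINT z|lborel. w z * \<phi> z))"

definition P_class :: "real \<Rightarrow> (real \<Rightarrow> real) set" where
  "P_class \<omega> = {w. (\<forall>x>0. w (x + \<omega>) = w x) \<and> (\<forall>x<0. w (x - \<omega>) = w x)}"

definition H_class :: "real \<Rightarrow> ((real \<Rightarrow> real) \<times> (real \<Rightarrow> real)) set" where
  "H_class \<omega> = {(u0, u1). u0 C1_differentiable_on UNIV \<and> continuous_on UNIV u1
     \<and> u0 \<in> P_class \<omega> \<and> deriv u0 \<in> P_class \<omega> \<and> u1 \<in> P_class \<omega>}"

text \<open>The interval integral is signed, so the formula is meant for negative \<open>z\<close> as well.\<close>

definition incident_wave :: "real \<Rightarrow> (real \<Rightarrow> real) \<Rightarrow> (real \<Rightarrow> real) \<Rightarrow> real \<Rightarrow> real" where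
  "incident_wave a u0 u1 z =
     (u0 z + u0 (- z)) / 2 + 1 / (2 * a) * (LBINT s=ereal (- z)..ereal z. u1 s)"

definition reduced_solution ::
    "real \<Rightarrow> real \<Rightarrow> real \<Rightarrow> (real \<Rightarrow> real) \<Rightarrow> (real \<Rightarrow> real) \<Rightarrow> (real \<Rightarrow> real) \<Rightarrow> bool" where
  "reduced_solution m \<kappa> a F p y \<longleftrightarrow> (\<forall>t>0.
     y differentiable (at t) \<and> deriv y differentiable (at t)
     \<and> m * deriv (deriv y) t = F (y t) - 2 * \<kappa> / a * deriv y t + 2 * \<kappa> * deriv p (a * t))"

definition system_solution ::
    "real \<Rightarrow> real \<Rightarrow> real \<Rightarrow> (real \<Rightarrow> real) \<Rightarrow> (real \<Rightarrow> real) \<Rightarrow> (real \<Rightarrow> real) \<Rightarrow> (real \<Rightarrow> real) \<Rightarrow> bool"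
  where
  "system_solution c k a F p y v \<longleftrightarrow> (\<forall>t>0.
     (y has_real_derivative v t) (at t)
     \<and> (v has_real_derivative c * F (y t) - k * v t + k * a * deriv p (a * t)) (at t))"

definition condition_F2 :: "real \<Rightarrow> real \<Rightarrow> (real \<Rightarrow> real) \<Rightarrow> bool" where
  "condition_F2 c k F \<longleftrightarrow>
     (\<forall>y1 y2. y1 \<noteq> y2 \<longrightarrow>
        k\<^sup>2 / 2 - 1 \<le> - c * ((F y2 - F y1) / (y2 - y1)) \<and>
        - c * ((F y2 - F y1) / (y2 - y1)) \<le> 1)
     \<and> 1 < k\<^sup>2 / 2 \<and> k\<^sup>2 / 2 \<le> 2"

text \<open>The supremum below is a maximum: the quotient is continuous on the compact interval.\<close>

definition condition_F3 ::
    "real \<Rightarrow> real \<Rightarrow> real \<Rightarrow> (real \<Rightarrow> real) \<Rightarrow> (real \<Rightarrow> real) \<Rightarrow> bool" where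
  "condition_F3 c k a F p \<longleftrightarrow> (\<exists>M>0. \<exists>N>0.
     (\<forall>y v. system_solution c k a F p y v \<longrightarrow>
        (\<forall>\<^sub>F t in at_top. \<bar>y t\<bar> \<le> M \<and> \<bar>v t\<bar> \<le> N))
     \<and> F C1_differentiable_on UNIV \<and> deriv F C1_differentiable_on UNIV
     \<and> (\<forall>y. \<bar>y\<bar> \<le> M \<longrightarrow> deriv F y < 0)
     \<and> (\<exists>\<beta>>0. \<forall>y. \<bar>y\<bar> \<ge> M \<longrightarrow> F y * sgn y \<le> - \<beta>)
     \<and> k > 1 / 2 * N * (SUP y\<in>{y. \<bar>y\<bar> \<le> M}. \<bar>deriv (deriv F) y\<bar> / \<bar>deriv F y\<bar>))"

text \<open>Functions on space-time take the pair \<open>(x, t)\<close>; thus \<open>(1, 0)\<close> is the direction of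
  \<open>x\<close> and \<open>(0, 1)\<close> the direction of \<open>t\<close>.\<close>

definition E_class :: "(real \<times> real \<Rightarrow> real) set" where
  "E_class = {u. continuous_on UNIV u
     \<and> (\<exists>ut. L2_loc ut \<and> weak_partial (0, 1) u ut)
     \<and> (\<exists>ux. L2_loc ux \<and> weak_partial (1, 0) u ux)}"

definition wave_equation_off_0 :: "real \<Rightarrow> real \<Rightarrow> (real \<times> real \<Rightarrow> real) \<Rightarrow> bool" where
  "wave_equation_off_0 \<mu> \<kappa> u \<longleftrightarrow> (\<forall>\<phi>. test_function {z. fst z \<noteq> 0} \<phi> \<longrightarrow>
     (LINT z|lborel. u z * (\<mu> * partial (0, 1) (partial (0, 1) \<phi>) z
                           - \<kappa> * partial (1, 0) (partial (1, 0) \<phi>) z)) = 0)"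

text \<open>The d'Alembert representation on the two half-lines. The first argument of \<open>f\<close>, \<open>g\<close>,
  \<open>df\<close>, \<open>dg\<close> is the sign of the half-line, \<open>1\<close> or \<open>-1\<close>. The functions \<open>df s\<close>, \<open>dg s\<close> are
  determined by \<open>u\<close> up to null sets, and \<open>f s\<close>, \<open>g s\<close> up to opposite constants.\<close>

definition dAlembert ::
    "real \<Rightarrow> (real \<times> real \<Rightarrow> real) \<Rightarrow> (real \<Rightarrow> real \<Rightarrow> real) \<Rightarrow> (real \<Rightarrow> real \<Rightarrow> real)
      \<Rightarrow> (real \<Rightarrow> real \<Rightarrow> real) \<Rightarrow> (real \<Rightarrow> real \<Rightarrow> real) \<Rightarrow> bool" where
  "dAlembert a u f g df dg \<longleftrightarrow> (\<forall>s\<in>{1, -1}.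
     continuous_on UNIV (f s) \<and> continuous_on UNIV (g s)
     \<and> L2_loc (df s) \<and> weak_partial 1 (f s) (df s)
     \<and> L2_loc (dg s) \<and> weak_partial 1 (g s) (dg s)
     \<and> (\<forall>x t. s * x > 0 \<longrightarrow> u (x, t) = f s (x - a * t) + g s (x + a * t)))"

text \<open>For a solution, the representation gives the time and space derivative on every line
  \<open>t = const\<close> as functions of \<open>x \<noteq> 0\<close>, up to null sets; the values at \<open>x = 0\<close> are irrelevant.\<close>

definition time_deriv ::
    "real \<Rightarrow> (real \<Rightarrow> real \<Rightarrow> real) \<Rightarrow> (real \<Rightarrow> real \<Rightarrow> real) \<Rightarrow> real \<Rightarrow> real \<Rightarrow> real" where
  "time_deriv a df dg x t = - a * df (sgn x) (x - a * t) + a * dg (sgn x) (x + a * t)"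

definition space_deriv ::
    "real \<Rightarrow> (real \<Rightarrow> real \<Rightarrow> real) \<Rightarrow> (real \<Rightarrow> real \<Rightarrow> real) \<Rightarrow> real \<Rightarrow> real \<Rightarrow> real" where
  "space_deriv a df dg x t = df (sgn x) (x - a * t) + dg (sgn x) (x + a * t)"

text \<open>The one-sided derivative of \<open>u\<close> in \<open>x\<close> at \<open>x = 0+\<close> (\<open>s = 1\<close>) or \<open>x = 0-\<close> (\<open>s = -1\<close>).\<close>

definition trace_deriv ::
    "real \<Rightarrow> (real \<Rightarrow> real \<Rightarrow> real) \<Rightarrow> (real \<Rightarrow> real \<Rightarrow> real) \<Rightarrow> real \<Rightarrow> real \<Rightarrow> real" where
  "trace_deriv a df dg s t = df s (- a * t) + dg s (a * t)"

definition string_solution ::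
    "real \<Rightarrow> real \<Rightarrow> real \<Rightarrow> (real \<Rightarrow> real) \<Rightarrow> (real \<times> real \<Rightarrow> real) \<Rightarrow> bool" where
  "string_solution m \<mu> \<kappa> F u \<longleftrightarrow>
     (let a = sqrt (\<kappa> / \<mu>); y = (\<lambda>t. u (0, t)) in
       wave_equation_off_0 \<mu> \<kappa> u
       \<and> (\<exists>f g df dg. dAlembert a u f g df dg
            \<and> (\<forall>\<phi>. test_function UNIV \<phi> \<longrightarrow>
                 m * (LINT t|lborel. y t * partial 1 (partial 1 \<phi>) t) =
                 (LINT t|lborel. (F (y t)
                    + \<kappa> * (trace_deriv a df dg 1 t - trace_deriv a df dg (-1) t)) * \<phi> t))))"

text \<open>The derivatives \<open>df s\<close>, \<open>dg s\<close> are only locally square integrable, so the condition on the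
  initial velocity is an equality almost everywhere.\<close>

definition initial_conditions ::
    "real \<Rightarrow> (real \<times> real \<Rightarrow> real) \<Rightarrow> (real \<Rightarrow> real) \<Rightarrow> (real \<Rightarrow> real) \<Rightarrow> real \<Rightarrow> bool" where
  "initial_conditions a u u0 u1 y1 \<longleftrightarrow>
     (\<exists>f g df dg. dAlembert a u f g df dg
        \<and> (\<forall>s\<in>{1, -1}. (\<forall>x. s * x > 0 \<longrightarrow> f s x + g s x = u0 x)
             \<and> (AE x in lborel. s * x > 0 \<longrightarrow> - a * df s x + a * dg s x = u1 x)))
     \<and> ((\<lambda>t. u (0, t)) has_real_derivative y1) (at 0)"

end

theory Submission
  imports Defs
begin

text \<open>In the reduced equation the string enters only through damping and through the periodic force
  \<open>2 \<kappa> p'(a t)\<close>. The heart of the matter is that any two of its solutions approach each other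
  exponentially fast (\<open>solutions_exp_close\<close>). Under the first condition the linear equation for their
  difference has a coefficient confined to an interval for which one quadratic form decreases
  uniformly. Under the second the coefficient \<open>q\<close> is an average of \<open>-c F'\<close> and changes slowly relative
  to its size, so that the energy \<open>z\<^sup>2/q + w\<^sup>2\<close> of the difference decreases.

  A solution exists for all positive times and is bounded: the nonlinearity is cut off at a high
  level, which makes the equation globally Lipschitz, and an energy estimate that does not see the
  cut-off shows that the level is never reached (\<open>reduced_system_bounded_solution\<close>). Comparing this
  solution with its own translate by one period, the contraction makes the translates by \<open>n\<close> periods
  a uniform Cauchy sequence. Their limit is a periodic solution, and it attracts all others, whence
  its uniqueness (\<open>periodic_attractor\<close>).

  For the string, the d'Alembert representation shows that the waves travelling towards the mass at
  positive times are fixed by the initial data, while the waves travelling away are fixed by the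
  displacement \<open>y(t)\<close> of the mass; in the cone \<open>\<bar>x\<bar> < a t\<close>
  the solution is \<open>y(t - \<bar>x\<bar>/a)\<close> plus a term that depends on the incoming wave alone
  (\<open>dAlembert_inside_light_cone\<close>). The distributional equation of the mass makes \<open>y\<close> a classical
  solution of the reduced equation for \<open>t > 0\<close> (\<open>string_trace_solves_reduced_equation\<close>).
  Conversely the periodic solution \<open>y\<^sub>p\<close> and the incoming waves, all continued periodically to the
  whole line, determine a solution \<open>u\<^sub>p\<close> of the string equation (\<open>string_solution_from_trace\<close>).
  Inside the cone the incoming terms of \<open>u\<close> and \<open>u\<^sub>p\<close> cancel, so that
  \<open>u - u\<^sub>p = (y - y\<^sub>p)(t - \<bar>x\<bar>/a)\<close>, and the convergence of \<open>y\<close> and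
  its derivative carries over to every bounded part of the string
  (\<open>outgoing_difference_local_convergence\<close>).

  Statements about distributions are brought down to continuous functions by a family of smooth test
  functions: rescaled smooth steps recover the fundamental theorem of calculus for weak derivatives
  (\<open>weak_derivative_FTC\<close>) and show that a function with vanishing second weak derivative is affine
  (\<open>weak_second_derivative_zero_affine\<close>).\<close>

section \<open>Primitives and global solutions of ordinary differential equations\<close>

text \<open>The signed integral, so that differentiation is possible at negative arguments as well.\<close>

definition primitive :: "(real \<Rightarrow> 'a::euclidean_space) \<Rightarrow> real \<Rightarrow> 'a" where
  "primitive h u = (LBINT s=0..u. h s)"

lemma primitive_0 [simp]: "primitive h 0 = 0"
  by (simp add: primitive_def zero_ereal_def)

lemma primitive_has_vector_derivative:
  assumes "continuous_on UNIV h"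
  shows "(primitive h has_vector_derivative h x) (at x)"
proof -
  define b where "b = \<bar>x\<bar> + 1"
  have "((\<lambda>u. LBINT y=ereal 0..ereal u. h y) has_vector_derivative h x) (at x within {-b..b})"
    using assms by (intro interval_integral_FTC2) (auto simp: b_def intro: continuous_on_subset)
  moreover have "at x within {-b..b} = at x"
    by (rule at_within_interior) (auto simp: b_def interior_atLeastAtMost_real)
  ultimately show ?thesis
    by (simp add: primitive_def[abs_def] zero_ereal_def)
qed

lemma primitive_has_real_derivative:
  fixes h :: "real \<Rightarrow> real"
  assumes "continuous_on UNIV h"
  shows "(primitive h has_real_derivative h x) (at x)"
  using primitive_has_vector_derivative[OF assms]
  by (simp add: has_real_derivative_iff_has_vector_derivative)

lemma continuous_on_primitive:
  assumes "continuous_on UNIV h"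
  shows "continuous_on S (primitive h)"
  using primitive_has_vector_derivative[OF assms]
  by (auto intro!: continuous_at_imp_continuous_on has_vector_derivative_continuous)

text \<open>The weighted bound behind the contraction estimate: integration gains the factor \<open>1 / (2 L)\<close>.\<close>

lemma norm_primitive_le_exp:
  fixes h :: "real \<Rightarrow> 'a::euclidean_space"
  assumes h: "continuous_on UNIV h" and L: "L > 0" and t: "t \<ge> 0"
    and bd: "\<And>s. s \<ge> 0 \<Longrightarrow> norm (h s) \<le> C * exp (2 * L * s)"
  shows "norm (primitive h t) \<le> C / (2 * L) * exp (2 * L * t)"
proof -
  have C: "C \<ge> 0" using bd[of 0] norm_ge_zero[of "h 0"] by (simp del: norm_ge_zero)
  show ?thesis
  proof (cases "t = 0")
    case False
    have "norm (primitive h t - primitive h 0)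
          \<le> C / (2 * L) * exp (2 * L * t) - C / (2 * L) * exp (2 * L * 0)"
    proof (rule differentiable_bound_general[where f' = h and \<phi>' = "\<lambda>s. C * exp (2 * L * s)"])
      show "0 < t" using t False by simp
      show "continuous_on {0..t} (primitive h)" by (rule continuous_on_primitive[OF h])
      show "continuous_on {0..t} (\<lambda>t. C / (2 * L) * exp (2 * L * t))"
        by (intro continuous_intros)
      show "(primitive h has_vector_derivative h x) (at x)" for x
        by (rule primitive_has_vector_derivative[OF h])
      show "((\<lambda>t. C / (2 * L) * exp (2 * L * t)) has_vector_derivative C * exp (2 * L * x)) (at x)"
        for x
        unfolding has_real_derivative_iff_has_vector_derivative[symmetric]
        using L by (auto intro!: derivative_eq_intros)
      show "norm (h x) \<le> C * exp (2 * L * x)" if "0 < x" for x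
        using bd that by simp
    qed
    moreover have "C / (2 * L) \<ge> 0" using C L by simp
    ultimately show ?thesis by simp
  qed (use C L in simp)
qed

text \<open>The integral operator becomes a contraction with factor \<open>1/2\<close> once a function is divided by
  the weight \<open>exp (2 L t)\<close>, so that one application of Banach's theorem gives the solution for
  all positive times.\<close>

lemma lipschitz_ode_global_solution:
  fixes f :: "real \<Rightarrow> 'a::euclidean_space \<Rightarrow> 'a"
  assumes cont: "continuous_on UNIV (\<lambda>(t, x). f t x)"
    and L: "L > 0" and lip: "\<And>t x y. norm (f t x - f t y) \<le> L * norm (x - y)"
    and bd: "\<And>t. norm (f t 0) \<le> B"
  shows "\<exists>x. x 0 = x0 \<and> continuous_on UNIV x
    \<and> (\<forall>t>0. (x has_vector_derivative f t (x t)) (at t))"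
proof -
  define H where "H z s = f s (exp (2 * L * s) *\<^sub>R apply_bcontfun z s)" for z :: "real \<Rightarrow>\<^sub>C 'a" and s
  have H_cont: "continuous_on S (H z)" for S z
    unfolding H_def
    by (rule continuous_on_compose2[OF cont, of S "\<lambda>s. (s, exp (2 * L * s) *\<^sub>R apply_bcontfun z s)",
          simplified]) (auto intro!: continuous_intros)
  \<comment> \<open>The constant continuation to negative times makes every iterate a bounded continuous function on
    the whole line.\<close>
  define Q where "Q z t = exp (- 2 * L * max 0 t) *\<^sub>R (x0 + primitive (H z) (max 0 t))" for z t
  have B: "B \<ge> 0" using bd[of 0] norm_ge_zero[of "f 0 0"] by linarith
  have H_bd: "norm (H z s) \<le> (B + L * norm z) * exp (2 * L * s)" if "s \<ge> 0" for z s
  proof -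
    have "norm (H z s) \<le> norm (f s 0) + norm (H z s - f s 0)"
      by (metis add.commute norm_triangle_sub)
    also have "norm (f s 0) \<le> B * exp (2 * L * s)"
      using bd[of s] B L that mult_left_mono[of 1 "exp (2 * L * s)" B] by simp
    also have "norm (H z s - f s 0) \<le> L * (exp (2 * L * s) * norm z)"
      unfolding H_def using lip[of s "exp (2 * L * s) *\<^sub>R apply_bcontfun z s" 0] L norm_bounded[of z s]
      by (auto intro: order_trans)
    finally show ?thesis by (simp add: algebra_simps)
  qed
  have Q_mem: "Q z \<in> bcontfun" for z
  proof (rule bcontfun_normI)
    have "continuous_on UNIV (\<lambda>t. primitive (H z) (max 0 t))"
      by (rule continuous_on_compose2[OF continuous_on_primitive[OF H_cont]])
        (auto intro!: continuous_intros)
    then show "continuous_on UNIV (Q z)"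
      unfolding Q_def by (intro continuous_intros)
    fix t :: real
    define \<tau> where "\<tau> = max 0 t"
    have \<tau>: "\<tau> \<ge> 0" by (simp add: \<tau>_def)
    have "norm (Q z t) \<le> exp (- 2 * L * \<tau>) * (norm x0 + norm (primitive (H z) \<tau>))"
      unfolding Q_def \<tau>_def[symmetric] by (simp add: norm_triangle_ineq)
    also have "\<dots> \<le> exp (- 2 * L * \<tau>) * (norm x0 + (B + L * norm z) / (2 * L) * exp (2 * L * \<tau>))"
      by (intro mult_left_mono add_left_mono norm_primitive_le_exp[OF H_cont L \<tau>] H_bd) auto
    also have "\<dots> = exp (- 2 * L * \<tau>) * norm x0 + (B + L * norm z) / (2 * L)"
      using L by (simp add: algebra_simps exp_minus)
    also have "\<dots> \<le> norm x0 + (B + L * norm z) / (2 * L)"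
      using L \<tau> mult_right_mono[of "exp (- 2 * L * \<tau>)" 1 "norm x0"] by simp
    finally show "norm (Q z t) \<le> norm x0 + (B + L * norm z) / (2 * L)" .
  qed
  define T where "T z = Bcontfun (Q z)" for z
  have T: "apply_bcontfun (T z) t = Q z t" for z t
    unfolding T_def using Q_mem by (simp add: Bcontfun_inverse)
  have contr: "dist (T z) (T w) \<le> 1 / 2 * dist z w" for z w
  proof (rule dist_bound)
    fix t :: real
    define \<tau> where "\<tau> = max 0 t"
    have \<tau>: "\<tau> \<ge> 0" by (simp add: \<tau>_def)
    have diff: "norm (H z s - H w s) \<le> (L * dist z w) * exp (2 * L * s)" if "s \<ge> 0" for s
    proof -
      have "norm (H z s - H w s) \<le> L * norm (exp (2 * L * s) *\<^sub>R (apply_bcontfun z s - apply_bcontfun w s))"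
        unfolding H_def using lip by (simp add: scaleR_diff_right)
      also have "\<dots> \<le> L * (exp (2 * L * s) * dist z w)"
        using L dist_bounded[of z s w] by (auto simp: dist_norm intro!: mult_left_mono)
      finally show ?thesis by (simp add: algebra_simps)
    qed
    have "primitive (H z) \<tau> - primitive (H w) \<tau> = primitive (\<lambda>s. H z s - H w s) \<tau>"
      unfolding primitive_def zero_ereal_def
      by (rule interval_lebesgue_integral_diff(2)[symmetric])
        (auto intro!: interval_integrable_continuous_on H_cont \<tau>)
    then have "norm (primitive (H z) \<tau> - primitive (H w) \<tau>) \<le> L * dist z w / (2 * L) * exp (2 * L * \<tau>)"
      using norm_primitive_le_exp[OF _ L \<tau> diff] by (simp add: H_cont continuous_on_diff)
    moreover have "dist (Q z t) (Q w t)
        = exp (- 2 * L * \<tau>) * norm (primitive (H z) \<tau> - primitive (H w) \<tau>)"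
      unfolding Q_def \<tau>_def[symmetric] dist_norm scaleR_diff_right[symmetric] by simp
    ultimately have "dist (Q z t) (Q w t)
        \<le> exp (- 2 * L * \<tau>) * (L * dist z w / (2 * L) * exp (2 * L * \<tau>))"
      by (simp add: mult_left_mono)
    also have "\<dots> = 1 / 2 * dist z w"
      using L by (simp add: exp_minus)
    finally show "dist (apply_bcontfun (T z) t) (apply_bcontfun (T w) t) \<le> 1 / 2 * dist z w"
      by (simp add: T)
  qed
  obtain z where z: "T z = z"
    using banach_fix_type[of "1 / 2" T] contr by auto
  define x where "x t = x0 + primitive (H z) t" for t
  have x_der: "(x has_vector_derivative H z t) (at t)" for t
    unfolding x_def
    using primitive_has_vector_derivative[OF H_cont]
    by (auto intro!: derivative_eq_intros)
  have "exp (2 * L * t) *\<^sub>R apply_bcontfun z t = x t" if "t > 0" for t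
  proof -
    have "apply_bcontfun z t = exp (- 2 * L * t) *\<^sub>R x t"
      using T[of z t] that by (simp add: z Q_def x_def max_def)
    then show ?thesis by (simp add: exp_minus)
  qed
  then have "H z t = f t (x t)" if "t > 0" for t
    using that by (simp add: H_def)
  moreover have "continuous_on UNIV x"
    unfolding x_def by (intro continuous_intros continuous_on_primitive[OF H_cont])
  moreover have "x 0 = x0" by (simp add: x_def)
  ultimately show ?thesis using x_der by metis
qed

text \<open>After the last time at which \<open>V \<le> b\<close> the function could only decrease.\<close>

lemma barrier_bound:
  fixes V V' :: "real \<Rightarrow> real"
  assumes cont: "continuous_on {0..} V" and V0: "V 0 \<le> b"
    and der: "\<And>t. t > 0 \<Longrightarrow> (V has_real_derivative V' t) (at t)"
    and dec: "\<And>t. t > 0 \<Longrightarrow> V t > b \<Longrightarrow> V' t \<le> 0"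
    and t: "t \<ge> 0"
  shows "V t \<le> b"
proof (rule ccontr)
  assume not: "\<not> V t \<le> b"
  define S where "S = {s \<in> {0..t}. V s \<le> b}"
  have "closed S"
    unfolding S_def
    by (rule continuous_on_closed_Collect_le) (auto intro: continuous_on_subset[OF cont])
  then have "compact S"
    by (simp add: compact_eq_bounded_closed S_def bounded_subset[OF bounded_closed_interval[of 0 t]] subset_iff)
  moreover have "0 \<in> S" using V0 t by (simp add: S_def)
  ultimately obtain s where s: "s \<in> S" "\<And>r. r \<in> S \<Longrightarrow> r \<le> s"
    using compact_attains_sup[of S] by blast
  have st: "0 \<le> s" "s < t" "V s \<le> b" using s(1) not by (auto simp: S_def less_le)
  have above: "V r > b" if "s < r" "r \<le> t" for r
    using s(2)[of r] that st by (force simp: S_def)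
  have "V t \<le> V s"
  proof (rule DERIV_nonpos_imp_decreasing_open[of s t V])
    show "continuous_on {s..t} V" using st by (auto intro: continuous_on_subset[OF cont])
    show "\<exists>y. DERIV V r :> y \<and> y \<le> 0" if "s < r" "r < t" for r
      using der[of r] dec[of r] above[of r] that st by force
  qed (use st in simp)
  then show False using st not by simp
qed

section \<open>Global bounded solutions of the reduced equation\<close>

lemma C1_on_UNIV_D:
  fixes F :: "real \<Rightarrow> real"
  assumes "F C1_differentiable_on UNIV"
  shows "(F has_real_derivative deriv F x) (at x)" "continuous_on S (deriv F)" "continuous_on S F"
proof -
  obtain D where D: "\<And>x. (F has_vector_derivative D x) (at x)" "continuous_on UNIV D"
    using assms unfolding C1_differentiable_on_def by auto
  have *: "(F has_real_derivative D x) (at x)" for x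
    using D(1) by (simp add: has_real_derivative_iff_has_vector_derivative)
  then have "deriv F = D" by (auto simp: DERIV_imp_deriv)
  then show "(F has_real_derivative deriv F x) (at x)" "continuous_on S (deriv F)"
    using * D(2) by (auto intro: continuous_on_subset)
  show "continuous_on S F"
    using * by (auto intro!: continuous_at_imp_continuous_on DERIV_isCont)
qed

lemma continuous_bounded_on_interval:
  fixes F :: "real \<Rightarrow> real"
  assumes "continuous_on {-L..L} F"
  obtains B where "B > 0" "\<And>x. \<bar>x\<bar> \<le> L \<Longrightarrow> \<bar>F x\<bar> \<le> B"
proof -
  have "bounded (F ` {-L..L})"
    using assms by (intro compact_imp_bounded compact_continuous_image) auto
  then obtain B where "B > 0" "\<forall>x\<in>F ` {-L..L}. norm x \<le> B"
    using bounded_pos by blast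
  then show ?thesis by (intro that[of B]) (auto simp: abs_le_iff)
qed

lemma C1_lipschitz_on_interval:
  fixes F :: "real \<Rightarrow> real"
  assumes "F C1_differentiable_on UNIV"
  obtains K where "K > 0"
    "\<And>x y. \<bar>x\<bar> \<le> L \<Longrightarrow> \<bar>y\<bar> \<le> L \<Longrightarrow> \<bar>F x - F y\<bar> \<le> K * \<bar>x - y\<bar>"
proof -
  obtain K where K: "K > 0" "\<And>x. \<bar>x\<bar> \<le> L \<Longrightarrow> \<bar>deriv F x\<bar> \<le> K"
    using continuous_bounded_on_interval[OF C1_on_UNIV_D(2)[OF assms]] by metis
  have "\<bar>F x - F y\<bar> \<le> K * \<bar>x - y\<bar>" if "\<bar>x\<bar> \<le> L" "\<bar>y\<bar> \<le> L" for x y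
    using field_differentiable_bound[of "{-L..L}" F "deriv F" K x y] K that
    by (simp add: has_field_derivative_at_within[OF C1_on_UNIV_D(1)[OF assms]] abs_le_iff)
  with K(1) show ?thesis using that by blast
qed

definition clip :: "real \<Rightarrow> real \<Rightarrow> real" where
  "clip L x = max (- L) (min L x)"

lemma abs_clip_le: "L \<ge> 0 \<Longrightarrow> \<bar>clip L x\<bar> \<le> L" "L \<ge> 0 \<Longrightarrow> \<bar>clip L x\<bar> \<le> \<bar>x\<bar>"
  and clip_diff_le: "L \<ge> 0 \<Longrightarrow> \<bar>clip L x - clip L y\<bar> \<le> \<bar>x - y\<bar>"
  and clip_eq: "\<bar>x\<bar> \<le> L \<Longrightarrow> clip L x = x"
  by (auto simp: clip_def max_def min_def)

text \<open>The nonlinearity pushes back towards the origin outside \<open>[-A, A]\<close>. The function \<open>V\<close> below,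
  the energy plus \<open>(k/2) (y v + k y\<^sup>2/2)\<close>, decreases along solutions outside a box, and both the
  box and the resulting bound do not see the level \<open>L\<close> at which the nonlinearity has been cut off.\<close>

lemma truncated_solution_bound:
  fixes c k Gb A Fm :: real
  assumes c: "c > 0" and k: "k > 0" and Gb: "Gb \<ge> 0" and A: "A > 0" and F: "continuous_on UNIV F"
    and Fup: "\<And>y. y \<ge> A \<Longrightarrow> c * F y \<le> - (Gb + 1)"
    and Fdn: "\<And>y. y \<le> - A \<Longrightarrow> c * F y \<ge> Gb + 1"
  obtains Z where "Z > 0"
    "\<And>L g y v. L \<ge> A \<Longrightarrow> (\<And>t. \<bar>g t\<bar> \<le> Gb) \<Longrightarrow> y 0 = 0 \<Longrightarrow> v 0 = 0 \<Longrightarrow>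
       continuous_on {0..} y \<Longrightarrow> continuous_on {0..} v \<Longrightarrow>
       (\<And>t. t > 0 \<Longrightarrow> (y has_real_derivative v t) (at t)) \<Longrightarrow>
       (\<And>t. t > 0 \<Longrightarrow> (v has_real_derivative c * F (clip L (y t)) - k * v t + g t) (at t)) \<Longrightarrow>
       (\<forall>t\<ge>0. \<bar>y t\<bar> \<le> Z)"
proof -
  obtain Fm where Fm: "Fm > 0" "\<And>x. \<bar>x\<bar> \<le> A \<Longrightarrow> \<bar>F x\<bar> \<le> Fm"
    using continuous_bounded_on_interval continuous_on_subset[OF F] by (metis subset_UNIV)
  \<comment> \<open>The constants of the box: completing the square in the derivative of \<open>V\<close> gives
    \<open>(\<bar>v\<bar> - Gb / k)\<^sup>2 + \<bar>y\<bar> < Y1\<close> wherever \<open>V\<close> increases.\<close>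
  define C1 where "C1 = A * (c * Fm + Gb) + A"
  define Y1 where "Y1 = C1 + Gb\<^sup>2 / k\<^sup>2"
  define V1 where "V1 = Gb / k + 1 + Y1"
  have C1: "C1 > 0" unfolding C1_def using A c Fm Gb by (intro add_nonneg_pos mult_nonneg_nonneg) auto
  then have Y1: "Y1 > 0" unfolding Y1_def by (intro add_pos_nonneg) auto
  have V1: "V1 > 0" unfolding V1_def using Y1 Gb k by (intro add_nonneg_pos) auto
  obtain Fb where Fb: "Fb > 0" "\<And>x. \<bar>x\<bar> \<le> Y1 \<Longrightarrow> \<bar>F x\<bar> \<le> Fb"
    using continuous_bounded_on_interval continuous_on_subset[OF F] by (metis subset_UNIV)
  define Vm where "Vm = V1\<^sup>2 / 2 + c * (Y1 * Fb) + k / 2 * (Y1 * V1 + k / 2 * Y1\<^sup>2)"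
  have Vm: "Vm > 0" unfolding Vm_def using V1 c Y1 Fb k
    by (intro add_pos_nonneg mult_nonneg_nonneg) auto
  \<comment> \<open>The form \<open>v\<^sup>2/2 + k y v/2 + k\<^sup>2 y\<^sup>2/4\<close> dominates \<open>k\<^sup>2 y\<^sup>2/8\<close>, so a bound on \<open>V\<close> bounds \<open>y\<^sup>2\<close> by \<open>E\<close>.\<close>
  define E where "E = 8 * (Vm + c * (A * Fm)) / k\<^sup>2"
  have E: "E > 0" unfolding E_def using Vm c A Fm k by (simp add: add_pos_pos)
  have "\<forall>t\<ge>0. \<bar>y t\<bar> \<le> 1 + E"
    if L: "L \<ge> A" and g: "\<And>t. \<bar>g t\<bar> \<le> Gb" and y0: "y 0 = 0" and v0: "v 0 = 0"
      and yc: "continuous_on {0..} y" and vc: "continuous_on {0..} v"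
      and yd: "\<And>t. t > 0 \<Longrightarrow> (y has_real_derivative v t) (at t)"
      and vd: "\<And>t. t > 0 \<Longrightarrow> (v has_real_derivative c * F (clip L (y t)) - k * v t + g t) (at t)"
    for L g y v
  proof -
    define f where "f x = F (clip L x)" for x
    have f_cont: "continuous_on UNIV f"
      unfolding f_def clip_def
      by (rule continuous_on_compose2[OF F]) (auto intro!: continuous_intros)
    define \<Phi> where "\<Phi> = primitive f"
    have \<Phi>: "(\<Phi> has_real_derivative f x) (at x)" for x
      unfolding \<Phi>_def by (rule primitive_has_real_derivative[OF f_cont])
    have \<Phi>0: "\<Phi> 0 = 0" by (simp add: \<Phi>_def)
    have \<Phi>_bd: "\<bar>\<Phi> x\<bar> \<le> r * b" if "\<And>x. \<bar>x\<bar> \<le> r \<Longrightarrow> \<bar>f x\<bar> \<le> b" "\<bar>x\<bar> \<le> r" for x r b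
    proof -
      have "norm (\<Phi> x - \<Phi> 0) \<le> b * norm (x - 0)"
        by (rule field_differentiable_bound[of "{-r..r}" \<Phi> f])
          (use that \<Phi> in \<open>auto intro: DERIV_subset\<close>)
      also have "\<dots> \<le> b * r"
        using that(1)[OF that(2)] that(2) abs_ge_zero[of "f x"] by (intro mult_left_mono) (auto simp del: abs_ge_zero)
      finally show ?thesis by (simp add: \<Phi>0 mult.commute)
    qed
    have f_small: "\<bar>f x\<bar> \<le> b" if "\<And>x. \<bar>x\<bar> \<le> r \<Longrightarrow> \<bar>F x\<bar> \<le> b" "\<bar>x\<bar> \<le> r" for x r b
      unfolding f_def using that abs_clip_le(2)[of L x] L A by auto
    have f_up: "c * f x \<le> - (Gb + 1)" if "x \<ge> A" for x
      unfolding f_def using Fup[of "clip L x"] L A that by (auto simp: clip_def)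
    have f_dn: "c * f x \<ge> Gb + 1" if "x \<le> - A" for x
      unfolding f_def using Fdn[of "clip L x"] L A that by (auto simp: clip_def)
    \<comment> \<open>Beyond \<open>A\<close> the restoring force makes the primitive decrease away from the origin, so its maximum
      is attained in \<open>[-A, A]\<close>, out of reach of the cut-off.\<close>
    have \<Phi>_le: "\<Phi> x \<le> A * Fm" for x
    proof -
      have A1: "\<bar>\<Phi> x\<bar> \<le> A * Fm" if "\<bar>x\<bar> \<le> A" for x
        using \<Phi>_bd[of A Fm x] f_small[of A Fm] Fm that by auto
      consider "\<bar>x\<bar> \<le> A" | "x > A" | "x < - A" by linarith
      then show ?thesis
      proof cases
        case 1 then show ?thesis using A1[of x] by simp
      next
        case 2
        have "\<Phi> x \<le> \<Phi> A"
        proof (rule DERIV_nonpos_imp_nonincreasing[of A x])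
          fix r assume "A \<le> r"
          then have "c * f r \<le> 0" using f_up[of r] Gb by linarith
          then show "\<exists>y. DERIV \<Phi> r :> y \<and> y \<le> 0" using \<Phi> c by (auto simp: mult_le_0_iff)
        qed (use 2 in simp)
        then show ?thesis using A1[of A] A by simp
      next
        case 3
        have "\<Phi> x \<le> \<Phi> (-A)"
        proof (rule DERIV_nonneg_imp_nondecreasing[of x "-A"])
          fix r assume "r \<le> - A"
          then have "c * f r \<ge> 0" using f_dn[of r] Gb by linarith
          then show "\<exists>y. DERIV \<Phi> r :> y \<and> 0 \<le> y" using \<Phi> c by (auto simp: zero_le_mult_iff)
        qed (use 3 in simp)
        then show ?thesis using A1[of "-A"] A by simp
      qed
    qed
    have yf: "x * (c * f x + s) \<le> C1 - \<bar>x\<bar>" if s: "\<bar>s\<bar> \<le> Gb" for x s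
    proof -
      consider "\<bar>x\<bar> \<le> A" | "x > A" | "x < - A" by linarith
      then show ?thesis
      proof cases
        case 1
        have "\<bar>x * (c * f x + s)\<bar> \<le> A * (c * Fm + Gb)"
          unfolding abs_mult using 1 f_small[of A Fm x] Fm(2) c s
          by (intro mult_mono abs_triangle_ineq[THEN order_trans] add_mono) (auto simp: abs_mult)
        then show ?thesis using 1 unfolding C1_def by linarith
      next
        case 2
        then have "c * f x + s \<le> -1" using f_up[of x] s by linarith
        then have "x * (c * f x + s) \<le> x * (-1)" using 2 A by (intro mult_left_mono) auto
        then show ?thesis using C1 2 A by linarith
      next
        case 3
        then have "c * f x + s \<ge> 1" using f_dn[of x] s by linarith
        then have "x * (c * f x + s) \<le> x * 1" using 3 A by (intro mult_left_mono_neg) auto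
        then show ?thesis using C1 3 A by linarith
      qed
    qed
    define V where "V t = (v t)\<^sup>2 / 2 - c * \<Phi> (y t) + k / 2 * (y t * v t + k / 2 * (y t)\<^sup>2)" for t
    define V' where "V' t = g t * v t - k / 2 * (v t)\<^sup>2 + k / 2 * (y t * (c * f (y t) + g t))" for t
    have Vd: "(V has_real_derivative V' t) (at t)" if "t > 0" for t
      unfolding V_def V'_def
      using yd[OF that] vd[OF that, folded f_def]
      by (auto intro!: derivative_eq_intros DERIV_chain2[OF \<Phi>] simp: field_simps power2_eq_square)
    have V_le: "V t \<le> Vm" if "t \<ge> 0" for t
    proof (rule barrier_bound[where V = V and V' = V'])
      show "continuous_on {0..} V"
        unfolding V_def
        using continuous_on_compose2[OF continuous_on_primitive[OF f_cont] yc, of UNIV]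
        by (intro continuous_intros yc vc) (auto simp: \<Phi>_def)
      show "V 0 \<le> Vm" using Vm by (simp add: V_def y0 v0 \<Phi>0)
      show "V' t \<le> 0" if t: "t > 0" and big: "V t > Vm" for t
      proof (rule ccontr)
        assume "\<not> V' t \<le> 0"
        then have pos: "V' t > 0" by simp
        have "V' t \<le> Gb * \<bar>v t\<bar> - k / 2 * (v t)\<^sup>2 + k / 2 * (C1 - \<bar>y t\<bar>)"
          unfolding V'_def using yf[OF g[of t], of "y t"] k g[of t]
            mult_right_mono[OF g[of t], of "\<bar>v t\<bar>"] abs_ge_self[of "g t * v t"]
          by (intro add_mono diff_mono mult_left_mono) (auto simp: abs_mult)
        also have "\<dots> = k / 2 * (Y1 - (\<bar>v t\<bar> - Gb / k)\<^sup>2 - \<bar>y t\<bar>)"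
          unfolding Y1_def using k by (simp add: field_simps power2_eq_square)
        finally have "0 < k / 2 * (Y1 - (\<bar>v t\<bar> - Gb / k)\<^sup>2 - \<bar>y t\<bar>)"
          using pos by linarith
        then have *: "(\<bar>v t\<bar> - Gb / k)\<^sup>2 + \<bar>y t\<bar> < Y1"
          using k by (simp add: zero_less_mult_iff)
        then have y1: "\<bar>y t\<bar> \<le> Y1" by (smt (verit) zero_le_power2)
        have "(\<bar>v t\<bar> - Gb / k)\<^sup>2 < (1 + Y1)\<^sup>2"
          using * Y1 by (simp add: power2_eq_square algebra_simps) (smt (verit) mult_pos_pos)
        then have "\<bar>v t\<bar> - Gb / k < 1 + Y1" using Y1 by (simp add: power_less_imp_less_base)
        then have v1: "\<bar>v t\<bar> \<le> V1" unfolding V1_def by simp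
        have "\<bar>\<Phi> (y t)\<bar> \<le> Y1 * Fb" using \<Phi>_bd[of Y1 Fb] f_small[of Y1 Fb] Fb(2) y1 by blast
        then have p: "- c * \<Phi> (y t) \<le> c * (Y1 * Fb)"
          using mult_left_mono[of "- \<Phi> (y t)" "Y1 * Fb" c] c by simp
        have "(v t)\<^sup>2 \<le> V1\<^sup>2" "(y t)\<^sup>2 \<le> Y1\<^sup>2"
          using v1 y1 by (simp_all add: abs_le_square_iff[symmetric])
        moreover have "y t * v t \<le> Y1 * V1"
          using mult_mono[OF y1 v1] Y1 abs_ge_self[of "y t * v t"] by (simp add: abs_mult)
        ultimately have "V t \<le> Vm"
          unfolding V_def Vm_def diff_conv_add_uminus using p k
          by (intro add_mono divide_right_mono mult_left_mono) auto
        then show False using big by simp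
      qed
    qed (use Vd that in auto)
    show ?thesis
    proof (intro allI impI)
      fix t :: real assume t: "t \<ge> 0"
      have "V t = (v t + k * y t / 2)\<^sup>2 / 2 + k\<^sup>2 * (y t)\<^sup>2 / 8 - c * \<Phi> (y t)"
        unfolding V_def by (simp add: field_simps power2_eq_square)
      moreover have "c * \<Phi> (y t) \<le> c * (A * Fm)" using \<Phi>_le c by simp
      ultimately have "k\<^sup>2 * (y t)\<^sup>2 / 8 \<le> Vm + c * (A * Fm)"
        using V_le[OF t] by (smt (verit) zero_le_power2 divide_nonneg_pos)
      then have "(y t)\<^sup>2 \<le> E" unfolding E_def using k by (simp add: field_simps)
      also have "E < (1 + E)\<^sup>2" using E by (simp add: power2_eq_square algebra_simps) (smt (verit) mult_pos_pos)
      finally have "\<bar>y t\<bar>\<^sup>2 < (1 + E)\<^sup>2" by simp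
      then show "\<bar>y t\<bar> \<le> 1 + E" using E by (smt (verit) power_less_imp_less_base)
    qed
  qed
  then show ?thesis using that[of "1 + E"] E by fastforce
qed

text \<open>Cutting off at a level above the a priori bound gives a globally Lipschitz equation, along whose
  solution the cut-off is inactive.\<close>

lemma reduced_system_bounded_solution:
  fixes F g :: "real \<Rightarrow> real"
  assumes c: "c > 0" and k: "k > 0" and F: "F C1_differentiable_on UNIV"
    and Ftop: "filterlim F at_bot at_top" and Fbot: "filterlim F at_top at_bot"
    and g: "continuous_on UNIV g" and gb: "\<And>t. \<bar>g t\<bar> \<le> Gb"
  shows "\<exists>y v B. (\<forall>t>0. (y has_real_derivative v t) (at t)
      \<and> (v has_real_derivative c * F (y t) - k * v t + g t) (at t) \<and> \<bar>y t\<bar> \<le> B)"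
proof -
  have Gb: "Gb \<ge> 0" using gb[of 0] by linarith
  note Fc = C1_on_UNIV_D(3)[OF F]
  have "eventually (\<lambda>y. F y \<le> - (Gb + 1) / c) at_top" using Ftop by (simp add: filterlim_at_bot)
  then obtain A1 where A1: "\<And>y. y \<ge> A1 \<Longrightarrow> F y \<le> - (Gb + 1) / c"
    unfolding eventually_at_top_linorder by blast
  have "eventually (\<lambda>y. F y \<ge> (Gb + 1) / c) at_bot" using Fbot by (simp add: filterlim_at_top)
  then obtain A2 where A2: "\<And>y. y \<le> A2 \<Longrightarrow> F y \<ge> (Gb + 1) / c"
    unfolding eventually_at_bot_linorder by blast
  define A where "A = \<bar>A1\<bar> + \<bar>A2\<bar> + 1"
  have A: "A > 0" by (simp add: A_def)
  have Fup: "c * F y \<le> - (Gb + 1)" if "y \<ge> A" for y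
    using A1[of y] that c by (simp add: A_def field_simps)
  have Fdn: "c * F y \<ge> Gb + 1" if "y \<le> - A" for y
    using A2[of y] that c by (simp add: A_def field_simps)
  obtain Z where Z: "Z > 0" and Zbd:
    "\<And>L g y v. L \<ge> A \<Longrightarrow> (\<And>t. \<bar>g t\<bar> \<le> Gb) \<Longrightarrow> y 0 = 0 \<Longrightarrow> v 0 = 0 \<Longrightarrow>
       continuous_on {0..} y \<Longrightarrow> continuous_on {0..} v \<Longrightarrow>
       (\<And>t. t > 0 \<Longrightarrow> (y has_real_derivative v t) (at t)) \<Longrightarrow>
       (\<And>t. t > 0 \<Longrightarrow> (v has_real_derivative c * F (clip L (y t)) - k * v t + g t) (at t)) \<Longrightarrow>
       (\<forall>t\<ge>0. \<bar>y t\<bar> \<le> Z)"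
    using truncated_solution_bound[OF c k Gb A Fc Fup Fdn] by metis
  define L where "L = A + Z"
  have L: "L > 0" using A Z by (simp add: L_def)
  obtain K where K: "K > 0"
    and Klip: "\<And>x y. \<bar>x\<bar> \<le> L \<Longrightarrow> \<bar>y\<bar> \<le> L \<Longrightarrow> \<bar>F x - F y\<bar> \<le> K * \<bar>x - y\<bar>"
    using C1_lipschitz_on_interval[OF F] by metis
  define f where "f t x = (snd x, c * F (clip L (fst x)) - k * snd x + g t)" for t and x :: "real \<times> real"
  define M where "M = 1 + c * K + k"
  have "\<exists>x. x 0 = (0, 0) \<and> continuous_on UNIV x
    \<and> (\<forall>t>0. (x has_vector_derivative f t (x t)) (at t))"
  proof (rule lipschitz_ode_global_solution)
    have "continuous_on UNIV (\<lambda>z::real \<times> real \<times> real. F (clip L (fst (snd z))))"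
      unfolding clip_def by (rule continuous_on_compose2[OF Fc[of UNIV]]) (auto intro!: continuous_intros)
    moreover have "continuous_on UNIV (\<lambda>z::real \<times> real \<times> real. g (fst z))"
      by (rule continuous_on_compose2[OF g]) (auto intro!: continuous_intros)
    ultimately show "continuous_on UNIV (\<lambda>(t, x). f t x)"
      unfolding f_def case_prod_beta by (intro continuous_intros)
    show "M > 0" unfolding M_def using c K k by (simp add: add_pos_pos)
    show "norm (f t x - f t y) \<le> M * norm (x - y)" for t x y
    proof -
      have component: "\<bar>fst z\<bar> \<le> norm z" "\<bar>snd z\<bar> \<le> norm z" for z :: "real \<times> real"
        using norm_fst_le[of "fst z" "snd z"] norm_snd_le[of "snd z" "fst z"] by simp_all
      have "norm (f t x - f t y) \<le> \<bar>snd x - snd y\<bar>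
          + \<bar>c * (F (clip L (fst x)) - F (clip L (fst y))) - k * (snd x - snd y)\<bar>"
        using norm_Pair_le[of "snd x - snd y" "c * (F (clip L (fst x)) - F (clip L (fst y))) - k * (snd x - snd y)"]
        by (simp add: f_def algebra_simps)
      also have "\<dots> \<le> \<bar>snd x - snd y\<bar> + (c * (K * \<bar>fst x - fst y\<bar>) + k * \<bar>snd x - snd y\<bar>)"
      proof (intro add_left_mono order_trans[OF abs_triangle_ineq4] add_mono)
        have "\<bar>F (clip L (fst x)) - F (clip L (fst y))\<bar> \<le> K * \<bar>clip L (fst x) - clip L (fst y)\<bar>"
          using Klip abs_clip_le(1)[of L] L by simp
        also have "\<dots> \<le> K * \<bar>fst x - fst y\<bar>"
          using K clip_diff_le L by simp
        finally show "\<bar>c * (F (clip L (fst x)) - F (clip L (fst y)))\<bar> \<le> c * (K * \<bar>fst x - fst y\<bar>)"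
          using c by (simp add: abs_mult)
      qed (use k in \<open>simp add: abs_mult\<close>)
      also have "\<dots> \<le> norm (x - y) + (c * (K * norm (x - y)) + k * norm (x - y))"
        using c K k component[of "x - y"]
        by (intro add_mono mult_left_mono) auto
      finally show ?thesis by (simp add: M_def algebra_simps)
    qed
    show "norm (f t 0) \<le> c * \<bar>F 0\<bar> + Gb" for t
      unfolding f_def using c gb[of t] L abs_triangle_ineq[of "c * F 0" "g t"]
      by (simp add: clip_eq abs_mult norm_Pair)
  qed
  then obtain x where x: "x 0 = (0, 0)" "continuous_on UNIV x"
    "\<And>t. t > 0 \<Longrightarrow> (x has_vector_derivative f t (x t)) (at t)" by blast
  define y where "y t = fst (x t)" for t
  define v where "v t = snd (x t)" for t
  have yd: "(y has_real_derivative v t) (at t)" if "t > 0" for t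
    using bounded_linear.has_vector_derivative[OF bounded_linear_fst x(3)[OF that]]
    unfolding y_def v_def f_def has_real_derivative_iff_has_vector_derivative by simp
  have vd: "(v has_real_derivative c * F (clip L (y t)) - k * v t + g t) (at t)" if "t > 0" for t
    using bounded_linear.has_vector_derivative[OF bounded_linear_snd x(3)[OF that]]
    unfolding y_def v_def f_def has_real_derivative_iff_has_vector_derivative by simp
  have "\<forall>t\<ge>0. \<bar>y t\<bar> \<le> Z"
  proof (rule Zbd[where L = L and g = g and v = v])
    show "continuous_on {0..} y" "continuous_on {0..} v"
      unfolding y_def v_def using continuous_on_subset[OF x(2)] by (auto intro!: continuous_intros)
    show "y 0 = 0" "v 0 = 0" by (simp_all add: y_def v_def x(1))
  qed (use Z gb yd vd in \<open>auto simp: L_def\<close>)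
  then have "(y has_real_derivative v t) (at t)
      \<and> (v has_real_derivative c * F (y t) - k * v t + g t) (at t) \<and> \<bar>y t\<bar> \<le> Z" if "t > 0" for t
  proof -
    have "\<bar>y t\<bar> \<le> Z" using \<open>\<forall>t\<ge>0. \<bar>y t\<bar> \<le> Z\<close> that by simp
    moreover from this have "clip L (y t) = y t" using A by (intro clip_eq) (simp add: L_def)
    ultimately show ?thesis using yd[OF that] vd[OF that] by simp
  qed
  then show ?thesis by blast
qed

section \<open>Exponential contraction of solutions\<close>

text \<open>The force is a parameter, so that it can be replaced by its periodic extension.\<close>

definition forced_system ::
    "real \<Rightarrow> real \<Rightarrow> (real \<Rightarrow> real) \<Rightarrow> (real \<Rightarrow> real) \<Rightarrow> (real \<Rightarrow> real) \<Rightarrow> (real \<Rightarrow> real) \<Rightarrow> bool"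
  where
  "forced_system c k F g y v \<longleftrightarrow> (\<forall>t>0. (y has_real_derivative v t) (at t)
     \<and> (v has_real_derivative c * F (y t) - k * v t + g t) (at t))"

definition exp_close ::
    "(real \<Rightarrow> real) \<Rightarrow> (real \<Rightarrow> real) \<Rightarrow> (real \<Rightarrow> real) \<Rightarrow> (real \<Rightarrow> real) \<Rightarrow> bool" where
  "exp_close y1 v1 y2 v2 \<longleftrightarrow> (\<exists>K r T. r > 0 \<and> T > 0
     \<and> (\<forall>t\<ge>T. (y1 t - y2 t)\<^sup>2 + (v1 t - v2 t)\<^sup>2 \<le> K * exp (- r * t)))"

text \<open>Dissipation and the upper bound give \<open>V' \<le> - (\<mu> / C) V\<close>, so \<open>V exp (\<mu> t / C)\<close> does not increase.\<close>

lemma lyapunov_exponential_decay: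
  fixes V V' e :: "real \<Rightarrow> real"
  assumes der: "\<And>t. t \<ge> T \<Longrightarrow> (V has_real_derivative V' t) (at t)"
    and pos: "\<alpha> > 0" "C > 0" "\<mu> > 0"
    and lower: "\<And>t. t \<ge> T \<Longrightarrow> \<alpha> * e t \<le> V t"
    and upper: "\<And>t. t \<ge> T \<Longrightarrow> V t \<le> C * e t"
    and diss: "\<And>t. t \<ge> T \<Longrightarrow> V' t \<le> - \<mu> * e t"
  shows "\<exists>K r. r > 0 \<and> (\<forall>t\<ge>T. e t \<le> K * exp (- r * t))"
proof -
  define r where "r = \<mu> / C"
  have r: "r > 0" using pos by (simp add: r_def)
  have "e t \<le> V T * exp (r * T) / \<alpha> * exp (- r * t)" if t: "t \<ge> T" for t
  proof -
    have "V t * exp (r * t) \<le> V T * exp (r * T)"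
    proof (rule DERIV_nonpos_imp_nonincreasing[OF t])
      fix s assume s: "T \<le> s"
      have "r * V s \<le> r * (C * e s)" using upper[OF s] r by simp
      also have "\<dots> = \<mu> * e s" using pos by (simp add: r_def)
      finally have "V' s + r * V s \<le> 0" using diss[OF s] by simp
      then have "(V' s + r * V s) * exp (r * s) \<le> 0" by (simp add: mult_le_0_iff)
      moreover have "((\<lambda>s. V s * exp (r * s)) has_real_derivative (V' s + r * V s) * exp (r * s)) (at s)"
        using der[OF s] by (auto intro!: derivative_eq_intros simp: algebra_simps)
      ultimately show "\<exists>y. ((\<lambda>s. V s * exp (r * s)) has_real_derivative y) (at s) \<and> y \<le> 0" by blast
    qed
    then have "V t \<le> V T * exp (r * T) * exp (- r * t)" by (simp add: exp_minus field_simps)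
    then show ?thesis using lower[OF t] pos by (simp add: field_simps)
  qed
  then show ?thesis using r by blast
qed

lemma abs_mult_le_half_squares: "\<bar>x * y\<bar> \<le> (x\<^sup>2 + y\<^sup>2) / 2" for x y :: real
  using sum_squares_bound[of "\<bar>x\<bar>" "\<bar>y\<bar>"] by (simp add: abs_mult)

text \<open>If the difference quotient of \<open>-c F\<close> stays in \<open>[k\<^sup>2/2 - 1, 1]\<close>, the difference
  \<open>(w, z)\<close> of two solutions obeys \<open>z' = -k z - q w\<close> with \<open>q\<close> in this interval. As \<open>q \<le> 1 < k\<^sup>2\<close>,
  one quadratic form is a Lyapunov function for all these \<open>q\<close> at once.\<close>

lemma contraction_F2:
  assumes F2: "condition_F2 c k F" and k: "k > 0"
    and s1: "forced_system c k F g y1 v1" and s2: "forced_system c k F g y2 v2"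
  shows "exp_close y1 v1 y2 v2"
proof -
  have k2: "k\<^sup>2 > 2" "k\<^sup>2 \<le> 4" using F2 by (auto simp: condition_F2_def)
  have k1: "k > 1" using k2(1) k by (smt (verit) power2_eq_square mult_le_one)
  define q0 where "q0 = k\<^sup>2 / 2 - 1"
  have q0: "0 < q0" "q0 \<le> 1" using k2 by (auto simp: q0_def)
  define w where "w t = y1 t - y2 t" for t
  define z where "z t = v1 t - v2 t" for t
  define V where "V t = (z t)\<^sup>2 + k * w t * z t + k\<^sup>2 / 2 * (w t)\<^sup>2" for t
  define D where "D t = c * (F (y1 t) - F (y2 t))" for t
  define V' where "V' t = (2 * z t + k * w t) * (D t - k * z t) + k * (z t)\<^sup>2 + k\<^sup>2 * w t * z t" for t
  have "\<exists>K r. r > 0 \<and> (\<forall>t\<ge>1. (w t)\<^sup>2 + (z t)\<^sup>2 \<le> K * exp (- r * t))"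
  proof (rule lyapunov_exponential_decay[where V = V and V' = V'])
    fix t :: real assume t: "t \<ge> 1"
    have d1: "(y1 has_real_derivative v1 t) (at t)" "(v1 has_real_derivative c * F (y1 t) - k * v1 t + g t) (at t)"
      and d2: "(y2 has_real_derivative v2 t) (at t)" "(v2 has_real_derivative c * F (y2 t) - k * v2 t + g t) (at t)"
      using s1 s2 t by (simp_all add: forced_system_def)
    have wd: "(w has_real_derivative z t) (at t)"
      and zd: "(z has_real_derivative D t - k * z t) (at t)"
      unfolding w_def z_def D_def using DERIV_diff[OF d1(1) d2(1)] DERIV_diff[OF d1(2) d2(2)]
      by (simp_all add: algebra_simps)
    show "(V has_real_derivative V' t) (at t)"
      unfolding V_def V'_def using wd zd
      by (auto intro!: derivative_eq_intros simp: field_simps power2_eq_square)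
    \<comment> \<open>The difference quotient is undefined where the solutions meet; there any admissible \<open>q\<close> works.\<close>
    obtain q where q: "q0 \<le> q" "q \<le> 1" "D t = - q * w t"
    proof (cases "y1 t = y2 t")
      case True
      then show ?thesis using that[of 1] q0 by (simp add: D_def w_def)
    next
      case False
      have "k\<^sup>2 / 2 - 1 \<le> - c * ((F (y1 t) - F (y2 t)) / (y1 t - y2 t)) \<and>
         - c * ((F (y1 t) - F (y2 t)) / (y1 t - y2 t)) \<le> 1"
        using F2 False unfolding condition_F2_def by metis
      then show ?thesis
        using that[of "- c * ((F (y1 t) - F (y2 t)) / (y1 t - y2 t))"] False
        by (simp add: D_def w_def q0_def)
    qed
    have "V' t = - (k * (z t)\<^sup>2 + 2 * q * (w t * z t) + k * q * (w t)\<^sup>2)"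
      unfolding V'_def q(3) by (simp add: algebra_simps power2_eq_square)
    moreover have "2 * q * (w t * z t) \<ge> - q * ((w t)\<^sup>2 + (z t)\<^sup>2)"
      using mult_left_mono[of "- ((w t)\<^sup>2 + (z t)\<^sup>2)" "2 * (w t * z t)" q]
        abs_mult_le_half_squares[of "w t" "z t"] q q0 by (simp add: abs_le_iff algebra_simps)
    moreover have "(k - q) * (z t)\<^sup>2 \<ge> ((k - 1) * q0) * (z t)\<^sup>2"
    proof (intro mult_right_mono)
      have "(k - 1) * q0 \<le> (k - 1) * 1" using q0 k1 by (intro mult_left_mono) auto
      then show "(k - 1) * q0 \<le> k - q" using q(2) unfolding mult_1_right by linarith
    qed simp
    moreover have "((k - 1) * q) * (w t)\<^sup>2 \<ge> ((k - 1) * q0) * (w t)\<^sup>2"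
      using q q0 k1 by (intro mult_right_mono) auto
    ultimately show "V' t \<le> - ((k - 1) * q0) * ((w t)\<^sup>2 + (z t)\<^sup>2)"
      by (simp add: algebra_simps)
    have "V t = (z t)\<^sup>2 / 3 + 2 / 3 * (z t + 3 * k / 4 * w t)\<^sup>2 + k\<^sup>2 / 8 * (w t)\<^sup>2"
      unfolding V_def by (simp add: field_simps power2_eq_square)
    moreover have "k\<^sup>2 / 8 * (w t)\<^sup>2 \<ge> 1 / 4 * (w t)\<^sup>2"
      using k2 by (intro mult_right_mono) auto
    moreover have "2 / 3 * (z t + 3 * k / 4 * w t)\<^sup>2 \<ge> 0" "(z t)\<^sup>2 \<ge> 0" by simp_all
    ultimately show "1 / 4 * ((w t)\<^sup>2 + (z t)\<^sup>2) \<le> V t"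
      by (simp only: distrib_left)
    have "k * (w t * z t) \<le> k * (((w t)\<^sup>2 + (z t)\<^sup>2) / 2)"
      using abs_mult_le_half_squares[of "w t" "z t"] k by (intro mult_left_mono) auto
    also have "\<dots> = k * (w t)\<^sup>2 / 2 + k * (z t)\<^sup>2 / 2"
      by (simp add: algebra_simps add_divide_distrib)
    finally have h1: "k * (w t * z t) \<le> k * (w t)\<^sup>2 / 2 + k * (z t)\<^sup>2 / 2" .
    have h2: "k\<^sup>2 / 2 * (w t)\<^sup>2 \<le> 2 * (w t)\<^sup>2" using k2 by (intro mult_right_mono) auto
    have h3: "0 \<le> k * (w t)\<^sup>2" "0 \<le> k * (z t)\<^sup>2" "0 \<le> (z t)\<^sup>2" using k by auto
    have "V t \<le> 2 * (w t)\<^sup>2 + 2 * (z t)\<^sup>2 + k * (w t)\<^sup>2 + k * (z t)\<^sup>2"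
      unfolding V_def mult.assoc[of k "w t"] using h1 h2 h3 by linarith
    then show "V t \<le> (2 + k) * ((w t)\<^sup>2 + (z t)\<^sup>2)"
      by (simp add: algebra_simps)
  qed (use k k1 q0 in auto)
  then show ?thesis
    unfolding exp_close_def w_def z_def using zero_less_one by metis
qed

text \<open>Here \<open>z' = -k z - q w\<close> where \<open>q\<close>, an average of \<open>-c F'\<close> over the segment between the two
  solutions, satisfies \<open>\<bar>q'\<bar> \<le> N S q\<close>. The energy \<open>z\<^sup>2/q + w\<^sup>2\<close> has derivative
  \<open>-(2 k + q'/q) z\<^sup>2/q\<close>, which is negative because \<open>N S < 2 k\<close>. A small multiple of \<open>w z\<close> makes
  the dissipation strict in \<open>w\<close> too.\<close>

lemma contraction_in_box:
  assumes c: "c > 0" and k: "k > 0"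
    and F: "F C1_differentiable_on UNIV" and dF: "deriv F C1_differentiable_on UNIV"
    and M: "M > 0" and N: "N \<ge> 0" and S: "S \<ge> 0"
    and neg: "\<And>y. \<bar>y\<bar> \<le> M \<Longrightarrow> deriv F y < 0"
    and ratio: "\<And>y. \<bar>y\<bar> \<le> M \<Longrightarrow> \<bar>deriv (deriv F) y\<bar> \<le> S * \<bar>deriv F y\<bar>"
    and kNS: "2 * k > N * S" and T: "T > 0"
    and s1: "forced_system c k F g y1 v1" and s2: "forced_system c k F g y2 v2"
    and b1: "\<And>t. t \<ge> T \<Longrightarrow> \<bar>y1 t\<bar> \<le> M \<and> \<bar>v1 t\<bar> \<le> N"
    and b2: "\<And>t. t \<ge> T \<Longrightarrow> \<bar>y2 t\<bar> \<le> M \<and> \<bar>v2 t\<bar> \<le> N"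
  shows "exp_close y1 v1 y2 v2"
proof -
  note F1 = C1_on_UNIV_D[OF F] and F2 = C1_on_UNIV_D[OF dF]
  obtain q1 where q1: "q1 > 0" "\<And>x. \<bar>x\<bar> \<le> M \<Longrightarrow> - c * deriv F x \<le> q1"
  proof -
    obtain B where "B > 0" "\<And>x. \<bar>x\<bar> \<le> M \<Longrightarrow> \<bar>deriv F x\<bar> \<le> B"
      using continuous_bounded_on_interval[OF F1(2)] by metis
    moreover from this have "- c * deriv F x \<le> c * B" if "\<bar>x\<bar> \<le> M" for x
      using that c mult_left_mono[of "- deriv F x" B c] by (simp add: abs_le_iff)
    ultimately show ?thesis using c by (intro that[of "c * B"]) auto
  qed
  obtain q0 where q0: "q0 > 0" "\<And>x. \<bar>x\<bar> \<le> M \<Longrightarrow> q0 \<le> - c * deriv F x"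
  proof -
    have "continuous_on {-M..M} (\<lambda>x. - c * deriv F x)" by (intro continuous_intros F1)
    then obtain x0 where "x0 \<in> {-M..M}" "\<forall>x\<in>{-M..M}. - c * deriv F x0 \<le> - c * deriv F x"
      using continuous_attains_inf[of "{-M..M}" "\<lambda>x. - c * deriv F x"] M by auto
    then show ?thesis using c neg[of x0]
      by (intro that[of "- c * deriv F x0"]) (auto simp: abs_le_iff mult_less_0_iff)
  qed
  define w where "w t = y1 t - y2 t" for t
  define z where "z t = v1 t - v2 t" for t
  define p where "p t \<theta> = y2 t + \<theta> * w t" for t \<theta>
  define p' where "p' t \<theta> = v2 t + \<theta> * z t" for t \<theta>
  define q where "q t = - c * integral {0..1} (\<lambda>\<theta>. deriv F (p t \<theta>))" for t
  define q' where "q' t = - c * integral {0..1} (\<lambda>\<theta>. deriv (deriv F) (p t \<theta>) * p' t \<theta>)" for t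
  have yd: "(y1 has_real_derivative v1 t) (at t)" "(y2 has_real_derivative v2 t) (at t)"
    and vd: "(v1 has_real_derivative c * F (y1 t) - k * v1 t + g t) (at t)"
      "(v2 has_real_derivative c * F (y2 t) - k * v2 t + g t) (at t)" if "t > 0" for t
    using s1 s2 that by (auto simp: forced_system_def)
  have wd: "(w has_real_derivative z t) (at t)" if "t > 0" for t
    unfolding w_def z_def using yd[OF that] by (auto intro!: derivative_eq_intros)
  have cont: "continuous_on {0<..} y2" "continuous_on {0<..} w" "continuous_on {0<..} v2"
      "continuous_on {0<..} z"
  proof -
    have c: "continuous_on {0<..} h" if "\<And>t. t > 0 \<Longrightarrow> (h has_real_derivative h' t) (at t)"
      for h h' :: "real \<Rightarrow> real"
      by (rule DERIV_continuous_on[where D = h']) (simp add: that has_field_derivative_at_within)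
    show "continuous_on {0<..} y2" "continuous_on {0<..} w" "continuous_on {0<..} v2"
        "continuous_on {0<..} z"
      unfolding w_def z_def
      using c[of y1 v1, OF yd(1)] c[of y2 v2, OF yd(2)] c[of v1, OF vd(1)] c[of v2, OF vd(2)]
      by (simp_all add: continuous_on_diff)
  qed
  have p_le: "\<bar>p t \<theta>\<bar> \<le> M" "\<bar>p' t \<theta>\<bar> \<le> N" if "t \<ge> T" "0 \<le> \<theta>" "\<theta> \<le> 1" for t \<theta>
  proof -
    have "\<bar>(1 - \<theta>) * a + \<theta> * b\<bar> \<le> R" if "\<bar>a\<bar> \<le> R" "\<bar>b\<bar> \<le> R" for a b R
      using convex_bound_le[of "\<bar>a\<bar>" R "\<bar>b\<bar>" "1 - \<theta>" \<theta>] that \<open>0 \<le> \<theta>\<close> \<open>\<theta> \<le> 1\<close>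
        abs_triangle_ineq[of "(1 - \<theta>) * a" "\<theta> * b"] by (simp add: abs_mult)
    from this[of "y2 t" M "y1 t"] this[of "v2 t" N "v1 t"]
    show "\<bar>p t \<theta>\<bar> \<le> M" "\<bar>p' t \<theta>\<bar> \<le> N"
      using b1[OF \<open>t \<ge> T\<close>] b2[OF \<open>t \<ge> T\<close>] by (auto simp: p_def p'_def w_def z_def algebra_simps)
  qed
  have int1: "(\<lambda>\<theta>. deriv F (p t \<theta>)) integrable_on {0..1}" for t
    unfolding p_def
    by (intro integrable_continuous_real continuous_on_compose2[OF F1(2)[of UNIV]] continuous_intros) auto
  have int2: "(\<lambda>\<theta>. deriv (deriv F) (p t \<theta>) * p' t \<theta>) integrable_on {0..1}" for t
    unfolding p_def p'_def
    by (intro integrable_continuous_real continuous_intros continuous_on_compose2[OF F2(2)[of UNIV]]) auto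
  have qd: "(q has_real_derivative q' t) (at t)" if t: "t > 0" for t
  proof -
    have "((\<lambda>t. integral (cbox 0 1) (\<lambda>\<theta>. deriv F (p t \<theta>))) has_real_derivative
        integral (cbox 0 1) (\<lambda>\<theta>. deriv (deriv F) (p t \<theta>) * p' t \<theta>)) (at t within {0<..})"
    proof (rule leibniz_rule_field_derivative)
      fix s \<theta> :: real assume "s \<in> {0<..}"
      then have "((\<lambda>s. p s \<theta>) has_real_derivative p' s \<theta>) (at s)"
        unfolding p_def p'_def using yd wd by (auto intro!: derivative_eq_intros)
      then show "((\<lambda>s. deriv F (p s \<theta>)) has_real_derivative
          deriv (deriv F) (p s \<theta>) * p' s \<theta>) (at s within {0<..})"
        by (rule has_field_derivative_at_within[OF DERIV_chain2[OF F2(1)]])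
    next
      have cfst: "continuous_on ({0<..} \<times> cbox 0 1) (\<lambda>x::real \<times> real. h (fst x))"
        if "continuous_on {0<..} h" for h :: "real \<Rightarrow> real"
        by (rule continuous_on_compose2[OF that]) (auto intro!: continuous_intros)
      show "continuous_on ({0<..} \<times> cbox 0 1) (\<lambda>(t, \<theta>). deriv (deriv F) (p t \<theta>) * p' t \<theta>)"
        unfolding p_def p'_def case_prod_beta
        by (intro continuous_intros cfst cont continuous_on_compose2[OF F2(2)[of UNIV]]) auto
    qed (use t int1 in auto)
    moreover have "at t within {0<..} = at t" using t by (intro at_within_open) auto
    ultimately show ?thesis
      unfolding q_def q'_def by (auto intro!: derivative_eq_intros)
  qed
  \<comment> \<open>The difference of the forces is the integral of the derivative along the segment.\<close>
  have qw: "c * (F (y1 t) - F (y2 t)) = - q t * w t" for t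
  proof -
    have "((\<lambda>\<theta>. deriv F (p t \<theta>) * w t) has_integral (F (p t 1) - F (p t 0))) {0..1}"
    proof (rule fundamental_theorem_of_calculus)
      fix \<theta> :: real
      have "((\<lambda>\<theta>. F (p t \<theta>)) has_real_derivative deriv F (p t \<theta>) * w t) (at \<theta>)"
        by (rule DERIV_chain2[OF F1(1)]) (auto simp: p_def intro!: derivative_eq_intros)
      then show "((\<lambda>\<theta>. F (p t \<theta>)) has_vector_derivative deriv F (p t \<theta>) * w t) (at \<theta> within {0..1})"
        by (auto simp: has_real_derivative_iff_has_vector_derivative[symmetric]
            intro: has_field_derivative_at_within)
    qed simp
    then have "integral {0..1} (\<lambda>\<theta>. deriv F (p t \<theta>) * w t) = F (y1 t) - F (y2 t)"
      by (auto simp: p_def w_def dest: integral_unique)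
    then show ?thesis by (simp add: q_def)
  qed
  have q_bd: "q0 \<le> q t" "q t \<le> q1" if t: "t \<ge> T" for t
  proof -
    have q_alt: "q t = integral {0..1} (\<lambda>\<theta>. - c * deriv F (p t \<theta>))"
      unfolding q_def by simp
    have i: "(\<lambda>\<theta>. - c * deriv F (p t \<theta>)) integrable_on {0..1}"
      using integrable_on_cmult_left[OF int1, of "- c"] by simp
    have "integral {0..1} (\<lambda>\<theta>::real. q0) \<le> q t"
      unfolding q_alt using p_le(1)[OF t] q0(2) by (intro integral_le i) auto
    then show "q0 \<le> q t" by simp
    have "q t \<le> integral {0..1} (\<lambda>\<theta>::real. q1)"
      unfolding q_alt using p_le(1)[OF t] q1(2) by (intro integral_le i) auto
    then show "q t \<le> q1" by simp
  qed
  have q'_bd: "\<bar>q' t\<bar> \<le> N * S * q t" if t: "t \<ge> T" for t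
  proof -
    have "norm (integral {0..1} (\<lambda>\<theta>. deriv (deriv F) (p t \<theta>) * p' t \<theta>))
        \<le> integral {0..1} (\<lambda>\<theta>. - N * S * deriv F (p t \<theta>))"
    proof (rule integral_norm_bound_integral[OF int2])
      show "(\<lambda>\<theta>. - N * S * deriv F (p t \<theta>)) integrable_on {0..1}"
        using integrable_on_cmult_left[OF int1, of "- N * S"] by simp
      fix \<theta> :: real assume \<theta>: "\<theta> \<in> {0..1}"
      have "\<bar>deriv (deriv F) (p t \<theta>)\<bar> * \<bar>p' t \<theta>\<bar> \<le> S * \<bar>deriv F (p t \<theta>)\<bar> * N"
        using ratio[of "p t \<theta>"] p_le[OF t, of \<theta>] \<theta> S by (intro mult_mono) auto
      then show "norm (deriv (deriv F) (p t \<theta>) * p' t \<theta>) \<le> - N * S * deriv F (p t \<theta>)"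
        using neg[of "p t \<theta>"] p_le[OF t, of \<theta>] \<theta> by (simp add: abs_mult algebra_simps)
    qed
    then have "c * \<bar>integral {0..1} (\<lambda>\<theta>. deriv (deriv F) (p t \<theta>) * p' t \<theta>)\<bar>
        \<le> c * (- N * S * integral {0..1} (\<lambda>\<theta>. deriv F (p t \<theta>)))"
      using c by (intro mult_left_mono) auto
    then show ?thesis using c by (simp add: q'_def q_def abs_mult algebra_simps)
  qed
  define \<delta> where "\<delta> = 2 * k - N * S"
  have \<delta>: "\<delta> > 0" using kNS by (simp add: \<delta>_def)
  define H where "H = 1 + k\<^sup>2 / (2 * q0)"
  have H: "H > 0" unfolding H_def using q0 by (intro add_pos_nonneg) auto
  \<comment> \<open>The first bound keeps the cross term below half of the dissipation in \<open>z\<close>, the others keep \<open>V\<close>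
    positive definite.\<close>
  define \<epsilon> where "\<epsilon> = min (\<delta> / (2 * q1 * H)) (min 1 (1 / q1))"
  have \<epsilon>: "\<epsilon> > 0" "\<epsilon> \<le> 1" "\<epsilon> \<le> 1 / q1" "\<epsilon> * H \<le> \<delta> / (2 * q1)"
  proof -
    show "\<epsilon> > 0" "\<epsilon> \<le> 1" "\<epsilon> \<le> 1 / q1" using \<delta> H q1 by (auto simp: \<epsilon>_def)
    have "\<epsilon> \<le> \<delta> / (2 * q1 * H)" by (simp add: \<epsilon>_def)
    then show "\<epsilon> * H \<le> \<delta> / (2 * q1)" using H q1 by (simp add: field_simps)
  qed
  define V where "V t = (z t)\<^sup>2 / q t + (w t)\<^sup>2 + \<epsilon> * (w t * z t)" for t
  define V' where "V' t = - (2 * k + q' t / q t) * ((z t)\<^sup>2 / q t)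
      + \<epsilon> * (z t)\<^sup>2 - \<epsilon> * (k * (w t * z t)) - \<epsilon> * (q t * (w t)\<^sup>2)" for t
  have "\<exists>K r. r > 0 \<and> (\<forall>t\<ge>T. (w t)\<^sup>2 + (z t)\<^sup>2 \<le> K * exp (- r * t))"
  proof (rule lyapunov_exponential_decay[where V = V and V' = V'])
    fix t :: real assume t: "t \<ge> T"
    have q_pos: "q t > 0" using q_bd(1)[OF t] q0 by simp
    have t0: "t > 0" using t T by simp
    have zd: "(z has_real_derivative - q t * w t - k * z t) (at t)"
    proof -
      have "(z has_real_derivative (c * (F (y1 t) - F (y2 t)) - k * z t)) (at t)"
        unfolding z_def using vd[OF t0] by (auto intro!: derivative_eq_intros simp: algebra_simps)
      then show ?thesis by (simp add: qw)
    qed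
    show "(V has_real_derivative V' t) (at t)"
      unfolding V_def V'_def using wd[OF t0] zd qd[OF t0] q_pos
      by (auto intro!: derivative_eq_intros simp: field_simps power2_eq_square)
    have wz: "\<bar>w t * z t\<bar> \<le> ((w t)\<^sup>2 + (z t)\<^sup>2) / 2" by (rule abs_mult_le_half_squares)
    have zq: "(z t)\<^sup>2 / q1 \<le> (z t)\<^sup>2 / q t" "(z t)\<^sup>2 / q t \<le> (z t)\<^sup>2 / q0"
      using q_bd[OF t] q_pos q0 by (auto intro!: divide_left_mono)
    have ez: "\<epsilon> * ((z t)\<^sup>2 / 2) \<le> 1 / q1 * ((z t)\<^sup>2 / 2)" "\<epsilon> * ((w t)\<^sup>2 / 2) \<le> 1 * ((w t)\<^sup>2 / 2)"
        "\<epsilon> * ((z t)\<^sup>2 / 2) \<le> 1 * ((z t)\<^sup>2 / 2)"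
      by (rule mult_right_mono; use \<epsilon> in simp)+
    have ewz: "\<bar>\<epsilon> * (w t * z t)\<bar> \<le> \<epsilon> * ((w t)\<^sup>2 / 2) + \<epsilon> * ((z t)\<^sup>2 / 2)"
      using mult_left_mono[OF wz, of \<epsilon>] \<epsilon> by (simp add: abs_mult algebra_simps)
    define \<alpha> where "\<alpha> = min (1 / q1) 1 / 2"
    have "min (1 / q1) 1 * (z t)\<^sup>2 \<le> 1 / q1 * (z t)\<^sup>2" "min (1 / q1) 1 * (w t)\<^sup>2 \<le> 1 * (w t)\<^sup>2"
      by (intro mult_right_mono; simp)+
    then show "min (1 / q1) 1 / 2 * ((w t)\<^sup>2 + (z t)\<^sup>2) \<le> V t"
      unfolding V_def using ewz ez zq by (simp add: algebra_simps abs_le_iff)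
    show "V t \<le> (2 + 1 / q0) * ((w t)\<^sup>2 + (z t)\<^sup>2)"
    proof -
      have "V t \<le> (z t)\<^sup>2 / q0 + (w t)\<^sup>2 + ((w t)\<^sup>2 + (z t)\<^sup>2)"
        unfolding V_def using ewz ez zq zero_le_power2[of "w t"] zero_le_power2[of "z t"] by linarith
      also have "\<dots> \<le> (2 + 1 / q0) * ((w t)\<^sup>2 + (z t)\<^sup>2)"
        using q0 by (simp add: field_simps)
      finally show ?thesis .
    qed
    have "2 * k + q' t / q t \<ge> \<delta>"
    proof -
      have "- q' t / q t \<le> N * S" using q'_bd[OF t] q_pos by (simp add: field_simps abs_le_iff)
      then show ?thesis by (simp add: \<delta>_def)
    qed
    then have a1: "(2 * k + q' t / q t) * ((z t)\<^sup>2 / q t) \<ge> \<delta> * ((z t)\<^sup>2 / q1)"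
      using zq \<delta> q1 by (intro mult_mono) auto
    \<comment> \<open>The weights are those that leave half of \<open>q0 w\<^sup>2\<close>, the dissipation produced by the cross term.\<close>
    have a2: "- (k * (w t * z t)) \<le> k\<^sup>2 / (2 * q0) * (z t)\<^sup>2 + q0 / 2 * (w t)\<^sup>2"
    proof -
      have "0 \<le> (k * z t + q0 * w t)\<^sup>2 / (2 * q0)" using q0 by simp
      also have "\<dots> = k\<^sup>2 / (2 * q0) * (z t)\<^sup>2 + q0 / 2 * (w t)\<^sup>2 + k * (w t * z t)"
        using q0 by (simp add: field_simps power2_eq_square)
      finally show ?thesis by simp
    qed
    have "V' t \<le> - \<delta> * ((z t)\<^sup>2 / q1) + \<epsilon> * (z t)\<^sup>2
        + \<epsilon> * (k\<^sup>2 / (2 * q0) * (z t)\<^sup>2 + q0 / 2 * (w t)\<^sup>2) - \<epsilon> * (q0 * (w t)\<^sup>2)"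
    proof -
      have "\<epsilon> * (- (k * (w t * z t))) \<le> \<epsilon> * (k\<^sup>2 / (2 * q0) * (z t)\<^sup>2 + q0 / 2 * (w t)\<^sup>2)"
        using a2 \<epsilon> by (intro mult_left_mono) auto
      moreover have "\<epsilon> * (q0 * (w t)\<^sup>2) \<le> \<epsilon> * (q t * (w t)\<^sup>2)"
        using q_bd[OF t] \<epsilon> by (intro mult_left_mono mult_right_mono) auto
      ultimately show ?thesis unfolding V'_def using a1 by (simp add: algebra_simps)
    qed
    also have "\<dots> = - (\<delta> / q1) * (z t)\<^sup>2 + (\<epsilon> * H) * (z t)\<^sup>2 - \<epsilon> * q0 / 2 * (w t)\<^sup>2"
      unfolding H_def by (simp add: algebra_simps)
    also have "\<dots> \<le> - (\<delta> / q1) * (z t)\<^sup>2 + (\<delta> / (2 * q1)) * (z t)\<^sup>2 - \<epsilon> * q0 / 2 * (w t)\<^sup>2"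
      using \<epsilon>(4) by (intro diff_right_mono add_left_mono mult_right_mono) auto
    also have "\<dots> = - (\<delta> / (2 * q1)) * (z t)\<^sup>2 - \<epsilon> * q0 / 2 * (w t)\<^sup>2"
      by (simp add: field_simps)
    also have "\<dots> \<le> - min (\<delta> / (2 * q1)) (\<epsilon> * q0 / 2) * ((w t)\<^sup>2 + (z t)\<^sup>2)"
    proof -
      have "min (\<delta> / (2 * q1)) (\<epsilon> * q0 / 2) * (z t)\<^sup>2 \<le> \<delta> / (2 * q1) * (z t)\<^sup>2"
        "min (\<delta> / (2 * q1)) (\<epsilon> * q0 / 2) * (w t)\<^sup>2 \<le> \<epsilon> * q0 / 2 * (w t)\<^sup>2"
        by (intro mult_right_mono; simp)+
      then show ?thesis by (simp only: distrib_left mult_minus_left)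
    qed
    finally show "V' t \<le> - min (\<delta> / (2 * q1)) (\<epsilon> * q0 / 2) * ((w t)\<^sup>2 + (z t)\<^sup>2)" .
  qed (use \<delta> q1 q0 \<epsilon> in \<open>auto simp: add_pos_pos\<close>)
  then show ?thesis
    unfolding exp_close_def w_def z_def using T by metis
qed

text \<open>By continuity on the compact interval the supremum in the condition is finite and bounds the
  quotient pointwise; eventually both solutions lie in the box of the condition.\<close>

lemma contraction_F3:
  assumes c: "c > 0" and k: "k > 0"
    and F3: "condition_F3 c k a F p" and g: "g = (\<lambda>t. k * a * deriv p (a * t))"
    and s1: "forced_system c k F g y1 v1" and s2: "forced_system c k F g y2 v2"
  shows "exp_close y1 v1 y2 v2"
proof -
  from F3 obtain M N where M: "M > 0" and N: "N > 0"
    and ev: "\<And>y v. system_solution c k a F p y v \<Longrightarrow>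
        (\<forall>\<^sub>F t in at_top. \<bar>y t\<bar> \<le> M \<and> \<bar>v t\<bar> \<le> N)"
    and F: "F C1_differentiable_on UNIV" and dF: "deriv F C1_differentiable_on UNIV"
    and neg: "\<And>y. \<bar>y\<bar> \<le> M \<Longrightarrow> deriv F y < 0"
    and kN: "k > 1 / 2 * N * (SUP y\<in>{y. \<bar>y\<bar> \<le> M}. \<bar>deriv (deriv F) y\<bar> / \<bar>deriv F y\<bar>)"
    unfolding condition_F3_def by blast
  define S where "S = (SUP y\<in>{y. \<bar>y\<bar> \<le> M}. \<bar>deriv (deriv F) y\<bar> / \<bar>deriv F y\<bar>)"
  have box: "{y. \<bar>y\<bar> \<le> M} = {-M..M}" by (auto simp: abs_le_iff)
  have "continuous_on {-M..M} (\<lambda>y. \<bar>deriv (deriv F) y\<bar> / \<bar>deriv F y\<bar>)"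
    using neg by (intro continuous_intros C1_on_UNIV_D(2)[OF F] C1_on_UNIV_D(2)[OF dF])
      (use neg in \<open>force simp: abs_le_iff\<close>)
  then have bdd: "bdd_above ((\<lambda>y. \<bar>deriv (deriv F) y\<bar> / \<bar>deriv F y\<bar>) ` {y. \<bar>y\<bar> \<le> M})"
    unfolding box by (intro bounded_imp_bdd_above compact_imp_bounded compact_continuous_image) auto
  have S_ge: "\<bar>deriv (deriv F) y\<bar> / \<bar>deriv F y\<bar> \<le> S" if "\<bar>y\<bar> \<le> M" for y
    unfolding S_def using that bdd by (intro cSUP_upper) auto
  have ratio: "\<bar>deriv (deriv F) y\<bar> \<le> S * \<bar>deriv F y\<bar>" if "\<bar>y\<bar> \<le> M" for y
    using S_ge[OF that] neg[OF that] by (simp add: field_simps)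
  have S: "S \<ge> 0" using S_ge[of 0] M by (auto intro: order_trans[rotated])
  have "system_solution c k a F p y1 v1" "system_solution c k a F p y2 v2"
    using s1 s2 unfolding forced_system_def system_solution_def g by auto
  then have "\<forall>\<^sub>F t in at_top. (\<bar>y1 t\<bar> \<le> M \<and> \<bar>v1 t\<bar> \<le> N) \<and> (\<bar>y2 t\<bar> \<le> M \<and> \<bar>v2 t\<bar> \<le> N)"
    using ev[of y1 v1] ev[of y2 v2] by (simp add: eventually_conj_iff)
  then obtain T where T: "\<And>t. t \<ge> T \<Longrightarrow> (\<bar>y1 t\<bar> \<le> M \<and> \<bar>v1 t\<bar> \<le> N) \<and> (\<bar>y2 t\<bar> \<le> M \<and> \<bar>v2 t\<bar> \<le> N)"
    unfolding eventually_at_top_linorder by blast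
  show ?thesis
  proof (rule contraction_in_box[OF c k F dF M _ S neg ratio _ _ s1 s2])
    show "2 * k > N * S" using kN unfolding S_def[symmetric] by simp
    show "max T 1 > 0" by simp
  qed (use N T in auto)
qed

section \<open>The periodic solution of the reduced equation\<close>

lemma uniform_limit_geometric_increments:
  fixes f :: "nat \<Rightarrow> 'a \<Rightarrow> real"
  assumes inc: "\<And>n x. n \<ge> N \<Longrightarrow> x \<in> S \<Longrightarrow> \<bar>f (Suc n) x - f n x\<bar> \<le> K * \<theta> ^ n"
    and \<theta>: "0 \<le> \<theta>" "\<theta> < 1"
  shows "\<exists>l. uniform_limit S f l sequentially"
proof -
  have "summable (\<lambda>n. K * \<theta> ^ n)" using \<theta> by (intro summable_mult summable_geometric) simp
  then have "uniform_limit S (\<lambda>n x. \<Sum>i<n. f (Suc i) x - f i x)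
      (\<lambda>x. suminf (\<lambda>i. f (Suc i) x - f i x)) sequentially"
    using inc by (intro Weierstrass_m_test_ev[where M = "\<lambda>n. K * \<theta> ^ n"] eventually_sequentiallyI[of N]) auto
  then have "uniform_limit S (\<lambda>n x. (\<Sum>i<n. f (Suc i) x - f i x) + f 0 x)
      (\<lambda>x. suminf (\<lambda>i. f (Suc i) x - f i x) + f 0 x) sequentially"
    by (intro uniform_limit_intros)
  moreover have "(\<Sum>i<n. f (Suc i) x - f i x) + f 0 x = f n x" for n x
    by (simp add: sum_lessThan_telescope[of "\<lambda>i. f i x"])
  ultimately have "uniform_limit S f (\<lambda>x. suminf (\<lambda>i. f (Suc i) x - f i x) + f 0 x) sequentially"
    by simp
  then show ?thesis by (rule exI[where P = "\<lambda>l. uniform_limit S f l sequentially"])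
qed

lemma uniform_limit_has_real_derivative:
  fixes f f' :: "nat \<Rightarrow> real \<Rightarrow> real"
  assumes S: "open S" "convex S"
    and der: "\<And>n x. x \<in> S \<Longrightarrow> (f n has_real_derivative f' n x) (at x)"
    and lf: "uniform_limit S f l sequentially" and lf': "uniform_limit S f' l' sequentially"
    and x: "x \<in> S"
  shows "(l has_real_derivative l' x) (at x)"
proof -
  have "\<exists>g. \<forall>x\<in>S. (\<lambda>n. f n x) \<longlonglongrightarrow> g x \<and> (g has_derivative (*) (l' x)) (at x within S)"
  proof (rule has_derivative_sequence[where f' = "\<lambda>n x. (*) (f' n x)" and ?x0.0 = x and l = "l x"])
    show "(f n has_derivative (*) (f' n x)) (at x within S)" if "x \<in> S" for n x
      using der[OF that] by (simp add: has_field_derivative_def has_derivative_at_withinI)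
    show "\<forall>\<^sub>F n in sequentially. \<forall>x\<in>S. \<forall>h. norm (f' n x * h - l' x * h) \<le> e * norm h" if "e > 0" for e
      using uniform_limitD[OF lf' that]
    proof eventually_elim
      case (elim n)
      then have "\<bar>f' n x - l' x\<bar> \<le> e" if "x \<in> S" for x
        using bspec[OF elim that] by (simp add: dist_real_def)
      then show ?case
        unfolding left_diff_distrib[symmetric] real_norm_def abs_mult by (auto intro: mult_right_mono)
    qed
    show "(\<lambda>n. f n x) \<longlonglongrightarrow> l x" using tendsto_uniform_limitI[OF lf x] .
  qed (use S x in auto)
  then obtain g where g: "\<And>x. x \<in> S \<Longrightarrow> (\<lambda>n. f n x) \<longlonglongrightarrow> g x"
      "\<And>x. x \<in> S \<Longrightarrow> (g has_derivative (*) (l' x)) (at x within S)" by blast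
  have "g z = l z" if "z \<in> S" for z
    using LIMSEQ_unique[OF g(1)[OF that] tendsto_uniform_limitI[OF lf that]] .
  moreover have "(g has_real_derivative l' x) (at x)"
    using g(2)[OF x] at_within_open[OF x S(1)] by (simp add: has_field_derivative_def)
  ultimately show ?thesis
    by (rule has_field_derivative_transform_within_open[OF _ S(1) x, rotated])
qed

lemma exp_close_abs_bound:
  assumes "exp_close y1 v1 y2 v2"
  obtains K r T where "r > 0" "T > 0"
    "\<And>t. t \<ge> T \<Longrightarrow> \<bar>y1 t - y2 t\<bar> \<le> K * exp (- r * t) \<and> \<bar>v1 t - v2 t\<bar> \<le> K * exp (- r * t)"
proof -
  obtain K r T where r: "r > 0" and T: "T > 0"
    and *: "\<And>t. t \<ge> T \<Longrightarrow> (y1 t - y2 t)\<^sup>2 + (v1 t - v2 t)\<^sup>2 \<le> K * exp (- r * t)"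
    using assms unfolding exp_close_def by blast
  have "\<bar>y1 t - y2 t\<bar> \<le> sqrt K * exp (- (r / 2) * t) \<and> \<bar>v1 t - v2 t\<bar> \<le> sqrt K * exp (- (r / 2) * t)"
    if "t \<ge> T" for t
  proof -
    have "sqrt (K * exp (- r * t)) = sqrt K * exp (- (r / 2) * t)"
      by (simp add: real_sqrt_mult real_sqrt_unique exp_double[symmetric])
    moreover have "\<bar>y1 t - y2 t\<bar> \<le> sqrt (K * exp (- r * t))" "\<bar>v1 t - v2 t\<bar> \<le> sqrt (K * exp (- r * t))"
      using *[OF that] zero_le_power2[of "y1 t - y2 t"] zero_le_power2[of "v1 t - v2 t"]
      by (intro real_le_rsqrt; simp only: power2_abs; linarith)+
    ultimately show ?thesis by simp
  qed
  then show ?thesis using that[of "r / 2" T "sqrt K"] r T by simp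
qed

lemma exp_close_tendsto:
  assumes "exp_close y1 v1 y2 v2"
  shows "((\<lambda>t. y1 t - y2 t) \<longlongrightarrow> 0) at_top" "((\<lambda>t. v1 t - v2 t) \<longlongrightarrow> 0) at_top"
proof -
  obtain K r T where r: "r > 0"
    and *: "\<And>t. t \<ge> T \<Longrightarrow> \<bar>y1 t - y2 t\<bar> \<le> K * exp (- r * t) \<and> \<bar>v1 t - v2 t\<bar> \<le> K * exp (- r * t)"
    using exp_close_abs_bound[OF assms] by metis
  have "filterlim (\<lambda>t::real. - r * t) at_bot at_top"
    by (rule filterlim_tendsto_neg_mult_at_bot[OF tendsto_const _ filterlim_ident]) (use r in simp)
  then have "((\<lambda>t. K * exp (- r * t)) \<longlongrightarrow> K * 0) at_top"
    by (intro tendsto_intros filterlim_compose[OF exp_at_bot])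
  then have lim: "((\<lambda>t. K * exp (- r * t)) \<longlongrightarrow> 0) at_top" by simp
  show "((\<lambda>t. y1 t - y2 t) \<longlongrightarrow> 0) at_top" "((\<lambda>t. v1 t - v2 t) \<longlongrightarrow> 0) at_top"
    by (rule Lim_null_comparison[OF _ lim], rule eventually_at_top_linorderI[of T], use * in simp)+
qed

text \<open>A solution and its translate by one period are exponentially close, so the translates by
  \<open>n\<close> periods form a uniformly convergent sequence of solutions. The limit is periodic.\<close>

lemma periodic_solution_exists:
  fixes F g :: "real \<Rightarrow> real"
  assumes F: "F C1_differentiable_on UNIV"
    and per: "\<And>t. t > 0 \<Longrightarrow> g (t + \<tau>) = g t" and \<tau>: "\<tau> > 0"
    and sol: "forced_system c k F g y v" and B: "\<And>t. t > 0 \<Longrightarrow> \<bar>y t\<bar> \<le> B"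
    and contr: "\<And>y1 v1 y2 v2. forced_system c k F g y1 v1 \<Longrightarrow> forced_system c k F g y2 v2
      \<Longrightarrow> exp_close y1 v1 y2 v2"
  shows "\<exists>yp vp. forced_system c k F g yp vp \<and> (\<forall>t>0. yp (t + \<tau>) = yp t)"
proof -
  note yd = sol[unfolded forced_system_def, rule_format, THEN conjunct1]
  note vd = sol[unfolded forced_system_def, rule_format, THEN conjunct2]
  have "forced_system c k F g (\<lambda>t. y (t + \<tau>)) (\<lambda>t. v (t + \<tau>))"
    unfolding forced_system_def
  proof (intro allI impI conjI)
    fix t :: real assume t: "t > 0"
    show "((\<lambda>t. y (t + \<tau>)) has_real_derivative v (t + \<tau>)) (at t)"
      using yd[of "t + \<tau>"] t \<tau> by (simp add: DERIV_shift)
    show "((\<lambda>t. v (t + \<tau>)) has_real_derivative c * F (y (t + \<tau>)) - k * v (t + \<tau>) + g t) (at t)"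
      using vd[of "t + \<tau>"] t \<tau> per[of t] by (simp add: DERIV_shift)
  qed
  from exp_close_abs_bound[OF contr[OF this sol]] obtain K r T where r: "r > 0"
    and close: "\<And>t. t \<ge> T \<Longrightarrow> \<bar>y (t + \<tau>) - y t\<bar> \<le> K * exp (- r * t) \<and> \<bar>v (t + \<tau>) - v t\<bar> \<le> K * exp (- r * t)"
    by metis
  define S where "S = {0::real<..}"
  have S: "open S" "convex S" by (auto simp: S_def)
  define Y where "Y n t = y (t + real n * \<tau>)" for n t
  define W where "W n t = v (t + real n * \<tau>)" for n t
  define \<theta> where "\<theta> = exp (- r * \<tau>)"
  have \<theta>: "0 \<le> \<theta>" "\<theta> < 1" using r \<tau> by (auto simp: \<theta>_def)
  obtain N :: nat where N: "T / \<tau> \<le> real N" using real_arch_simple by blast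
  have K: "K \<ge> 0" using close[of T] exp_gt_zero[of "- r * T"]
    by (smt (verit) mult_neg_pos order_refl)
  have inc: "\<bar>Y (Suc n) t - Y n t\<bar> \<le> K * \<theta> ^ n \<and> \<bar>W (Suc n) t - W n t\<bar> \<le> K * \<theta> ^ n"
    if "n \<ge> N" "t \<in> S" for n t
  proof -
    have "T \<le> real N * \<tau>" using N \<tau> by (simp add: field_simps)
    also have "\<dots> \<le> real n * \<tau>" using that \<tau> by (intro mult_right_mono) auto
    also have "\<dots> \<le> t + real n * \<tau>" using that by (simp add: S_def)
    finally have *: "T \<le> t + real n * \<tau>" .
    have "exp (- r * (t + real n * \<tau>)) \<le> exp (real n * (- r * \<tau>))"
      using that r by (simp add: S_def algebra_simps)
    also have "\<dots> = \<theta> ^ n" unfolding \<theta>_def by (rule exp_of_nat_mult)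
    finally have "K * exp (- r * (t + real n * \<tau>)) \<le> K * \<theta> ^ n" using K by (rule mult_left_mono)
    then show ?thesis using close[OF *] unfolding Y_def W_def by (simp add: algebra_simps)
  qed
  obtain yp where yp: "uniform_limit S Y yp sequentially"
    using uniform_limit_geometric_increments[of N S Y K \<theta>] inc \<theta> by blast
  obtain vp where vp: "uniform_limit S W vp sequentially"
    using uniform_limit_geometric_increments[of N S W K \<theta>] inc \<theta> by blast
  have pos: "t + real n * \<tau> > 0" if "t \<in> S" for t n
    using that \<tau> by (auto simp: S_def add_pos_nonneg)
  have per_n: "g (t + real n * \<tau>) = g t" if "t \<in> S" for t n
  proof (induction n)
    case (Suc n)
    then show ?case using per[OF pos[OF that, of n]] by (simp add: algebra_simps)
  qed simp
  have Y_B: "\<bar>Y n t\<bar> \<le> B" if "t \<in> S" for n t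
    unfolding Y_def by (rule B[OF pos[OF that]])
  have yp_B: "\<bar>yp t\<bar> \<le> B" if "t \<in> S" for t
    by (rule LIMSEQ_le_const2[OF tendsto_rabs[OF tendsto_uniform_limitI[OF yp that]]])
      (use Y_B[OF that] in blast)
  obtain C where C: "C > 0" "\<And>x y. \<bar>x\<bar> \<le> B \<Longrightarrow> \<bar>y\<bar> \<le> B \<Longrightarrow> \<bar>F x - F y\<bar> \<le> C * \<bar>x - y\<bar>"
    using C1_lipschitz_on_interval[OF F] by metis
  have FY: "uniform_limit S (\<lambda>n t. F (Y n t)) (\<lambda>t. F (yp t)) sequentially"
  proof (rule uniform_limitI)
    fix e :: real assume "e > 0"
    then have "e / C > 0" using C by simp
    from uniform_limitD[OF yp this] show "\<forall>\<^sub>F n in sequentially. \<forall>t\<in>S. dist (F (Y n t)) (F (yp t)) < e"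
    proof eventually_elim
      case (elim n)
      show ?case
      proof
        fix t assume t: "t \<in> S"
        have "\<bar>F (Y n t) - F (yp t)\<bar> \<le> C * \<bar>Y n t - yp t\<bar>" using C(2) Y_B yp_B t by blast
        also have "\<dots> < e" using elim t C(1) by (auto simp: dist_real_def field_simps)
        finally show "dist (F (Y n t)) (F (yp t)) < e" by (simp add: dist_real_def)
      qed
    qed
  qed
  have "forced_system c k F g yp vp"
    unfolding forced_system_def
  proof (intro allI impI conjI)
    fix t :: real assume "t > 0"
    then have t: "t \<in> S" by (simp add: S_def)
    show "(yp has_real_derivative vp t) (at t)"
    proof (rule uniform_limit_has_real_derivative[OF S _ yp vp t])
      show "(Y n has_real_derivative W n x) (at x)" if "x \<in> S" for n x
        unfolding Y_def W_def using yd[OF pos[OF that, of n]] by (simp add: DERIV_shift)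
    qed
    show "(vp has_real_derivative c * F (yp t) - k * vp t + g t) (at t)"
    proof (rule uniform_limit_has_real_derivative[OF S _ vp _ t])
      show "(W n has_real_derivative c * F (Y n x) - k * W n x + g x) (at x)" if "x \<in> S" for n x
        unfolding Y_def W_def using vd[OF pos[OF that, of n]] per_n[OF that, of n] by (simp add: DERIV_shift)
      show "uniform_limit S (\<lambda>n x. c * F (Y n x) - k * W n x + g x)
          (\<lambda>x. c * F (yp x) - k * vp x + g x) sequentially"
        by (intro uniform_limit_add uniform_limit_minus uniform_limit_const
            bounded_linear.uniform_limit[OF bounded_linear_mult_right FY]
            bounded_linear.uniform_limit[OF bounded_linear_mult_right vp])
    qed
  qed
  moreover have "yp (t + \<tau>) = yp t" if "t > 0" for t
  proof -
    have t: "t \<in> S" "t + \<tau> \<in> S" using that \<tau> by (auto simp: S_def)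
    have "(\<lambda>n. Y (Suc n) t) \<longlonglongrightarrow> yp t"
      using LIMSEQ_Suc[OF tendsto_uniform_limitI[OF yp t(1)]] .
    moreover have "Y (Suc n) t = Y n (t + \<tau>)" for n by (simp add: Y_def algebra_simps)
    ultimately have "(\<lambda>n. Y n (t + \<tau>)) \<longlonglongrightarrow> yp t" by simp
    then show ?thesis by (rule LIMSEQ_unique[OF tendsto_uniform_limitI[OF yp t(2)]])
  qed
  ultimately show ?thesis by blast
qed

text \<open>The difference is itself periodic, and a periodic function that tends to zero vanishes.\<close>

lemma periodic_eq_if_asymptotic:
  fixes y z :: "real \<Rightarrow> real"
  assumes "\<tau> > 0" "\<And>t. t > 0 \<Longrightarrow> y (t + \<tau>) = y t" "\<And>t. t > 0 \<Longrightarrow> z (t + \<tau>) = z t"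
    and lim: "((\<lambda>t. y t - z t) \<longlongrightarrow> 0) at_top" and t: "t > 0"
  shows "y t = z t"
proof -
  have "y (t + real n * \<tau>) - z (t + real n * \<tau>) = y t - z t" for n
  proof (induction n)
    case (Suc n)
    have "t + real n * \<tau> > 0" using t \<open>\<tau> > 0\<close> by (simp add: add_pos_nonneg)
    from assms(2,3)[OF this] Suc show ?case by (simp add: algebra_simps)
  qed simp
  moreover have "filterlim (\<lambda>n. t + real n * \<tau>) at_top sequentially"
    using \<open>\<tau> > 0\<close>
    by (intro filterlim_tendsto_add_at_top[OF tendsto_const]
        filterlim_at_top_mult_tendsto_pos[OF tendsto_const] filterlim_real_sequentially)
  from filterlim_compose[OF lim this]
  have "(\<lambda>n. y (t + real n * \<tau>) - z (t + real n * \<tau>)) \<longlonglongrightarrow> 0" .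
  ultimately show ?thesis by (simp add: LIMSEQ_const_iff)
qed

text \<open>The form in which both convergence claims are reached: on sets of bounded measure, uniform
  smallness almost everywhere makes the integral small.\<close>

lemma tendsto_integral_plus_SUP:
  fixes A :: "real \<Rightarrow> real set" and G e :: "real \<Rightarrow> real \<Rightarrow> real"
  assumes A: "\<And>t. A t \<in> sets lborel" "\<And>t. A t \<noteq> {}" "\<And>t. emeasure lborel (A t) \<le> ennreal C"
    and small: "\<And>\<delta>. \<delta> > 0 \<Longrightarrow> \<forall>\<^sub>F t in at_top.
       (AE x in lborel. x \<in> A t \<longrightarrow> 0 \<le> G t x \<and> G t x \<le> \<delta>) \<and> (\<forall>x\<in>A t. \<bar>e t x\<bar> \<le> \<delta>)"
  shows "((\<lambda>t. (LBINT x:A t. G t x) + (SUP x\<in>A t. \<bar>e t x\<bar>)) \<longlongrightarrow> 0) at_top"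
proof (rule tendstoI)
  fix \<eta> :: real assume \<eta>: "\<eta> > 0"
  define D where "D = max C 0 + 2"
  have D: "D > 0" by (simp add: D_def)
  define \<delta> where "\<delta> = \<eta> / D"
  have \<delta>: "\<delta> > 0" using \<eta> D by (simp add: \<delta>_def)
  from small[OF \<delta>] show "\<forall>\<^sub>F t in at_top. dist ((LBINT x:A t. G t x) + (SUP x\<in>A t. \<bar>e t x\<bar>)) 0 < \<eta>"
  proof eventually_elim
    case (elim t)
    then have AE: "AE x in lborel. x \<in> A t \<longrightarrow> 0 \<le> G t x \<and> G t x \<le> \<delta>"
      and E: "\<And>x. x \<in> A t \<Longrightarrow> \<bar>e t x\<bar> \<le> \<delta>" by auto
    have fin: "emeasure lborel (A t) < \<infinity>" using A(3)[of t] by (rule order.strict_trans1) simp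
    have "emeasure lborel (A t) \<le> ennreal (max C 0)"
      using A(3)[of t] by (rule order_trans) (simp add: ennreal_leI)
    then have m: "measure lborel (A t) \<le> max C 0"
      unfolding measure_def by (intro enn2real_leI) auto
    have "(LBINT x:A t. G t x) \<le> (LINT x|lborel. indicator (A t) x * \<delta>)"
      unfolding set_lebesgue_integral_def
    proof (rule integral_mono_AE')
      show "integrable lborel (\<lambda>x. indicator (A t) x * \<delta>)" using A(1)[of t] fin by simp
      show "AE x in lborel. indicator (A t) x *\<^sub>R G t x \<le> indicator (A t) x * \<delta>"
        using AE by eventually_elim (auto simp: indicator_def)
      show "AE x in lborel. 0 \<le> indicator (A t) x * \<delta>" using \<delta> by simp
    qed
    also have "\<dots> = measure lborel (A t) * \<delta>" using A(1)[of t] by simp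
    also have "\<dots> \<le> max C 0 * \<delta>" using m \<delta> by (intro mult_right_mono) auto
    finally have I1: "(LBINT x:A t. G t x) \<le> max C 0 * \<delta>" .
    have "AE x in lborel. 0 \<le> indicator (A t) x *\<^sub>R G t x"
      using AE by eventually_elim (auto simp: indicator_def)
    then have I0: "(LBINT x:A t. G t x) \<ge> 0"
      unfolding set_lebesgue_integral_def by (rule integral_nonneg_AE)
    obtain x0 where x0: "x0 \<in> A t" using A(2)[of t] by blast
    have bdd: "bdd_above ((\<lambda>x. \<bar>e t x\<bar>) ` A t)" using E by (intro bdd_aboveI2)
    have "\<bar>e t x0\<bar> \<le> (SUP x\<in>A t. \<bar>e t x\<bar>)" by (rule cSUP_upper[OF x0 bdd])
    moreover have "(SUP x\<in>A t. \<bar>e t x\<bar>) \<le> \<delta>" using A(2)[of t] E by (intro cSUP_least) auto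
    ultimately have "\<bar>(LBINT x:A t. G t x) + (SUP x\<in>A t. \<bar>e t x\<bar>)\<bar> \<le> max C 0 * \<delta> + \<delta>"
      using I0 I1 by linarith
    also have "\<dots> < D * \<delta>" using \<delta> by (simp add: D_def algebra_simps)
    also have "\<dots> = \<eta>" using D by (simp add: \<delta>_def)
    finally show ?case by simp
  qed
qed

section \<open>Periodic extension from the positive half-line\<close>

text \<open>Subtracting \<open>\<lfloor>z / w\<rfloor>\<close> periods moves \<open>z\<close> to \<open>[0, w)\<close>. One period is added back so
  that the argument is strictly positive, where periodicity is known.\<close>

definition periodic_ext :: "real \<Rightarrow> (real \<Rightarrow> real) \<Rightarrow> real \<Rightarrow> real" where
  "periodic_ext w h z = h (z - w * real_of_int \<lfloor>z / w\<rfloor> + w)"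

lemma periodic_ext_arg:
  assumes "w > 0"
  shows "w \<le> z - w * real_of_int \<lfloor>z / w\<rfloor> + w" "z - w * real_of_int \<lfloor>z / w\<rfloor> + w \<le> 2 * w"
proof -
  have "w * real_of_int \<lfloor>z / w\<rfloor> \<le> w * (z / w)"
    using assms by (intro mult_left_mono of_int_floor_le) auto
  then show "w \<le> z - w * real_of_int \<lfloor>z / w\<rfloor> + w" using assms by simp
  have "w * (z / w) \<le> w * (real_of_int \<lfloor>z / w\<rfloor> + 1)"
    using assms by (intro mult_left_mono real_of_int_floor_add_one_ge) auto
  then show "z - w * real_of_int \<lfloor>z / w\<rfloor> + w \<le> 2 * w" using assms by (simp add: distrib_left)
qed

lemma periodic_ext_shift: "w > 0 \<Longrightarrow> periodic_ext w h (z + w) = periodic_ext w h z"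
  by (simp add: periodic_ext_def add_divide_distrib algebra_simps)

lemma positive_periodic_multiple:
  fixes h :: "real \<Rightarrow> real"
  assumes "w > 0" and per: "\<And>x. x > 0 \<Longrightarrow> h (x + w) = h x" and "x > 0"
  shows "h (x + real n * w) = h x"
proof (induction n)
  case (Suc n)
  have "x + real n * w > 0" using assms by (simp add: add_pos_nonneg)
  from per[OF this] Suc show ?case by (simp add: algebra_simps)
qed simp

text \<open>Both arguments are positive and differ by a multiple of the period, whose sign decides from which
  side the periodicity on the half-line is applied.\<close>

lemma periodic_ext_eq:
  assumes w: "w > 0" and per: "\<And>x. x > 0 \<Longrightarrow> h (x + w) = h x" and z: "z + real n * w > 0"
  shows "periodic_ext w h z = h (z + real n * w)"
proof -
  define s where "s = z - w * real_of_int \<lfloor>z / w\<rfloor> + w"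
  have s: "s > 0" using periodic_ext_arg(1)[OF w, of z] w by (simp add: s_def)
  define j where "j = int n + \<lfloor>z / w\<rfloor> - 1"
  have j: "z + real n * w = s + real_of_int j * w" by (simp add: s_def j_def algebra_simps)
  have "h s = h (z + real n * w)"
  proof (cases "j \<ge> 0")
    case True
    then show ?thesis
      using positive_periodic_multiple[of w h s "nat j", OF w per s] by (simp add: j)
  next
    case False
    then show ?thesis
      using positive_periodic_multiple[of w h "z + real n * w" "nat (- j)", OF w per z] by (simp add: j)
  qed
  then show ?thesis by (simp add: periodic_ext_def s_def)
qed

lemma periodic_ext_pos:
  assumes "w > 0" "\<And>x. x > 0 \<Longrightarrow> h (x + w) = h x" "z > 0"
  shows "periodic_ext w h z = h z"
  using periodic_ext_eq[of w h z 0] assms by simp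

text \<open>Near any point the extension is a translate of the original function, so that continuity and
  derivatives are inherited from the half-line.\<close>

lemma periodic_ext_locally:
  assumes w: "w > 0"
  obtains n where "z + real n * w > 0"
    "\<And>h s. (\<And>x. x > 0 \<Longrightarrow> h (x + w) = h x) \<Longrightarrow> s \<in> {- (real n * w)<..}
      \<Longrightarrow> h (s + real n * w) = periodic_ext w h s"
proof -
  obtain n :: nat where "- z / w < real n" using reals_Archimedean2 by blast
  then have n: "z + real n * w > 0" using w by (simp add: field_simps)
  have "h (s + real n * w) = periodic_ext w h s"
    if "\<And>x. x > 0 \<Longrightarrow> h (x + w) = h x" "s \<in> {- (real n * w)<..}" for h s
    using periodic_ext_eq[of w h s n, OF w that(1)] that(2) by simp
  with n show ?thesis using that by blast
qed

lemma has_derivative_periodic_ext: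
  assumes w: "w > 0" and per: "\<And>x. x > 0 \<Longrightarrow> h (x + w) = h x" "\<And>x. x > 0 \<Longrightarrow> h' (x + w) = h' x"
    and der: "\<And>x. x > 0 \<Longrightarrow> (h has_real_derivative h' x) (at x)"
  shows "(periodic_ext w h has_real_derivative periodic_ext w h' z) (at z)"
proof -
  obtain n where n: "z + real n * w > 0"
    and ext: "\<And>h s. (\<And>x. x > 0 \<Longrightarrow> h (x + w) = h x) \<Longrightarrow> s \<in> {- (real n * w)<..}
      \<Longrightarrow> h (s + real n * w) = periodic_ext w h s"
    using periodic_ext_locally[OF w] by metis
  have z: "z \<in> {- (real n * w)<..}" using n by simp
  have "((\<lambda>s. h (s + real n * w)) has_real_derivative h' (z + real n * w)) (at z)"
    using der[OF n] by (simp add: DERIV_shift)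
  then have "(periodic_ext w h has_real_derivative h' (z + real n * w)) (at z)"
    by (rule has_field_derivative_transform_within_open[OF _ open_greaterThan z]) (rule ext[of h, OF per(1)])
  then show ?thesis using ext[of h', OF per(2) z] by simp
qed

lemma continuous_on_periodic_ext:
  assumes w: "w > 0" and per: "\<And>x. x > 0 \<Longrightarrow> h (x + w) = h x"
    and cont: "\<And>x. x > 0 \<Longrightarrow> isCont h x"
  shows "continuous_on S (periodic_ext w h)"
proof -
  have "isCont (periodic_ext w h) z" for z
  proof -
    obtain n where n: "z + real n * w > 0"
      and ext: "\<And>h s. (\<And>x. x > 0 \<Longrightarrow> h (x + w) = h x) \<Longrightarrow> s \<in> {- (real n * w)<..}
        \<Longrightarrow> h (s + real n * w) = periodic_ext w h s"
      using periodic_ext_locally[OF w] by metis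
    let ?U = "{- (real n * w)<..}"
    have "continuous_on ?U (\<lambda>s. h (s + real n * w))"
    proof (rule continuous_on_compose2[of "{0<..}" h])
      show "continuous_on {0<..} h" using cont by (simp add: continuous_at_imp_continuous_on)
    qed (auto intro!: continuous_intros)
    then have "continuous_on ?U (periodic_ext w h)"
      by (rule continuous_on_eq) (rule ext[of h, OF per])
    then show ?thesis using n by (simp add: continuous_on_eq_continuous_at)
  qed
  then show ?thesis by (simp add: continuous_at_imp_continuous_on)
qed

lemma periodic_ext_bounded:
  assumes w: "w > 0" and cont: "\<And>x. x > 0 \<Longrightarrow> isCont h x"
  obtains B where "\<And>z. \<bar>periodic_ext w h z\<bar> \<le> B"
proof -
  have "continuous_on {w..2 * w} h" using w cont by (intro continuous_at_imp_continuous_on) auto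
  then have "bounded (h ` {w..2 * w})" by (intro compact_imp_bounded compact_continuous_image) auto
  then obtain B where B: "\<forall>x\<in>h ` {w..2 * w}. norm x \<le> B" unfolding bounded_iff by blast
  have "\<bar>periodic_ext w h z\<bar> \<le> B" for z
    unfolding periodic_ext_def using B periodic_ext_arg[OF w, of z] by simp
  then show ?thesis using that by blast
qed

section \<open>The reduced equation\<close>

lemma forced_system_imp_reduced_solution:
  assumes pos: "m > 0" "a > 0"
    and sys: "forced_system (1 / m) (2 * \<kappa> / (a * m)) F (\<lambda>t. 2 * \<kappa> / (a * m) * a * deriv p (a * t)) y v"
  shows "reduced_solution m \<kappa> a F p y" "t > 0 \<Longrightarrow> deriv y t = v t"
proof -
  note yd = sys[unfolded forced_system_def, rule_format, THEN conjunct1]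
  note vd = sys[unfolded forced_system_def, rule_format, THEN conjunct2]
  show v: "deriv y t = v t" if "t > 0" for t
    using DERIV_imp_deriv[OF yd[OF that]] .
  show "reduced_solution m \<kappa> a F p y"
    unfolding reduced_solution_def
  proof (intro allI impI conjI)
    fix t :: real assume t: "t > 0"
    show "y differentiable (at t)" using yd[OF t] unfolding real_differentiable_def by blast
    have d: "(deriv y has_real_derivative 1 / m * F (y t) - 2 * \<kappa> / (a * m) * v t
        + 2 * \<kappa> / (a * m) * a * deriv p (a * t)) (at t)"
      by (rule has_field_derivative_transform_within_open[OF vd[OF t] open_greaterThan[of 0]])
        (use t v in auto)
    then show "deriv y differentiable (at t)" unfolding real_differentiable_def by blast
    show "m * deriv (deriv y) t = F (y t) - 2 * \<kappa> / a * deriv y t + 2 * \<kappa> * deriv p (a * t)"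
      using DERIV_imp_deriv[OF d] v[OF t] pos by (simp add: field_simps)
  qed
qed

lemma reduced_solution_imp_forced_system:
  assumes pos: "m > 0" "a > 0" and sol: "reduced_solution m \<kappa> a F p y"
  shows "forced_system (1 / m) (2 * \<kappa> / (a * m)) F (\<lambda>t. 2 * \<kappa> / (a * m) * a * deriv p (a * t)) y (deriv y)"
  unfolding forced_system_def
proof (intro allI impI conjI)
  fix t :: real assume t: "t > 0"
  have s: "y differentiable (at t)" "deriv y differentiable (at t)"
    "m * deriv (deriv y) t = F (y t) - 2 * \<kappa> / a * deriv y t + 2 * \<kappa> * deriv p (a * t)"
    using sol t by (auto simp: reduced_solution_def)
  show "(y has_real_derivative deriv y t) (at t)"
    using s(1) by (simp add: DERIV_deriv_iff_real_differentiable)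
  have "deriv (deriv y) t = 1 / m * F (y t) - 2 * \<kappa> / (a * m) * deriv y t
      + 2 * \<kappa> / (a * m) * a * deriv p (a * t)"
    using s(3) pos by (simp add: field_simps)
  then show "(deriv y has_real_derivative 1 / m * F (y t) - 2 * \<kappa> / (a * m) * deriv y t
      + 2 * \<kappa> / (a * m) * a * deriv p (a * t)) (at t)"
    using s(2)[unfolded DERIV_deriv_iff_real_differentiable[symmetric]] by (simp only:)
qed

lemma incident_wave_primitive:
  assumes "continuous_on UNIV u1"
  shows "incident_wave a u0 u1 z
    = (u0 z + u0 (- z)) / 2 + (primitive u1 z - primitive u1 (- z)) / (2 * a)"
proof -
  have "(LBINT s=ereal (- z)..ereal 0. u1 s) + (LBINT s=ereal 0..ereal z. u1 s)
      = (LBINT s=ereal (- z)..ereal z. u1 s)"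
    by (rule interval_integral_sum)
      (simp add: min_def max_def interval_integrable_continuous_on continuous_on_subset[OF assms])
  moreover have "(LBINT s=ereal (- z)..ereal 0. u1 s) = - (LBINT s=ereal 0..ereal (- z). u1 s)"
    by (rule interval_integral_endpoints_reverse)
  ultimately show ?thesis
    by (simp add: incident_wave_def primitive_def zero_ereal_def)
qed

lemma incident_wave_derivative:
  assumes u0: "u0 C1_differentiable_on UNIV" and u1: "continuous_on UNIV u1"
  shows "(incident_wave a u0 u1 has_real_derivative
      (deriv u0 z - deriv u0 (- z)) / 2 + (u1 z + u1 (- z)) / (2 * a)) (at z)"
proof -
  note d0 = C1_on_UNIV_D(1)[OF u0] and d1 = primitive_has_real_derivative[OF u1]
  have "((\<lambda>z. (u0 z + u0 (- z)) / 2 + (primitive u1 z - primitive u1 (- z)) / (2 * a))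
      has_real_derivative (deriv u0 z + deriv u0 (- z) * (- 1)) / 2 + (u1 z - u1 (- z) * (- 1)) / (2 * a)) (at z)"
    by (intro DERIV_add DERIV_diff DERIV_cdivide d0 d1 DERIV_chain2[OF d0] DERIV_chain2[OF d1])
      (auto intro!: derivative_eq_intros)
  then show ?thesis unfolding incident_wave_primitive[OF u1, abs_def] by simp
qed

lemma incident_force_properties:
  fixes a \<omega> :: real
  assumes a: "a > 0" and H: "(u0, u1) \<in> H_class \<omega>" and p: "p = incident_wave a u0 u1"
  shows "deriv p z = (deriv u0 z - deriv u0 (- z)) / 2 + (u1 z + u1 (- z)) / (2 * a)"
    "continuous_on UNIV (deriv p)" "(p has_real_derivative deriv p z) (at z)"
    "z > 0 \<Longrightarrow> deriv p (z + \<omega>) = deriv p z"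
proof -
  have u0: "u0 C1_differentiable_on UNIV" and u1: "continuous_on UNIV u1"
    and P: "deriv u0 \<in> P_class \<omega>" "u1 \<in> P_class \<omega>"
    using H by (auto simp: H_class_def)
  note d = incident_wave_derivative[OF u0 u1, of a]
  show eq: "deriv p z = (deriv u0 z - deriv u0 (- z)) / 2 + (u1 z + u1 (- z)) / (2 * a)" for z
    unfolding p by (rule DERIV_imp_deriv[OF d])
  show "(p has_real_derivative deriv p z) (at z)" using d[of z] eq[of z] by (simp add: p)
  have "continuous_on UNIV (\<lambda>z. deriv u0 (- z))" "continuous_on UNIV (\<lambda>z. u1 (- z))"
    by (auto intro!: continuous_on_compose2[OF C1_on_UNIV_D(2)[OF u0, of UNIV]]
        continuous_on_compose2[OF u1] continuous_intros)
  then have "continuous_on UNIV (\<lambda>z. (deriv u0 z - deriv u0 (- z)) / 2 + (u1 z + u1 (- z)) / (2 * a))"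
    using a by (intro continuous_intros C1_on_UNIV_D(2)[OF u0] u1) auto
  then show "continuous_on UNIV (deriv p)" unfolding eq[abs_def] .
  show "deriv p (z + \<omega>) = deriv p z" if "z > 0"
  proof -
    have "deriv u0 (z + \<omega>) = deriv u0 z" "u1 (z + \<omega>) = u1 z"
      "deriv u0 (- z - \<omega>) = deriv u0 (- z)" "u1 (- z - \<omega>) = u1 (- z)"
      using P that unfolding P_class_def by auto
    then show ?thesis unfolding eq by simp
  qed
qed

lemma solutions_exp_close:
  assumes c: "c > 0" and k: "k > 0" and "condition_F2 c k F \<or> condition_F3 c k a F p"
    and "forced_system c k F (\<lambda>t. k * a * deriv p (a * t)) y1 v1"
    and "forced_system c k F (\<lambda>t. k * a * deriv p (a * t)) y2 v2"
  shows "exp_close y1 v1 y2 v2"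
  using assms contraction_F2[OF _ k] contraction_F3[OF c k _ refl] by blast

text \<open>On positive times the force agrees with its periodic extension, which is continuous and bounded on
  the whole line.\<close>

lemma periodic_attractor:
  fixes c k a \<omega> :: real
  assumes c: "c > 0" and k: "k > 0" and a: "a > 0" and \<omega>: "\<omega> > 0"
    and F: "F C1_differentiable_on UNIV"
    and Flim: "filterlim F at_bot at_top" "filterlim F at_top at_bot"
    and H: "(u0, u1) \<in> H_class \<omega>" and p: "p = incident_wave a u0 u1"
    and F23: "condition_F2 c k F \<or> condition_F3 c k a F p"
  obtains yp vp where "forced_system c k F (\<lambda>t. k * a * deriv p (a * t)) yp vp"
    "\<And>t. t > 0 \<Longrightarrow> yp (t + \<omega> / a) = yp t" "\<And>t. t > 0 \<Longrightarrow> vp (t + \<omega> / a) = vp t"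
    "\<And>y v. forced_system c k F (\<lambda>t. k * a * deriv p (a * t)) y v \<Longrightarrow> exp_close y v yp vp"
proof -
  note dp = incident_force_properties[OF a H p]
  define g where "g t = k * a * deriv p (a * t)" for t
  have g: "(\<lambda>t. k * a * deriv p (a * t)) = g" by (simp add: g_def fun_eq_iff)
  define \<tau> where "\<tau> = \<omega> / a"
  have \<tau>: "\<tau> > 0" "a * \<tau> = \<omega>" using a \<omega> by (auto simp: \<tau>_def)
  have per: "g (t + \<tau>) = g t" if "t > 0" for t
    using dp(4)[of "a * t"] that a \<tau> by (simp add: g_def distrib_left)
  have g_cont: "isCont g t" for t
  proof -
    have "continuous_on UNIV g"
      unfolding g_def by (intro continuous_intros continuous_on_compose2[OF dp(2)]) auto
    then show ?thesis by (simp add: continuous_on_eq_continuous_at)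
  qed
  define h where "h = periodic_ext \<tau> g"
  have h_cont: "continuous_on UNIV h"
    unfolding h_def by (rule continuous_on_periodic_ext[of \<tau> g, OF \<tau>(1) per g_cont])
  obtain Gb where Gb: "\<And>t. \<bar>h t\<bar> \<le> Gb"
    unfolding h_def using periodic_ext_bounded[of \<tau> g, OF \<tau>(1) g_cont] by metis
  have hg: "h t = g t" if "t > 0" for t
    unfolding h_def by (rule periodic_ext_pos[of \<tau> g, OF \<tau>(1) per that])
  obtain y v B where sol: "\<forall>t>0. (y has_real_derivative v t) (at t)
      \<and> (v has_real_derivative c * F (y t) - k * v t + h t) (at t) \<and> \<bar>y t\<bar> \<le> B"
    using reduced_system_bounded_solution[OF c k F Flim h_cont Gb] by blast
  then have sys: "forced_system c k F g y v" and B: "\<And>t. t > 0 \<Longrightarrow> \<bar>y t\<bar> \<le> B"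
    by (auto simp: forced_system_def hg)
  have contr: "exp_close y1 v1 y2 v2"
    if "forced_system c k F g y1 v1" "forced_system c k F g y2 v2" for y1 v1 y2 v2
    using solutions_exp_close[OF c k F23, unfolded g, OF that] .
  obtain yp vp where yp: "forced_system c k F g yp vp" and yp_per: "\<forall>t>0. yp (t + \<tau>) = yp t"
    using periodic_solution_exists[of F g \<tau>, OF F per \<tau>(1) sys B contr] by blast
  have vp_per: "vp (t + \<tau>) = vp t" if t: "t > 0" for t
  proof -
    have "((\<lambda>t. yp (t + \<tau>)) has_real_derivative vp (t + \<tau>)) (at t)"
      using yp t \<tau>(1) by (simp add: forced_system_def DERIV_shift[symmetric])
    then have "(yp has_real_derivative vp (t + \<tau>)) (at t)"
      by (rule has_field_derivative_transform_within_open[OF _ open_greaterThan[of 0]])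
        (use t yp_per in auto)
    then show ?thesis using yp t DERIV_unique unfolding forced_system_def by blast
  qed
  show ?thesis
    using that[of yp vp] yp yp_per vp_per contr unfolding g \<tau>_def by blast
qed

section \<open>Test functions\<close>

lemma partial_eq: "(f has_derivative D) (at z) \<Longrightarrow> partial e f z = D e"
  by (simp add: partial_def frechet_derivative_at[symmetric])

lemma partial_eq_deriv: "(f has_real_derivative D) (at z) \<Longrightarrow> partial e f z = D * e"
  by (simp add: partial_eq has_field_derivative_def)

lemma C_class_SucI:
  assumes "\<And>z. (f has_derivative f' z) (at z)" "\<And>e. C_class n (\<lambda>z. f' z e)"
  shows "C_class (Suc n) f"
proof -
  have "partial e f = (\<lambda>z. f' z e)" for e using partial_eq[OF assms(1)] by (simp add: fun_eq_iff)
  then show ?thesis using assms by (auto simp: differentiable_def)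
qed

lemma C_class_Suc_has_derivative:
  "C_class (Suc n) f \<Longrightarrow> (f has_derivative (\<lambda>e. partial e f z)) (at z)"
  by (simp add: partial_def frechet_derivative_works[symmetric])

lemma C_class_Suc_imp: "C_class (Suc n) f \<Longrightarrow> C_class n f"
proof (induction n arbitrary: f)
  case 0
  then show ?case
    by (auto intro!: continuous_at_imp_continuous_on differentiable_imp_continuous_within)
next
  case (Suc n)
  then have "C_class (Suc n) (partial e f)" "f differentiable (at z)" for e z by simp_all
  then show ?case using Suc.IH by simp
qed

lemma C_class_const: "C_class n (\<lambda>_. c)"
proof (induction n arbitrary: c)
  case (Suc n)
  show ?case by (rule C_class_SucI[where f' = "\<lambda>_ _. 0"]) (auto simp: Suc)
qed simp

lemma C_class_add: "C_class n f \<Longrightarrow> C_class n g \<Longrightarrow> C_class n (\<lambda>z. f z + g z)"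
proof (induction n arbitrary: f g)
  case 0 then show ?case by (simp add: continuous_on_add)
next
  case (Suc n)
  show ?case
  proof (rule C_class_SucI)
    show "((\<lambda>z. f z + g z) has_derivative (\<lambda>e. partial e f z + partial e g z)) (at z)" for z
      using Suc.prems by (intro has_derivative_add C_class_Suc_has_derivative)
    show "C_class n (\<lambda>z. partial e f z + partial e g z)" for e
      using Suc by simp
  qed
qed

lemma C_class_mult: "C_class n f \<Longrightarrow> C_class n g \<Longrightarrow> C_class n (\<lambda>z. f z * g z)"
proof (induction n arbitrary: f g)
  case 0 then show ?case by (simp add: continuous_on_mult)
next
  case (Suc n)
  show ?case
  proof (rule C_class_SucI)
    show "((\<lambda>z. f z * g z) has_derivative (\<lambda>e. f z * partial e g z + partial e f z * g z)) (at z)" for z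
      using Suc.prems by (intro has_derivative_mult C_class_Suc_has_derivative)
    have "C_class n f" "C_class n g" "C_class n (partial e f)" "C_class n (partial e g)" for e
      using Suc.prems C_class_Suc_imp by auto
    then show "C_class n (\<lambda>z. f z * partial e g z + partial e f z * g z)" for e
      by (intro C_class_add Suc.IH)
  qed
qed

lemma C_class_cmult: "C_class n f \<Longrightarrow> C_class n (\<lambda>z. c * f z)"
  by (intro C_class_mult C_class_const)

lemma C_class_diff: "C_class n f \<Longrightarrow> C_class n g \<Longrightarrow> C_class n (\<lambda>z. f z - g z)"
  using C_class_add[of n f "\<lambda>z. (- 1) * g z"] C_class_cmult[of n g "-1"] by simp

lemma C_class_real_SucI:
  assumes "\<And>z. (f has_real_derivative f' z) (at z)" "C_class n f'"
  shows "C_class (Suc n) f"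
proof (rule C_class_SucI)
  show "(f has_derivative (*) (f' z)) (at z)" for z
    using assms(1) by (simp add: has_field_derivative_def)
  show "C_class n (\<lambda>z. f' z * e)" for e
    by (intro C_class_mult C_class_const assms)
qed

lemma C_class_real_Suc_D:
  fixes f :: "real \<Rightarrow> real"
  assumes "C_class (Suc n) f"
  shows "(f has_real_derivative partial 1 f z) (at z)" "C_class n (partial 1 f)"
proof -
  have "(f has_derivative (\<lambda>e. partial e f z)) (at z)" using assms by (rule C_class_Suc_has_derivative)
  moreover have "(\<lambda>e. partial e f z) = (*) (partial 1 f z)"
  proof (rule ext)
    fix e :: real
    have "partial (e *\<^sub>R 1) f z = e *\<^sub>R partial 1 f z"
      by (rule linear_cmul[OF has_derivative_linear[OF C_class_Suc_has_derivative[OF assms]]])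
    then show "partial e f z = partial 1 f z * e" by simp
  qed
  ultimately show "(f has_real_derivative partial 1 f z) (at z)"
    by (simp only: has_field_derivative_def)
  show "C_class n (partial 1 f)" using assms by simp
qed

lemma C_class_affine:
  fixes f :: "real \<Rightarrow> real"
  shows "C_class n f \<Longrightarrow> C_class n (\<lambda>x. f (c * x + d))"
proof (induction n arbitrary: f)
  case 0
  then have "continuous_on UNIV f" by simp
  then show ?case
    by (simp add: continuous_on_compose2[of UNIV f] continuous_intros)
next
  case (Suc n)
  show ?case
  proof (rule C_class_real_SucI)
    show "((\<lambda>x. f (c * x + d)) has_real_derivative partial 1 f (c * z + d) * c) (at z)" for z
      by (rule DERIV_chain2[OF C_class_real_Suc_D(1)[OF Suc.prems]])
        (auto intro!: derivative_eq_intros)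
    have "C_class n (\<lambda>x. partial 1 f (c * x + d))"
      using Suc.IH C_class_real_Suc_D(2)[OF Suc.prems] by blast
    then show "C_class n (\<lambda>z. partial 1 f (c * z + d) * c)"
      by (intro C_class_mult C_class_const)
  qed
qed

lemma C_class_primitive: "C_class n f \<Longrightarrow> C_class n (primitive f)" if "continuous_on UNIV f"
  using C_class_Suc_imp[OF C_class_real_SucI[OF primitive_has_real_derivative[OF that]]] .

text \<open>The functions \<open>poly q (1/x) exp (- 1/x)\<close> for \<open>x > 0\<close>, extended by zero, are closed under
  differentiation; with \<open>q = 1\<close> this is the classical smooth function that is flat at the origin.\<close>

definition flat :: "real poly \<Rightarrow> real \<Rightarrow> real" where
  "flat q x = (if x > 0 then poly q (1 / x) * exp (- (1 / x)) else 0)"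

lemma flat_tendsto_0: "(flat q \<longlongrightarrow> 0) (at 0)"
proof -
  have "((\<lambda>t. poly q t * exp (- t)) \<longlongrightarrow> (\<Sum>i\<le>degree q. coeff q i * 0)) at_top"
  proof -
    have "poly q t * exp (- t) = (\<Sum>i\<le>degree q. coeff q i * (t ^ i / exp t))" for t :: real
      unfolding poly_altdef sum_distrib_right by (simp add: exp_minus divide_inverse mult.assoc)
    moreover have "((\<lambda>t. \<Sum>i\<le>degree q. coeff q i * (t ^ i / exp t)) \<longlongrightarrow> (\<Sum>i\<le>degree q. coeff q i * 0)) at_top"
      by (intro tendsto_sum tendsto_mult tendsto_const tendsto_power_div_exp_0)
    ultimately show ?thesis by simp
  qed
  from filterlim_compose[OF this filterlim_inverse_at_top_right]
  have "((\<lambda>x. poly q (inverse x) * exp (- inverse x)) \<longlongrightarrow> 0) (at_right 0)" by simp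
  then have "(flat q \<longlongrightarrow> 0) (at_right 0)"
    by (rule Lim_transform_eventually)
      (auto simp: flat_def eventually_at_right_field inverse_eq_divide intro!: exI[of _ 1])
  moreover have "(flat q \<longlongrightarrow> 0) (at_left 0)"
    by (rule Lim_transform_eventually[OF tendsto_const])
      (auto simp: flat_def eventually_at_left_field intro!: exI[of _ "-1"])
  ultimately show ?thesis by (simp add: filterlim_split_at)
qed

lemma flat_has_derivative:
  "(flat q has_real_derivative flat ([:0, 0, 1:] * (q - pderiv q)) x) (at x)"
proof -
  consider "x > 0" | "x < 0" | "x = 0" by linarith
  then show ?thesis
  proof cases
    case 1
    have "((\<lambda>x. poly q (1 / x) * exp (- (1 / x))) has_real_derivative
        poly (pderiv q) (1 / x) * (- 1 / x\<^sup>2) * exp (- (1 / x))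
        + exp (- (1 / x)) * (1 / x\<^sup>2) * poly q (1 / x)) (at x)"
      using 1 by (auto intro!: derivative_eq_intros DERIV_chain2[OF poly_DERIV] simp: power2_eq_square)
    moreover have "poly (pderiv q) (1 / x) * (- 1 / x\<^sup>2) * exp (- (1 / x))
        + exp (- (1 / x)) * (1 / x\<^sup>2) * poly q (1 / x) = flat ([:0, 0, 1:] * (q - pderiv q)) x"
      using 1 by (simp add: flat_def power2_eq_square algebra_simps)
    ultimately have "((\<lambda>x. poly q (1 / x) * exp (- (1 / x))) has_real_derivative
        flat ([:0, 0, 1:] * (q - pderiv q)) x) (at x)" by simp
    then show ?thesis
      by (rule has_field_derivative_transform_within_open[of _ _ _ "{0<..}"]) (use 1 in \<open>auto simp: flat_def\<close>)
  next
    case 2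
    have "((\<lambda>x. 0) has_real_derivative flat ([:0, 0, 1:] * (q - pderiv q)) x) (at x)"
      using 2 by (simp add: flat_def)
    then show ?thesis
      by (rule has_field_derivative_transform_within_open[of _ _ _ "{..<0}"]) (use 2 in \<open>auto simp: flat_def\<close>)
  next
    case 3
    have "flat (pCons 0 q) h = (flat q (0 + h) - flat q 0) / h" for h
      by (simp add: flat_def)
    then have "((\<lambda>h. (flat q (0 + h) - flat q 0) / h) \<longlongrightarrow> 0) (at 0)"
      using flat_tendsto_0[of "pCons 0 q"] by presburger
    then show ?thesis using 3 by (simp add: DERIV_def flat_def)
  qed
qed

lemma C_class_flat: "C_class n (flat q)"
proof (induction n arbitrary: q)
  case 0
  show ?case
    by (auto intro!: continuous_at_imp_continuous_on DERIV_isCont[OF flat_has_derivative])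
next
  case (Suc n)
  then show ?case by (intro C_class_real_SucI[OF flat_has_derivative])
qed

text \<open>The normalised primitive of the bump \<open>flat 1 (1 + x) flat 1 (1 - x)\<close>, which is positive exactly on
  \<open>(-1, 1)\<close>.\<close>

lemma smooth_step_exists:
  obtains R :: "real \<Rightarrow> real" and B where "\<And>n. C_class n R" "\<And>x. x \<le> - 1 \<Longrightarrow> R x = 0"
    "\<And>x. x \<ge> 1 \<Longrightarrow> R x = 1" "\<And>x. \<bar>R x\<bar> \<le> B"
proof -
  define b where "b x = flat 1 (1 * x + 1) * flat 1 ((-1) * x + 1)" for x
  have b: "C_class n b" for n
    unfolding b_def by (intro C_class_mult C_class_affine C_class_flat)
  have b_cont: "continuous_on UNIV b" using b[of 0] by simp
  have b0: "b x = 0" if "x \<le> -1 \<or> x \<ge> 1" for x using that by (auto simp: b_def flat_def)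
  have b_pos: "b x > 0" if "-1 < x" "x < 1" for x using that by (simp add: b_def flat_def)
  note d = primitive_has_real_derivative[OF b_cont]
  define I where "I = primitive b 1 - primitive b (-1)"
  have "primitive b (-1) < primitive b 1"
    by (rule DERIV_pos_imp_increasing_open[of "-1" 1 "primitive b"])
      (use d b_pos continuous_on_primitive[OF b_cont] in auto)
  then have I: "I > 0" by (simp add: I_def)
  define R where "R x = 1 / I * (primitive b x - primitive b (-1))" for x
  have R: "C_class n R" for n
    unfolding R_def by (intro C_class_cmult C_class_diff C_class_const C_class_primitive[OF b_cont] b)
  have const: "primitive b x = primitive b y" if "x \<le> y" "\<And>z. x \<le> z \<Longrightarrow> z \<le> y \<Longrightarrow> b z = 0" for x y
  proof (cases "x = y")
    case False
    have "DERIV (primitive b) z :> 0" if "x < z" "z < y" for z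
      using d[of z] that \<open>\<And>z. x \<le> z \<Longrightarrow> z \<le> y \<Longrightarrow> b z = 0\<close>[of z] by simp
    then show ?thesis
      using DERIV_isconst_end[of x y "primitive b"] False that continuous_on_primitive[OF b_cont] by simp
  qed simp
  have Rl: "R x = 0" if "x \<le> -1" for x using const[of x "-1"] that b0 by (simp add: R_def)
  have Rr: "R x = 1" if "x \<ge> 1" for x using const[of 1 x] that b0 I by (simp add: R_def I_def)
  obtain B where B: "B > 0" "\<And>x. \<bar>x\<bar> \<le> 1 \<Longrightarrow> \<bar>R x\<bar> \<le> B"
    using continuous_bounded_on_interval continuous_on_subset[of UNIV R] R[of 0] by (metis C_class.simps(1) subset_UNIV)
  have "\<bar>R x\<bar> \<le> B + 1" for x
    using B(2)[of x] B(1) Rl[of x] Rr[of x] by (cases "\<bar>x\<bar> \<le> 1") (auto simp: abs_le_iff not_le)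
  with R Rl Rr that show ?thesis by blast
qed

lemma test_functionI:
  assumes "\<And>n. C_class n \<phi>" "\<And>z. norm z > K \<Longrightarrow> \<phi> z = 0"
  shows "test_function UNIV \<phi>"
proof -
  have "{z. \<phi> z \<noteq> 0} \<subseteq> cball 0 K" using assms(2) by force
  then have "bounded {z. \<phi> z \<noteq> 0}" by (rule bounded_subset[OF bounded_cball])
  then show ?thesis using assms(1) by (simp add: test_function_def compact_closure)
qed

lemma test_function_mono: "test_function U \<phi> \<Longrightarrow> test_function UNIV \<phi>"
  by (simp add: test_function_def)

lemma test_function_support:
  assumes "test_function U \<phi>"
  obtains K where "K > 0" "\<And>z. norm z \<ge> K \<Longrightarrow> \<phi> z = 0" "\<And>z e. norm z \<ge> K \<Longrightarrow> partial e \<phi> z = 0"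
proof -
  have "bounded {z. \<phi> z \<noteq> 0}"
    using assms by (auto simp: test_function_def intro: bounded_subset[OF compact_imp_bounded closure_subset])
  then obtain K where K: "\<forall>z\<in>{z. \<phi> z \<noteq> 0}. norm z \<le> K" unfolding bounded_iff by blast
  define L where "L = max K 0 + 1"
  have zero: "\<phi> z = 0" if "norm z > K" for z using K that by force
  have "partial e \<phi> z = 0" if "norm z \<ge> L" for z e
  proof -
    have "((\<lambda>_. 0) has_derivative (\<lambda>_. 0)) (at z)" by simp
    then have "(\<phi> has_derivative (\<lambda>_. 0)) (at z)"
      by (rule has_derivative_transform_within_open[of _ _ _ _ "- cball 0 K"])
        (use that zero in \<open>auto simp: L_def\<close>)
    then show ?thesis by (rule partial_eq)
  qed
  then show ?thesis using zero by (intro that[of L]) (auto simp: L_def)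
qed

lemma test_function_partial:
  assumes "test_function U \<phi>"
  shows "test_function U (partial e \<phi>)"
proof -
  have C: "C_class (Suc n) \<phi>" for n using assms unfolding test_function_def by blast
  have "partial e \<phi> z = 0" if "z \<notin> closure {z. \<phi> z \<noteq> 0}" for z
  proof -
    have "((\<lambda>_. 0) has_derivative (\<lambda>_. 0)) (at z)" by simp
    then have "(\<phi> has_derivative (\<lambda>_. 0)) (at z)"
      by (rule has_derivative_transform_within_open[of _ _ _ _ "- closure {z. \<phi> z \<noteq> 0}"])
        (use that closure_subset[of "{z. \<phi> z \<noteq> 0}"] in \<open>auto simp del: closure_subset\<close>)
    then show ?thesis by (rule partial_eq)
  qed
  then have "{z. partial e \<phi> z \<noteq> 0} \<subseteq> closure {z. \<phi> z \<noteq> 0}" by blast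
  then have sub: "closure {z. partial e \<phi> z \<noteq> 0} \<subseteq> closure {z. \<phi> z \<noteq> 0}"
    by (rule closure_minimal) simp
  moreover have "compact (closure {z. partial e \<phi> z \<noteq> 0})"
    using sub assms bounded_subset[OF compact_imp_bounded sub]
    by (simp add: test_function_def compact_eq_bounded_closed)
  moreover have "C_class n (partial e \<phi>)" for n using C[of n] by simp
  ultimately show ?thesis using assms unfolding test_function_def by auto
qed

lemma test_function_continuous: "test_function U \<phi> \<Longrightarrow> continuous_on S \<phi>"
  unfolding test_function_def by (metis C_class.simps(1) continuous_on_subset subset_UNIV)

lemma test_function_has_derivative:
  "test_function U \<phi> \<Longrightarrow> (\<phi> has_derivative (\<lambda>e. partial e \<phi> z)) (at z)"
  unfolding test_function_def using C_class_Suc_has_derivative by blast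

lemma test_function_has_real_derivative:
  fixes \<phi> :: "real \<Rightarrow> real"
  shows "test_function U \<phi> \<Longrightarrow> (\<phi> has_real_derivative partial 1 \<phi> z) (at z)"
  unfolding test_function_def using C_class_real_Suc_D(1) by blast

section \<open>Weak derivatives on the line\<close>

lemma integrable_bounded_support:
  fixes f :: "'a::euclidean_space \<Rightarrow> real"
  assumes "f \<in> borel_measurable borel" "\<And>z. norm z \<le> K \<Longrightarrow> \<bar>f z\<bar> \<le> B" "\<And>z. norm z > K \<Longrightarrow> f z = 0"
  shows "integrable lborel f"
proof (rule integrableI_bounded_set[where A = "cball 0 K" and B = B])
  show "emeasure lborel (cball (0::'a) K) < \<infinity>"
    using emeasure_bounded_finite[OF bounded_cball] by simp
qed (use assms in auto)

lemma continuous_bounded_cball: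
  fixes f :: "'a::euclidean_space \<Rightarrow> real"
  assumes "continuous_on UNIV f"
  obtains B where "\<And>z. norm z \<le> K \<Longrightarrow> \<bar>f z\<bar> \<le> B"
proof -
  have "bounded (f ` cball 0 K)"
    by (intro compact_imp_bounded compact_continuous_image continuous_on_subset[OF assms]) auto
  then obtain B where "\<forall>x\<in>f ` cball 0 K. norm x \<le> B" unfolding bounded_iff by blast
  then show ?thesis using that[of B] by simp
qed

lemma L2_locI:
  fixes f :: "'a::euclidean_space \<Rightarrow> real"
  assumes "f \<in> borel_measurable borel" "\<And>K. \<exists>B. \<forall>z. norm z \<le> K \<longrightarrow> \<bar>f z\<bar> \<le> B"
  shows "L2_loc f"
  unfolding L2_loc_def
proof (intro conjI allI impI)
  fix K :: "'a set" assume K: "compact K"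
  from compact_imp_bounded[OF K] obtain R where R: "\<forall>z\<in>K. norm z \<le> R"
    unfolding bounded_iff by (rule exE)
  from assms(2)[of R] obtain B where B: "\<forall>z. norm z \<le> R \<longrightarrow> \<bar>f z\<bar> \<le> B" by (rule exE)
  have "integrable lborel (\<lambda>z. indicator K z * (f z)\<^sup>2)"
  proof (rule integrable_bounded_support)
    show "(\<lambda>z. indicator K z * (f z)\<^sup>2) \<in> borel_measurable borel"
      using assms(1) K by (intro borel_measurable_times borel_measurable_indicator borel_measurable_power)
        (auto intro: borel_compact)
    show "\<bar>indicator K z * (f z)\<^sup>2\<bar> \<le> B\<^sup>2" if "norm z \<le> R" for z
      using B that by (auto simp: indicator_def abs_le_square_iff[symmetric] intro: order_trans)
    show "indicator K z * (f z)\<^sup>2 = 0" if "norm z > R" for z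
      using R that by (auto simp: indicator_def)
  qed
  then show "set_integrable lborel K (\<lambda>z. (f z)\<^sup>2)" by (simp add: set_integrable_def)
qed (rule assms(1))

lemma L2_loc_continuous:
  fixes f :: "'a::euclidean_space \<Rightarrow> real"
  assumes "continuous_on UNIV f"
  shows "L2_loc f"
proof (rule L2_locI)
  show "f \<in> borel_measurable borel" using assms by (rule borel_measurable_continuous_onI)
  show "\<exists>B. \<forall>z. norm z \<le> K \<longrightarrow> \<bar>f z\<bar> \<le> B" for K
    by (rule continuous_bounded_cball[OF assms, of K]) blast
qed

text \<open>On a bounded set \<open>\<bar>w\<bar> \<le> w\<^sup>2 + 1\<close>, so local square integrability implies local integrability.\<close>

lemma L2_loc_mult_integrable:
  fixes w \<phi> :: "'a::euclidean_space \<Rightarrow> real"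
  assumes w: "L2_loc w" and \<phi>: "\<phi> \<in> borel_measurable borel" "\<And>z. \<bar>\<phi> z\<bar> \<le> B" "\<And>z. norm z > K \<Longrightarrow> \<phi> z = 0"
  shows "integrable lborel (\<lambda>z. w z * \<phi> z)"
proof (rule Bochner_Integration.integrable_bound)
  let ?C = "cball (0::'a) K"
  have "integrable lborel (\<lambda>z. indicator ?C z *\<^sub>R (w z)\<^sup>2)"
    using w unfolding L2_loc_def set_integrable_def by auto
  moreover have "integrable lborel (indicator ?C :: 'a \<Rightarrow> real)"
    by (rule integrable_bounded_support[of _ K 1, OF borel_measurable_indicator]) (simp_all add: indicator_def)
  ultimately have "integrable lborel (\<lambda>z. B * (indicator ?C z *\<^sub>R (w z)\<^sup>2 + indicator ?C z))"
    by (intro integrable_mult_right Bochner_Integration.integrable_add)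
  then show "integrable lborel (\<lambda>z. B * (indicator ?C z *\<^sub>R (w z)\<^sup>2 + indicator ?C z))" .
  show "(\<lambda>z. w z * \<phi> z) \<in> borel_measurable lborel"
    using borel_measurable_times[of w borel \<phi>] w \<phi>(1) unfolding L2_loc_def by simp
  have "norm (w z * \<phi> z) \<le> norm (B * (indicator ?C z *\<^sub>R (w z)\<^sup>2 + indicator ?C z))" for z
  proof (cases "norm z \<le> K")
    case True
    have "\<bar>w z\<bar> \<le> (w z)\<^sup>2 + 1"
      using abs_mult_le_half_squares[of "w z" 1] zero_le_power2[of "w z"] by simp
    moreover have "B \<ge> 0" using \<phi>(2)[of z] by linarith
    ultimately have "\<bar>w z\<bar> * \<bar>\<phi> z\<bar> \<le> ((w z)\<^sup>2 + 1) * B" by (intro mult_mono \<phi>(2)) auto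
    also have "\<dots> \<le> \<bar>B * ((w z)\<^sup>2 + 1)\<bar>" using abs_ge_self[of "((w z)\<^sup>2 + 1) * B"] by (simp add: mult.commute)
    finally show ?thesis using True by (simp add: abs_mult)
  qed (use \<phi>(3) in auto)
  then show "AE z in lborel. norm (w z * \<phi> z) \<le> norm (B * (indicator ?C z *\<^sub>R (w z)\<^sup>2 + indicator ?C z))"
    by simp
qed

lemma L2_loc_set_integrable:
  fixes w :: "real \<Rightarrow> real"
  assumes "L2_loc w"
  shows "set_integrable lborel {\<alpha>..\<beta>} w"
proof -
  have "integrable lborel (\<lambda>z. w z * indicator {\<alpha>..\<beta>} z)"
    by (rule L2_loc_mult_integrable[OF assms, of _ 1 "\<bar>\<alpha>\<bar> + \<bar>\<beta>\<bar>"]) (auto simp: indicator_def)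
  then show ?thesis by (simp add: set_integrable_def mult.commute)
qed

lemma integral_dilation:
  fixes f :: "real \<Rightarrow> real"
  assumes "c \<noteq> 0"
  shows "(LINT t|lborel. f (c * t)) = (LINT x|lborel. f x) / \<bar>c\<bar>"
  using lborel_integral_real_affine[of c f 0] assms by simp

lemma step_derivative_zero:
  fixes R R' :: "real \<Rightarrow> real"
  assumes R: "\<And>x. (R has_real_derivative R' x) (at x)"
    and left: "\<And>x. x \<le> - 1 \<Longrightarrow> R x = 0" and right: "\<And>x. x \<ge> 1 \<Longrightarrow> R x = 1"
    and x: "\<bar>x\<bar> > 1"
  shows "R' x = 0"
proof -
  have "x < -1 \<or> x > 1" using x by linarith
  then show ?thesis
  proof
    assume x: "x < -1"
    have "(R has_real_derivative 0) (at x)"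
      by (rule has_field_derivative_transform_within_open[of "\<lambda>_. 0" _ _ "{..<-1}"])
        (use x left in auto)
    then show ?thesis using DERIV_unique R by blast
  next
    assume x: "x > 1"
    have "(R has_real_derivative 0) (at x)"
      by (rule has_field_derivative_transform_within_open[of "\<lambda>_. 1" _ _ "{1<..}"])
        (use x right in auto)
    then show ?thesis using DERIV_unique R by blast
  qed
qed

lemma scaled_ge_1: "x \<ge> 1 \<Longrightarrow> x * real (Suc n) \<ge> 1"
  using mult_mono[of 1 x 1 "real (Suc n)"] by simp

lemma scaled_le_minus_1: "x \<le> - 1 \<Longrightarrow> x * real (Suc n) \<le> - 1"
  using scaled_ge_1[of "- x" n] by simp

text \<open>For a smooth step \<open>R\<close> from 0 to 1, the derivative of \<open>R ((t - s) N)\<close> tends to the Dirac mass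
  at \<open>s\<close> as \<open>N\<close> grows.\<close>

lemma step_derivative_tendsto_dirac:
  fixes f R R' :: "real \<Rightarrow> real"
  assumes f: "continuous_on UNIV f"
    and R: "\<And>x. (R has_real_derivative R' x) (at x)" and R': "continuous_on UNIV R'"
    and left: "\<And>x. x \<le> - 1 \<Longrightarrow> R x = 0" and right: "\<And>x. x \<ge> 1 \<Longrightarrow> R x = 1"
  shows "(\<lambda>n. LINT t|lborel. f t * (R' ((t - s) * real (Suc n)) * real (Suc n))) \<longlonglongrightarrow> f s"
proof -
  note R'0 = step_derivative_zero[OF R left right]
  have subst: "(LINT t|lborel. f t * (R' ((t - s) * real (Suc n)) * real (Suc n)))
      = (LINT x|lborel. f (s + x / real (Suc n)) * R' x)" for n
  proof -
    have "(LINT t|lborel. f t * (R' ((t - s) * real (Suc n)) * real (Suc n)))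
        = \<bar>1 / real (Suc n)\<bar> *\<^sub>R (LINT x|lborel. f (s + 1 / real (Suc n) * x)
            * (R' ((s + 1 / real (Suc n) * x - s) * real (Suc n)) * real (Suc n)))"
      by (rule lborel_integral_real_affine) simp
    also have "(\<lambda>x. f (s + 1 / real (Suc n) * x) * (R' ((s + 1 / real (Suc n) * x - s) * real (Suc n)) * real (Suc n)))
        = (\<lambda>x. real (Suc n) * (f (s + x / real (Suc n)) * R' x))"
      by (simp add: fun_eq_iff)
    finally show ?thesis by simp
  qed
  obtain Bf where Bf: "\<And>x. norm x \<le> \<bar>s\<bar> + 1 \<Longrightarrow> \<bar>f x\<bar> \<le> Bf"
    using continuous_bounded_cball[OF f] by metis
  obtain BR where BR: "\<And>x. norm x \<le> 1 \<Longrightarrow> \<bar>R' x\<bar> \<le> BR"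
    using continuous_bounded_cball[OF R'] by metis
  have meas: "g \<in> borel_measurable borel" if "continuous_on UNIV g" for g :: "real \<Rightarrow> real"
    using that by (rule borel_measurable_continuous_onI)
  have int: "integrable lborel R'"
    by (rule integrable_bounded_support[OF meas[OF R'], of 1 BR]) (use BR R'0 in auto)
  have "(\<lambda>n. LINT x|lborel. f (s + x / real (Suc n)) * R' x) \<longlonglongrightarrow> (LINT x|lborel. f s * R' x)"
  proof (rule integral_dominated_convergence[where w = "\<lambda>x. Bf * \<bar>R' x\<bar>"])
    show "integrable lborel (\<lambda>x. Bf * \<bar>R' x\<bar>)" using int by simp
    show "(\<lambda>x. f s * R' x) \<in> borel_measurable lborel" using meas[OF R'] by simp
    have "continuous_on UNIV (\<lambda>x. f (s + x / real (Suc n)) * R' x)" for n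
      by (intro continuous_on_mult R' continuous_on_compose2[OF f]) (auto intro!: continuous_intros)
    then show "(\<lambda>x. f (s + x / real (Suc n)) * R' x) \<in> borel_measurable lborel" for n
      using meas by simp
    show "AE x in lborel. (\<lambda>n. f (s + x / real (Suc n)) * R' x) \<longlonglongrightarrow> f s * R' x"
    proof (intro AE_I2 tendsto_mult tendsto_const)
      fix x :: real
      have "(\<lambda>n. s + x / real (Suc n)) \<longlonglongrightarrow> s + 0"
        by (intro tendsto_add tendsto_const LIMSEQ_Suc lim_const_over_n)
      moreover have "isCont f s" using f by (simp add: continuous_on_eq_continuous_at)
      ultimately show "(\<lambda>n. f (s + x / real (Suc n))) \<longlonglongrightarrow> f s"
        using isCont_tendsto_compose by fastforce
    qed
    show "AE x in lborel. norm (f (s + x / real (Suc n)) * R' x) \<le> Bf * \<bar>R' x\<bar>" for n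
    proof (rule AE_I2)
      fix x :: real
      show "norm (f (s + x / real (Suc n)) * R' x) \<le> Bf * \<bar>R' x\<bar>"
      proof (cases "\<bar>x\<bar> \<le> 1")
        case True
        have "\<bar>x / real (Suc n)\<bar> \<le> 1" using True by (simp add: divide_le_eq)
        then have "norm (s + x / real (Suc n)) \<le> \<bar>s\<bar> + 1" unfolding real_norm_def by linarith
        then show ?thesis using Bf by (simp add: abs_mult mult_right_mono)
      qed (use R'0 in simp)
    qed
  qed
  moreover have "(LINT x|lborel. R' x) = 1"
  proof -
    have "(LINT x|lborel. R' x) = (LBINT x:{-2..2}. R' x)"
      unfolding set_lebesgue_integral_def
    proof (rule Bochner_Integration.integral_cong)
      show "R' x = indicat_real {-2..2} x *\<^sub>R R' x" for x
        using R'0[of x] by (cases "\<bar>x\<bar> > 1") (auto simp: indicator_def)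
    qed simp
    also have "\<dots> = R 2 - R (-2)"
      unfolding set_lebesgue_integral_def
      by (rule integral_FTC_atLeastAtMost)
        (use R R' in \<open>auto simp: has_real_derivative_iff_has_vector_derivative[symmetric]
          intro: has_field_derivative_at_within continuous_on_subset\<close>)
    finally show ?thesis using left right by simp
  qed
  ultimately show ?thesis unfolding subst by simp
qed

text \<open>Testing with a difference of two smooth steps recovers the fundamental theorem of calculus for
  weak derivatives.\<close>

lemma weak_derivative_FTC:
  fixes f w :: "real \<Rightarrow> real"
  assumes f: "continuous_on UNIV f" and w: "L2_loc w" and fw: "weak_partial 1 f w" and le: "\<alpha> \<le> \<beta>"
  shows "(LBINT x:{\<alpha>..\<beta>}. w x) = f \<beta> - f \<alpha>"
proof -
  obtain R :: "real \<Rightarrow> real" and B where RC: "\<And>n. C_class n R" and left: "\<And>x. x \<le> - 1 \<Longrightarrow> R x = 0"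
    and right: "\<And>x. x \<ge> 1 \<Longrightarrow> R x = 1" and RB: "\<And>x. \<bar>R x\<bar> \<le> B"
    using smooth_step_exists by metis
  define R' where "R' = partial 1 R"
  have R: "(R has_real_derivative R' x) (at x)" for x
    unfolding R'_def by (rule C_class_real_Suc_D(1)[OF RC])
  have R': "continuous_on UNIV R'"
    unfolding R'_def using C_class_real_Suc_D(2)[OF RC[of "Suc 0"]] by simp
  define \<phi> where "\<phi> n t = R ((t - \<alpha>) * real (Suc n)) - R ((t - \<beta>) * real (Suc n))" for n t
  define K where "K = \<bar>\<alpha>\<bar> + \<bar>\<beta>\<bar> + 1"
  have outside: "\<phi> n t = 0" if "\<bar>t\<bar> > K" for n t
  proof -
    have "(t - \<alpha>) * real (Suc n) \<le> - 1 \<and> (t - \<beta>) * real (Suc n) \<le> -1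
        \<or> (t - \<alpha>) * real (Suc n) \<ge> 1 \<and> (t - \<beta>) * real (Suc n) \<ge> 1"
    proof (cases "t < 0")
      case True
      then have "t - \<alpha> \<le> -1" "t - \<beta> \<le> -1" using that unfolding K_def by linarith+
      then show ?thesis using scaled_le_minus_1 by blast
    next
      case False
      then have "t - \<alpha> \<ge> 1" "t - \<beta> \<ge> 1" using that unfolding K_def by linarith+
      then show ?thesis using scaled_ge_1 by blast
    qed
    then show ?thesis using left right unfolding \<phi>_def by auto
  qed
  have \<phi>C: "C_class j (\<phi> n)" for n j
  proof -
    have "C_class j (\<lambda>t. R (real (Suc n) * t + (- \<alpha> * real (Suc n))) - R (real (Suc n) * t + (- \<beta> * real (Suc n))))"
      by (intro C_class_diff C_class_affine RC)
    then show ?thesis unfolding \<phi>_def[abs_def] by (simp add: algebra_simps)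
  qed
  have test: "test_function UNIV (\<phi> n)" for n
    by (rule test_functionI[OF \<phi>C, of K]) (use outside in auto)
  have d\<phi>: "partial 1 (\<phi> n) t = R' ((t - \<alpha>) * real (Suc n)) * real (Suc n)
      - R' ((t - \<beta>) * real (Suc n)) * real (Suc n)" for n t
  proof -
    have "(\<phi> n has_real_derivative R' ((t - \<alpha>) * real (Suc n)) * real (Suc n)
      - R' ((t - \<beta>) * real (Suc n)) * real (Suc n)) (at t)"
      unfolding \<phi>_def
      by (intro DERIV_diff DERIV_chain2[OF R]) (auto intro!: derivative_eq_intros)
    from partial_eq_deriv[OF this, of 1] show ?thesis by simp
  qed
  have int: "integrable lborel (\<lambda>t. f t * (R' ((t - s) * real (Suc n)) * real (Suc n)))" for n s
  proof -
    define \<psi> where "\<psi> t = f t * (R' ((t - s) * real (Suc n)) * real (Suc n))" for t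
    have c: "continuous_on UNIV \<psi>"
      unfolding \<psi>_def by (intro continuous_on_mult f continuous_on_compose2[OF R'] continuous_on_const)
        (auto intro!: continuous_intros)
    have "\<psi> t = 0" if "norm t > \<bar>s\<bar> + 1" for t
    proof -
      have "1 < \<bar>t - s\<bar>" using that unfolding real_norm_def by linarith
      also have "\<dots> \<le> \<bar>t - s\<bar> * real (Suc n)" using mult_left_mono[of 1 "real (Suc n)" "\<bar>t - s\<bar>"] by simp
      finally have "\<bar>(t - s) * real (Suc n)\<bar> > 1" by (simp add: abs_mult)
      then show ?thesis using step_derivative_zero[OF R left right] by (simp add: \<psi>_def)
    qed
    moreover obtain B where "\<And>t. norm t \<le> \<bar>s\<bar> + 1 \<Longrightarrow> \<bar>\<psi> t\<bar> \<le> B"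
      using continuous_bounded_cball[OF c] by metis
    ultimately have "integrable lborel \<psi>"
      using integrable_bounded_support[OF borel_measurable_continuous_onI[OF c]] by blast
    then show ?thesis unfolding \<psi>_def .
  qed
  have lhs: "(\<lambda>n. LINT t|lborel. f t * partial 1 (\<phi> n) t) \<longlonglongrightarrow> f \<alpha> - f \<beta>"
  proof -
    have "(LINT t|lborel. f t * partial 1 (\<phi> n) t)
      = (LINT t|lborel. f t * (R' ((t - \<alpha>) * real (Suc n)) * real (Suc n)))
        - (LINT t|lborel. f t * (R' ((t - \<beta>) * real (Suc n)) * real (Suc n)))" for n
      unfolding d\<phi> right_diff_distrib by (rule Bochner_Integration.integral_diff[OF int int])
    then show ?thesis
      by (simp only:) (intro tendsto_diff step_derivative_tendsto_dirac[OF f R R' left right])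
  qed
  have rhs: "(\<lambda>n. LINT t|lborel. w t * \<phi> n t) \<longlonglongrightarrow> (LINT t|lborel. indicator {\<alpha>..\<beta>} t *\<^sub>R w t)"
  proof (rule integral_dominated_convergence[where w = "\<lambda>t. \<bar>w t * (2 * B * indicator (cball 0 K) t)\<bar>"])
    have wm: "w \<in> borel_measurable borel" using w by (simp add: L2_loc_def)
    have "integrable lborel (\<lambda>t. w t * (2 * B * indicator (cball 0 K) t))"
      by (rule L2_loc_mult_integrable[OF w, of _ "\<bar>2 * B\<bar>" K]) (auto simp: indicator_def)
    then show "integrable lborel (\<lambda>t. \<bar>w t * (2 * B * indicator (cball 0 K) t)\<bar>)"
      by (rule integrable_abs)
    show "(\<lambda>t. indicator {\<alpha>..\<beta>} t *\<^sub>R w t) \<in> borel_measurable lborel" using wm by simp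
    have "continuous_on UNIV (\<phi> n)" for n using \<phi>C[of 0 n] by simp
    then show "(\<lambda>t. w t * \<phi> n t) \<in> borel_measurable lborel" for n
      using borel_measurable_times[OF wm borel_measurable_continuous_onI] by simp
    show "AE t in lborel. norm (w t * \<phi> n t) \<le> \<bar>w t * (2 * B * indicator (cball 0 K) t)\<bar>" for n
    proof (rule AE_I2)
      fix t
      show "norm (w t * \<phi> n t) \<le> \<bar>w t * (2 * B * indicator (cball 0 K) t)\<bar>"
      proof (cases "\<bar>t\<bar> \<le> K")
        case True
        have "\<bar>\<phi> n t\<bar> \<le> B + B" unfolding \<phi>_def by (intro order_trans[OF abs_triangle_ineq4] add_mono RB)
        then show ?thesis using True by (auto simp: abs_mult intro!: mult_left_mono)
      qed (use outside in auto)
    qed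
    have lim: "(\<lambda>n. R ((t - s) * real (Suc n))) \<longlonglongrightarrow> (if t > s then 1 else 0)" if "t \<noteq> s" for t s
    proof (rule tendsto_eventually)
      obtain N where N: "1 / \<bar>t - s\<bar> < real N" using reals_Archimedean2 by blast
      show "\<forall>\<^sub>F n in sequentially. R ((t - s) * real (Suc n)) = (if t > s then 1 else 0)"
      proof (rule eventually_sequentiallyI[of N])
        fix n assume "N \<le> n"
        then have "1 / \<bar>t - s\<bar> \<le> real (Suc n)" using N by linarith
        then have big: "1 \<le> \<bar>t - s\<bar> * real (Suc n)" using that by (simp add: field_simps)
        show "R ((t - s) * real (Suc n)) = (if t > s then 1 else 0)"
        proof (cases "t > s")
          case True
          then show ?thesis using right big by simp
        next
          case False
          then have "(t - s) * real (Suc n) = - (\<bar>t - s\<bar> * real (Suc n))"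
            by (simp only: abs_of_nonpos not_less diff_le_0_iff_le mult_minus_left minus_minus)
          then have "(t - s) * real (Suc n) \<le> - 1" using big by linarith
          then show ?thesis using left False by simp
        qed
      qed
    qed
    have "AE t in lborel. t \<noteq> \<alpha> \<and> t \<noteq> \<beta>"
      using AE_lborel_singleton[of \<alpha>] AE_lborel_singleton[of \<beta>] by eventually_elim simp
    then show "AE t in lborel. (\<lambda>n. w t * \<phi> n t) \<longlonglongrightarrow> indicator {\<alpha>..\<beta>} t *\<^sub>R w t"
    proof eventually_elim
      case (elim t)
      have "(\<lambda>n. w t * \<phi> n t) \<longlonglongrightarrow> w t * ((if t > \<alpha> then 1 else 0) - (if t > \<beta> then 1 else 0))"
        unfolding \<phi>_def using elim by (intro tendsto_mult tendsto_diff tendsto_const lim) auto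
      moreover have "w t * ((if t > \<alpha> then 1 else 0) - (if t > \<beta> then 1 else 0)) = indicator {\<alpha>..\<beta>} t *\<^sub>R w t"
        using elim le by (auto simp: indicator_def)
      ultimately show ?case by simp
    qed
  qed
  have "(LINT t|lborel. f t * partial 1 (\<phi> n) t) = - (LINT t|lborel. w t * \<phi> n t)" for n
    using fw test unfolding weak_partial_def by blast
  then have "f \<alpha> - f \<beta> = - (LINT t|lborel. indicator {\<alpha>..\<beta>} t *\<^sub>R w t)"
    using LIMSEQ_unique[OF lhs] tendsto_minus[OF rhs] by simp
  then show ?thesis by (simp add: set_lebesgue_integral_def)
qed


text \<open>Testing with a smoothed piecewise linear hat over \<open>s1 < s2 < s3\<close>, whose second derivative is
  a combination of Dirac masses, expresses that \<open>W\<close> takes the value of the chord at \<open>s2\<close>.\<close>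

lemma weak_second_derivative_zero_chord:
  fixes W :: "real \<Rightarrow> real"
  assumes W: "continuous_on UNIV W"
    and zero: "\<And>\<phi>. test_function UNIV \<phi> \<Longrightarrow> (\<And>t. t \<le> 0 \<Longrightarrow> \<phi> t = 0)
      \<Longrightarrow> (LINT t|lborel. W t * partial 1 (partial 1 \<phi>) t) = 0"
    and s: "0 < s1" "s1 < s2" "s2 < s3"
  shows "(s3 - s2) * W s1 - (s3 - s1) * W s2 + (s2 - s1) * W s3 = 0"
proof -
  obtain R :: "real \<Rightarrow> real" and B where RC: "\<And>n. C_class n R" and left: "\<And>x. x \<le> - 1 \<Longrightarrow> R x = 0"
    and right: "\<And>x. x \<ge> 1 \<Longrightarrow> R x = 1" and RB: "\<And>x. \<bar>R x\<bar> \<le> B"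
    using smooth_step_exists by metis
  define R' where "R' = partial 1 R"
  have R: "(R has_real_derivative R' x) (at x)" for x
    unfolding R'_def by (rule C_class_real_Suc_D(1)[OF RC])
  have R': "continuous_on UNIV R'"
    unfolding R'_def using C_class_real_Suc_D(2)[OF RC[of "Suc 0"]] by simp
  have Rc: "continuous_on UNIV R" using RC[of 0] by simp
  \<comment> \<open>\<open>Q\<close> is zero on the left and affine on the right, hence a smoothed positive part.\<close>
  define Q where "Q x = primitive R x - primitive R (-1)" for x
  have Q: "(Q has_real_derivative R x) (at x)" for x
    unfolding Q_def using primitive_has_real_derivative[OF Rc] by (auto intro!: derivative_eq_intros)
  have QC: "C_class n Q" for n
    unfolding Q_def by (intro C_class_diff C_class_const C_class_primitive[OF Rc] RC)
  have Qleft: "Q x = 0" if "x \<le> -1" for x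
  proof (cases "x = -1")
    case False
    have "Q (-1) = Q x"
    proof (rule DERIV_isconst_end[of x "-1" Q])
      show "continuous_on {x..-1} Q"
        by (rule DERIV_continuous_on[OF has_field_derivative_at_within[OF Q]])
      show "DERIV Q z :> 0" if "z < -1" for z
        using Q[of z] left[of z] that by simp
    qed (use that False in simp)
    then show ?thesis by (simp add: Q_def)
  qed (simp add: Q_def)
  have Qright: "Q x = Q 1 + (x - 1)" if "x \<ge> 1" for x
  proof (cases "x = 1")
    case False
    have "Q x - x = Q 1 - 1"
    proof (rule DERIV_isconst_end[of 1 x "\<lambda>x. Q x - x"])
      have d: "((\<lambda>x. Q x - x) has_real_derivative R z - 1) (at z)" for z
        using Q by (auto intro!: derivative_eq_intros)
      show "continuous_on {1..x} (\<lambda>x. Q x - x)"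
        by (rule DERIV_continuous_on[OF has_field_derivative_at_within[OF d]])
      show "DERIV (\<lambda>x. Q x - x) z :> 0" if "1 < z" for z
        using d[of z] right[of z] that by simp
    qed (use that False in simp)
    then show ?thesis by simp
  qed simp
  define c1 where "c1 = s3 - s2"
  define c2 where "c2 = s3 - s1"
  define c3 where "c3 = s2 - s1"
  \<comment> \<open>The scales start beyond \<open>N\<close>, so that the smoothed hat vanishes for \<open>t \<le> 0\<close>.\<close>
  obtain N :: nat where N: "1 / s1 < real N" using reals_Archimedean2 by blast
  define h where "h n = real (Suc (n + N))" for n
  have h: "h n > 0" "s1 * h n \<ge> 1" "h n \<ge> 1" for n
  proof -
    show "h n > 0" "h n \<ge> 1" by (auto simp: h_def)
    have "1 / s1 \<le> h n" using N by (simp add: h_def)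
    then show "s1 * h n \<ge> 1" using s by (simp add: field_simps)
  qed
  define \<psi> where "\<psi> n t = (c1 * Q (h n * t + (- s1 * h n)) - c2 * Q (h n * t + (- s2 * h n))
      + c3 * Q (h n * t + (- s3 * h n))) * (1 / h n)" for n t
  have \<psi>C: "C_class j (\<psi> n)" for n j
    unfolding \<psi>_def by (intro C_class_mult C_class_add C_class_diff C_class_const C_class_affine QC)
  have \<psi>0: "\<psi> n t = 0" if "t \<le> 0" for n t
  proof -
    have "h n * t \<le> 0" using h(1)[of n] that by (simp add: mult_le_0_iff)
    moreover have "s2 * h n \<ge> s1 * h n" "s3 * h n \<ge> s1 * h n"
      using h(1)[of n] s by (auto intro!: mult_right_mono)
    ultimately have "h n * t + (- s1 * h n) \<le> -1" "h n * t + (- s2 * h n) \<le> -1" "h n * t + (- s3 * h n) \<le> -1"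
      using h(2)[of n] by auto
    then show ?thesis by (simp add: \<psi>_def Qleft)
  qed
  \<comment> \<open>To the right of \<open>s3\<close> all three terms are affine, and the weights cancel both coefficients.\<close>
  have \<psi>1: "\<psi> n t = 0" if "t \<ge> s3 + 1" for n t
  proof -
    have "(t - s) * h n \<ge> 1" if "t - s \<ge> 1" for s
      unfolding h_def using that by (rule scaled_ge_1)
    from this[of s1] this[of s2] this[of s3] have ge: "h n * t + (- s1 * h n) \<ge> 1" "h n * t + (- s2 * h n) \<ge> 1" "h n * t + (- s3 * h n) \<ge> 1"
      using that s by (simp_all add: algebra_simps)
    have "\<psi> n t = (c1 * (Q 1 + (h n * t + (- s1 * h n) - 1)) - c2 * (Q 1 + (h n * t + (- s2 * h n) - 1))
        + c3 * (Q 1 + (h n * t + (- s3 * h n) - 1))) * (1 / h n)"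
      unfolding \<psi>_def by (simp only: Qright[OF ge(1)] Qright[OF ge(2)] Qright[OF ge(3)])
    also have "c1 * (Q 1 + (h n * t + (- s1 * h n) - 1)) - c2 * (Q 1 + (h n * t + (- s2 * h n) - 1))
        + c3 * (Q 1 + (h n * t + (- s3 * h n) - 1)) = 0"
      unfolding c1_def c2_def c3_def by (simp add: algebra_simps)
    finally show ?thesis by simp
  qed
  have test: "test_function UNIV (\<psi> n)" for n
  proof (rule test_functionI[OF \<psi>C])
    show "\<psi> n z = 0" if "norm z > s3 + 1" for z
      using \<psi>0[of z n] \<psi>1[of z n] that by (cases "z \<le> 0") auto
  qed
  have d1: "(\<psi> n has_real_derivative (c1 * R (h n * t + (- s1 * h n)) - c2 * R (h n * t + (- s2 * h n))
      + c3 * R (h n * t + (- s3 * h n)))) (at t)" for n t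
  proof -
    have "(\<psi> n has_real_derivative (c1 * (R (h n * t + (- s1 * h n)) * h n) - c2 * (R (h n * t + (- s2 * h n)) * h n)
      + c3 * (R (h n * t + (- s3 * h n)) * h n)) * (1 / h n)) (at t)"
      unfolding \<psi>_def
      by (intro DERIV_cmult_right DERIV_add DERIV_diff DERIV_cmult DERIV_chain2[OF Q])
        (auto intro!: derivative_eq_intros)
    moreover have "(x * (p * h n) - y * (q * h n) + z * (r * h n)) * (1 / h n) = x * p - y * q + z * r"
      for x y z p q r using h(1)[of n] by (simp add: field_simps)
    ultimately show ?thesis by (simp only:)
  qed
  have p1: "partial 1 (\<psi> n) = (\<lambda>t. c1 * R (h n * t + (- s1 * h n)) - c2 * R (h n * t + (- s2 * h n))
      + c3 * R (h n * t + (- s3 * h n)))" for n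
    using partial_eq_deriv[OF d1, of 1] by (simp add: fun_eq_iff)
  have p2: "partial 1 (partial 1 (\<psi> n)) t = c1 * (R' ((t - s1) * h n) * h n)
      - c2 * (R' ((t - s2) * h n) * h n) + c3 * (R' ((t - s3) * h n) * h n)" for n t
  proof -
    have "(partial 1 (\<psi> n) has_real_derivative (c1 * (R' (h n * t + (- s1 * h n)) * h n)
      - c2 * (R' (h n * t + (- s2 * h n)) * h n) + c3 * (R' (h n * t + (- s3 * h n)) * h n))) (at t)"
      unfolding p1
      by (intro DERIV_add DERIV_diff DERIV_cmult DERIV_chain2[OF R]) (auto intro!: derivative_eq_intros)
    from partial_eq_deriv[OF this, of 1] show ?thesis by (simp add: algebra_simps)
  qed
  have int: "integrable lborel (\<lambda>t. W t * (R' ((t - s) * h n) * h n))" for n s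
  proof -
    have c: "continuous_on UNIV (\<lambda>t. W t * (R' ((t - s) * h n) * h n))"
      by (intro continuous_on_mult W continuous_on_compose2[OF R'] continuous_on_const)
        (auto intro!: continuous_intros)
    obtain B where B: "\<And>t. norm t \<le> \<bar>s\<bar> + 1 \<Longrightarrow> \<bar>W t * (R' ((t - s) * h n) * h n)\<bar> \<le> B"
      using continuous_bounded_cball[OF c] by metis
    have Z: "W t * (R' ((t - s) * h n) * h n) = 0" if "norm t > \<bar>s\<bar> + 1" for t
    proof -
      have "1 < \<bar>t - s\<bar>" using that unfolding real_norm_def by linarith
      also have "\<dots> \<le> \<bar>t - s\<bar> * h n" using mult_left_mono[OF h(3)[of n], of "\<bar>t - s\<bar>"] by simp
      finally have "\<bar>(t - s) * h n\<bar> > 1" using h(1)[of n] by (simp add: abs_mult)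
      then show ?thesis using step_derivative_zero[OF R left right] by simp
    qed
    show ?thesis by (rule integrable_bounded_support[OF borel_measurable_continuous_onI[OF c] B Z])
  qed
  define L where "L n s = (LINT t|lborel. W t * (R' ((t - s) * h n) * h n))" for n s
  have lim: "(\<lambda>n. L n s) \<longlonglongrightarrow> W s" for s
    using LIMSEQ_ignore_initial_segment[OF step_derivative_tendsto_dirac[OF W R R' left right], of s N]
    unfolding L_def h_def .
  have "0 = c1 * L n s1 - c2 * L n s2 + c3 * L n s3" for n
  proof -
    have "0 = (LINT t|lborel. W t * partial 1 (partial 1 (\<psi> n)) t)"
      by (rule zero[OF test \<psi>0, symmetric])
    also have "\<dots> = (LINT t|lborel. c1 * (W t * (R' ((t - s1) * h n) * h n))
        - c2 * (W t * (R' ((t - s2) * h n) * h n)) + c3 * (W t * (R' ((t - s3) * h n) * h n)))"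
      unfolding p2 by (simp add: algebra_simps)
    also have "\<dots> = c1 * L n s1 - c2 * L n s2 + c3 * L n s3"
      unfolding L_def using int
      by (simp only: Bochner_Integration.integral_add Bochner_Integration.integral_diff
          Bochner_Integration.integrable_diff integrable_mult_right integral_mult_right_zero)
    finally show ?thesis .
  qed
  moreover have "(\<lambda>n. c1 * L n s1 - c2 * L n s2 + c3 * L n s3) \<longlonglongrightarrow> c1 * W s1 - c2 * W s2 + c3 * W s3"
    by (intro tendsto_intros lim)
  ultimately have "(\<lambda>n. 0) \<longlonglongrightarrow> c1 * W s1 - c2 * W s2 + c3 * W s3" by simp
  then show ?thesis using LIMSEQ_unique tendsto_const unfolding c1_def c2_def c3_def by metis
qed

lemma weak_second_derivative_zero_affine:
  fixes W :: "real \<Rightarrow> real"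
  assumes W: "continuous_on UNIV W"
    and zero: "\<And>\<phi>. test_function UNIV \<phi> \<Longrightarrow> (\<And>t. t \<le> 0 \<Longrightarrow> \<phi> t = 0)
      \<Longrightarrow> (LINT t|lborel. W t * partial 1 (partial 1 \<phi>) t) = 0"
  shows "\<exists>A B. \<forall>t>0. W t = A + B * t"
proof (intro exI allI impI)
  fix t :: real assume t: "t > 0"
  note chord = weak_second_derivative_zero_chord[OF W zero]
  consider "t < 1" | "t = 1" | "1 < t" "t < 2" | "t = 2" | "t > 2" by linarith
  then show "W t = (2 * W 1 - W 2) + (W 2 - W 1) * t"
  proof cases
    case 1 then show ?thesis using chord[of t 1 2] t by (simp add: algebra_simps)
  next
    case 3 then show ?thesis using chord[of 1 t 2] by (simp add: algebra_simps)
  next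
    case 5 then show ?thesis using chord[of 1 2 t] by (simp add: algebra_simps)
  qed simp_all
qed

text \<open>The dilation is moved to the test function.\<close>

lemma weak_derivative_dilation:
  fixes g w :: "real \<Rightarrow> real"
  assumes gw: "weak_partial 1 g w" and c: "c \<noteq> 0" and \<phi>: "test_function UNIV \<phi>"
  shows "(LINT t|lborel. w (c * t) * \<phi> t) = - (LINT t|lborel. g (c * t) * partial 1 \<phi> t) / c"
proof -
  define \<psi> where "\<psi> x = \<phi> (1 / c * x + 0)" for x
  obtain K where K: "K > 0" "\<And>z. norm z \<ge> K \<Longrightarrow> \<phi> z = 0"
    using test_function_support[OF \<phi>] by metis
  have "test_function UNIV \<psi>"
  proof (rule test_functionI)
    show "C_class n \<psi>" for n
      unfolding \<psi>_def by (rule C_class_affine) (use \<phi> in \<open>simp add: test_function_def\<close>)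
    show "\<psi> x = 0" if "norm x > K * \<bar>c\<bar>" for x
    proof -
      have "K \<le> \<bar>x\<bar> / \<bar>c\<bar>" using that c by (simp add: pos_le_divide_eq)
      then show ?thesis unfolding \<psi>_def by (intro K(2)) simp
    qed
  qed
  then have "(LINT x|lborel. g x * partial 1 \<psi> x) = - (LINT x|lborel. w x * \<psi> x)"
    using gw unfolding weak_partial_def by blast
  moreover have "partial 1 \<psi> x = partial 1 \<phi> (x / c) / c" for x
  proof -
    have "(\<psi> has_real_derivative partial 1 \<phi> (1 / c * x + 0) * (1 / c)) (at x)"
      unfolding \<psi>_def using c by (intro DERIV_chain2[OF test_function_has_real_derivative[OF \<phi>]])
        (auto intro!: derivative_eq_intros)
    from partial_eq_deriv[OF this, of 1] show ?thesis by simp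
  qed
  moreover have "(LINT t|lborel. w (c * t) * \<phi> t) = (LINT x|lborel. w x * \<psi> x) / \<bar>c\<bar>"
    using integral_dilation[OF c, of "\<lambda>x. w x * \<phi> (x / c)"] c by (simp add: \<psi>_def)
  moreover have "(LINT t|lborel. g (c * t) * partial 1 \<phi> t) / c
      = (LINT x|lborel. g x * (partial 1 \<phi> (x / c) / c)) / \<bar>c\<bar>"
    using integral_dilation[OF c, of "\<lambda>x. g x * (partial 1 \<phi> (x / c) / c)"] c by simp
  ultimately show ?thesis by simp
qed

lemma integration_by_parts_half_line:
  fixes f f' g g' :: "real \<Rightarrow> real"
  assumes f: "\<And>x. (f has_real_derivative f' x) (at x)" and f': "continuous_on UNIV f'"
    and g: "\<And>x. (g has_real_derivative g' x) (at x)" and g': "continuous_on UNIV g'"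
    and supp: "\<And>x. \<bar>x\<bar> \<ge> K \<Longrightarrow> g x = 0 \<and> g' x = 0"
  shows "(LINT x|lborel. indicator {0<..} x * (f x * g' x))
    = - (f 0 * g 0) - (LINT x|lborel. indicator {0<..} x * (f' x * g x))"
proof -
  define b where "b = \<bar>K\<bar>"
  have cut: "(LINT x|lborel. indicator {0<..} x * r x) = (LINT x|lborel. indicator {0..b} x *\<^sub>R r x)"
    if meas: "r \<in> borel_measurable borel" and "\<And>x. \<bar>x\<bar> \<ge> K \<Longrightarrow> r x = 0" for r :: "real \<Rightarrow> real"
  proof (rule integral_cong_AE)
    show "AE x in lborel. indicator {0<..} x * r x = indicator {0..b} x *\<^sub>R r x"
      using AE_lborel_singleton[of 0]
    proof eventually_elim
      case (elim x)
      show ?case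
      proof (cases "x \<le> b")
        case False
        then have "r x = 0" using that(2)[of x] by (simp add: b_def)
        then show ?thesis by simp
      qed (use elim in \<open>auto simp: indicator_def\<close>)
    qed
  qed (use meas in \<open>auto intro!: borel_measurable_times borel_measurable_indicator\<close>)
  have fc: "continuous_on UNIV f" and gc: "continuous_on UNIV g"
    using f g by (auto intro!: continuous_at_imp_continuous_on DERIV_isCont)
  have "(LINT x|lborel. indicator {0..b} x *\<^sub>R (f x * g' x))
      = f b * g b - f 0 * g 0 - (LINT x|lborel. indicator {0..b} x *\<^sub>R (f' x * g x))"
    by (rule integral_by_parts') (use f g f' g' in \<open>auto simp: b_def continuous_on_eq_continuous_at\<close>)
  moreover have "g b = 0" using supp[of b] by (simp add: b_def)
  moreover have "(LINT x|lborel. indicator {0<..} x * (f x * g' x)) = (LINT x|lborel. indicator {0..b} x *\<^sub>R (f x * g' x))"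
    by (rule cut) (use supp fc g' in \<open>auto intro!: borel_measurable_continuous_onI continuous_on_mult\<close>)
  moreover have "(LINT x|lborel. indicator {0<..} x * (f' x * g x)) = (LINT x|lborel. indicator {0..b} x *\<^sub>R (f' x * g x))"
    by (rule cut) (use supp f' gc in \<open>auto intro!: borel_measurable_continuous_onI continuous_on_mult\<close>)
  ultimately show ?thesis by simp
qed

lemma integration_by_parts_negative_half_line:
  fixes f f' g g' :: "real \<Rightarrow> real"
  assumes f: "\<And>x. (f has_real_derivative f' x) (at x)" and f': "continuous_on UNIV f'"
    and g: "\<And>x. (g has_real_derivative g' x) (at x)" and g': "continuous_on UNIV g'"
    and supp: "\<And>x. \<bar>x\<bar> \<ge> K \<Longrightarrow> g x = 0 \<and> g' x = 0"
  shows "(LINT x|lborel. indicator {..<0} x * (f x * g' x))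
    = f 0 * g 0 - (LINT x|lborel. indicator {..<0} x * (f' x * g x))"
proof -
  have refl: "(LINT x|lborel. indicator {..<0} x * r x) = (LINT x|lborel. indicator {0<..} x * r (- x))" for r :: "real \<Rightarrow> real"
    using integral_dilation[of "-1" "\<lambda>x. indicator {0<..} x * r (- x)"]
    by (simp add: indicator_def cong: if_cong)
  have mirror: "(uminus has_real_derivative - 1) (at x)" for x :: real
    by (auto intro!: derivative_eq_intros)
  have "(LINT x|lborel. indicator {0<..} x * (f (- x) * (- g' (- x))))
      = - (f (- 0) * g (- 0)) - (LINT x|lborel. indicator {0<..} x * (- f' (- x) * g (- x)))"
  proof (rule integration_by_parts_half_line)
    show "((\<lambda>x. f (- x)) has_real_derivative - f' (- x)) (at x)" for x
      using DERIV_chain2[OF f mirror] by simp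
    show "((\<lambda>x. g (- x)) has_real_derivative - g' (- x)) (at x)" for x
      using DERIV_chain2[OF g mirror] by simp
    show "continuous_on UNIV (\<lambda>x. - f' (- x))"
      by (intro continuous_on_minus continuous_on_compose2[OF f']) (auto intro!: continuous_intros)
    show "continuous_on UNIV (\<lambda>x. - g' (- x))"
      by (intro continuous_on_minus continuous_on_compose2[OF g']) (auto intro!: continuous_intros)
    show "g (- x) = 0 \<and> - g' (- x) = 0" if "\<bar>x\<bar> \<ge> K" for x using supp[of "- x"] that by simp
  qed
  then show ?thesis unfolding refl by simp
qed

lemma integration_by_parts_line:
  fixes f f' g g' :: "real \<Rightarrow> real"
  assumes f: "\<And>x. (f has_real_derivative f' x) (at x)" and f': "continuous_on UNIV f'"
    and g: "\<And>x. (g has_real_derivative g' x) (at x)" and g': "continuous_on UNIV g'"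
    and supp: "\<And>x. \<bar>x\<bar> \<ge> K \<Longrightarrow> g x = 0 \<and> g' x = 0"
  shows "(LINT x|lborel. f x * g' x) = - (LINT x|lborel. f' x * g x)"
proof -
  define b where "b = \<bar>K\<bar>"
  have zero: "g x = 0 \<and> g' x = 0" if "\<not> (- b \<le> x \<and> x \<le> b)" for x
    using supp[of x] that by (auto simp: b_def abs_le_iff not_le)
  have "(LINT x|lborel. indicator {-b..b} x *\<^sub>R (f x * g' x))
      = f b * g b - f (-b) * g (-b) - (LINT x|lborel. indicator {-b..b} x *\<^sub>R (f' x * g x))"
    by (rule integral_by_parts') (use f f' g g' in \<open>auto simp: b_def continuous_on_eq_continuous_at\<close>)
  moreover have "(\<lambda>x. indicator {-b..b} x *\<^sub>R (f x * g' x)) = (\<lambda>x. f x * g' x)"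
      "(\<lambda>x. indicator {-b..b} x *\<^sub>R (f' x * g x)) = (\<lambda>x. f' x * g x)"
    using zero by (auto simp: indicator_def fun_eq_iff)
  moreover have "g b = 0" "g (-b) = 0" using supp[of b] supp[of "-b"] by (auto simp: b_def)
  ultimately show ?thesis by simp
qed

lemma weak_partial_C1:
  fixes f f' :: "real \<Rightarrow> real"
  assumes f: "\<And>x. (f has_real_derivative f' x) (at x)" and f': "continuous_on UNIV f'"
  shows "weak_partial 1 f f'"
  unfolding weak_partial_def
proof (intro allI impI)
  fix \<phi> :: "real \<Rightarrow> real" assume \<phi>: "test_function UNIV \<phi>"
  obtain K where K: "\<And>z. norm z \<ge> K \<Longrightarrow> \<phi> z = 0" "\<And>z e. norm z \<ge> K \<Longrightarrow> partial e \<phi> z = 0"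
    using test_function_support[OF \<phi>] by metis
  show "(LINT x|lborel. f x * partial 1 \<phi> x) = - (LINT x|lborel. f' x * \<phi> x)"
    by (rule integration_by_parts_line[OF f f' test_function_has_real_derivative[OF \<phi>]
          test_function_continuous[OF test_function_partial[OF \<phi>]], of K]) (simp add: K)
qed

section \<open>Uniqueness of weak derivatives\<close>

text \<open>The positive and the negative part of \<open>d\<close> are densities of two finite measures that agree on all
  half-lines \<open>(x, \<infinity>)\<close> and therefore coincide.\<close>

lemma AE_zero_if_interval_integrals_zero:
  fixes d :: "real \<Rightarrow> real"
  assumes int: "set_integrable lborel {\<alpha>..\<beta>} d"
    and zero: "\<And>s t. \<alpha> \<le> s \<Longrightarrow> s \<le> t \<Longrightarrow> t \<le> \<beta> \<Longrightarrow> (LBINT x:{s..t}. d x) = 0"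
  shows "AE x in lborel. x \<in> {\<alpha>..\<beta>} \<longrightarrow> d x = 0"
proof -
  define D where "D x = indicator {\<alpha>..\<beta>} x * d x" for x
  have D: "integrable lborel D"
    using int unfolding set_integrable_def D_def[abs_def] by simp
  define P where "P x = max (D x) 0" for x
  define N where "N x = max (- D x) 0" for x
  have P: "integrable lborel P" and N: "integrable lborel N"
    unfolding P_def[abs_def] N_def[abs_def]
    by (rule integrable_max[OF D integrable_zero], rule integrable_max[OF integrable_minus[OF D] integrable_zero])
  have tail: "integrable lborel (\<lambda>y. f y * indicator {x<..} y)" if "integrable lborel f" for f :: "real \<Rightarrow> real" and x
    using integrable_mult_indicator[OF _ that, of "{x<..}"] by (simp add: mult.commute)
  have em: "emeasure (density lborel (\<lambda>x. ennreal (f x))) {x<..} = ennreal (LINT y|lborel. f y * indicator {x<..} y)"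
    if f: "integrable lborel f" and pos: "\<And>y. 0 \<le> f y" for f :: "real \<Rightarrow> real" and x
  proof -
    have "emeasure (density lborel (\<lambda>x. ennreal (f x))) {x<..} = (\<integral>\<^sup>+ y. ennreal (f y) * indicator {x<..} y \<partial>lborel)"
      using borel_measurable_integrable[OF f] by (intro emeasure_density) auto
    also have "\<dots> = (\<integral>\<^sup>+ y. ennreal (f y * indicator {x<..} y) \<partial>lborel)"
      by (intro nn_integral_cong) (simp add: indicator_def)
    also have "\<dots> = ennreal (LINT y|lborel. f y * indicator {x<..} y)"
      using pos by (intro nn_integral_eq_integral tail[OF f]) auto
    finally show ?thesis .
  qed
  have zero_tail: "(LINT y|lborel. D y * indicator {x<..} y) = 0" for x
  proof -
    have "(LINT y|lborel. D y * indicator {x<..} y) = (LINT y|lborel. indicator {max x \<alpha>..\<beta>} y *\<^sub>R d y)"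
    proof (rule integral_cong_AE)
      show "(\<lambda>y. D y * indicator {x<..} y) \<in> borel_measurable lborel"
        using borel_measurable_integrable[OF tail[OF D]] .
      have "set_integrable lborel {max x \<alpha>..\<beta>} d"
        by (rule set_integrable_subset[OF int]) auto
      then show "(\<lambda>y. indicator {max x \<alpha>..\<beta>} y *\<^sub>R d y) \<in> borel_measurable lborel"
        unfolding set_integrable_def by (rule borel_measurable_integrable)
      show "AE y in lborel. D y * indicator {x<..} y = indicator {max x \<alpha>..\<beta>} y *\<^sub>R d y"
        using AE_lborel_singleton[of x] by eventually_elim (auto simp: D_def indicator_def)
    qed
    also have "\<dots> = 0"
    proof (cases "max x \<alpha> \<le> \<beta>")
      case True
      then show ?thesis using zero[of "max x \<alpha>" \<beta>] by (simp add: set_lebesgue_integral_def)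
    qed simp
    finally show ?thesis .
  qed
  have "density lborel (\<lambda>x. ennreal (P x)) = density lborel (\<lambda>x. ennreal (N x))"
  proof (rule measure_eqI_lessThan)
    have pos: "0 \<le> P y" "0 \<le> N y" for y by (simp_all add: P_def N_def)
    show "emeasure (density lborel (\<lambda>x. ennreal (P x))) {x<..} < \<infinity>" for x
      unfolding em[OF P pos(1)] by simp
    have diff: "(LINT y|lborel. P y * indicator {x<..} y) - (LINT y|lborel. N y * indicator {x<..} y)
        = (LINT y|lborel. D y * indicator {x<..} y)" for x
    proof -
      have "(\<lambda>y. D y * indicator {x<..} y) = (\<lambda>y. P y * indicator {x<..} y - N y * indicator {x<..} y)"
        by (auto simp: P_def N_def max_def fun_eq_iff)
      then show ?thesis using Bochner_Integration.integral_diff[OF tail[OF P] tail[OF N], of x x] by simp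
    qed
    show "emeasure (density lborel (\<lambda>x. ennreal (P x))) {x<..} = emeasure (density lborel (\<lambda>x. ennreal (N x))) {x<..}" for x
      unfolding em[OF P pos(1)] em[OF N pos(2)] using zero_tail[of x] diff[of x] by simp
  qed simp_all
  moreover have "(\<lambda>x. ennreal (P x)) \<in> borel_measurable lborel" "(\<lambda>x. ennreal (N x)) \<in> borel_measurable lborel"
    using borel_measurable_integrable[OF P] borel_measurable_integrable[OF N] by simp_all
  ultimately have "AE x in lborel. ennreal (P x) = ennreal (N x)"
    using sigma_finite_measure.density_unique[OF sigma_finite_lborel] by blast
  then show ?thesis
  proof eventually_elim
    case (elim x)
    then have "P x = N x" by (simp add: P_def N_def)
    then have "D x = 0" by (auto simp: P_def N_def max_def split: if_splits)
    then show ?case by (auto simp: D_def)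
  qed
qed

text \<open>Countably many intervals with rational end points cover the open set.\<close>

lemma AE_zero_on_open_if_interval_integrals_zero:
  fixes d :: "real \<Rightarrow> real"
  assumes I: "open I" and int: "\<And>\<alpha> \<beta>. set_integrable lborel {\<alpha>..\<beta>} d"
    and zero: "\<And>s t. s \<le> t \<Longrightarrow> {s..t} \<subseteq> I \<Longrightarrow> (LBINT x:{s..t}. d x) = 0"
  shows "AE x in lborel. x \<in> I \<longrightarrow> d x = 0"
proof -
  define J where "J = {q \<in> \<rat> \<times> \<rat>. {fst q..snd q} \<subseteq> I}"
  have "countable J" unfolding J_def
    by (rule countable_subset[of _ "\<rat> \<times> \<rat>"]) (auto intro: countable_rat)
  moreover have "AE x in lborel. x \<in> {fst q..snd q} \<longrightarrow> d x = 0" if "q \<in> J" for q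
  proof (rule AE_zero_if_interval_integrals_zero[OF int])
    fix s t assume "fst q \<le> s" "s \<le> t" "t \<le> snd q"
    then have "{s..t} \<subseteq> {fst q..snd q}" by auto
    also have "\<dots> \<subseteq> I" using that by (auto simp: J_def)
    finally show "(LBINT x:{s..t}. d x) = 0" by (rule zero[OF \<open>s \<le> t\<close>])
  qed
  ultimately have "AE x in lborel. \<forall>q\<in>J. x \<in> {fst q..snd q} \<longrightarrow> d x = 0"
    by (subst AE_ball_countable) auto
  then show ?thesis
  proof eventually_elim
    case (elim x)
    show ?case
    proof
      assume "x \<in> I"
      then obtain e where e: "e > 0" "cball x e \<subseteq> I" using I open_contains_cball by blast
      obtain a where a: "a \<in> \<rat>" "x - e < a" "a < x" using Rats_dense_in_real[of "x - e" x] e by auto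
      obtain b where b: "b \<in> \<rat>" "x < b" "b < x + e" using Rats_dense_in_real[of x "x + e"] e by auto
      have "{a..b} \<subseteq> cball x e" using a b by (auto simp: dist_real_def)
      then have "(a, b) \<in> J" using a b e by (auto simp: J_def)
      then show "d x = 0" using elim a b by force
    qed
  qed
qed

text \<open>The increments of \<open>f\<close> over the intervals in \<open>I\<close> are the integrals of its weak derivative and at
  the same time those of \<open>h'\<close>.\<close>

lemma weak_derivative_eq_classical:
  fixes f h h' w :: "real \<Rightarrow> real"
  assumes f: "continuous_on UNIV f" and w: "L2_loc w" and fw: "weak_partial 1 f w"
    and I: "open I" and fh: "\<And>x y. x \<in> I \<Longrightarrow> y \<in> I \<Longrightarrow> f x - f y = h x - h y"
    and h: "\<And>x. (h has_real_derivative h' x) (at x)" and h': "continuous_on UNIV h'"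
  shows "AE x in lborel. x \<in> I \<longrightarrow> w x = h' x"
proof -
  have int': "set_integrable lborel {\<alpha>..\<beta>} h'" for \<alpha> \<beta>
    by (rule borel_integrable_atLeastAtMost') (rule continuous_on_subset[OF h'], simp)
  have "AE x in lborel. x \<in> I \<longrightarrow> w x - h' x = 0"
  proof (rule AE_zero_on_open_if_interval_integrals_zero[OF I])
    show "set_integrable lborel {\<alpha>..\<beta>} (\<lambda>x. w x - h' x)" for \<alpha> \<beta>
      by (intro set_integral_diff L2_loc_set_integrable[OF w] int')
    fix s t assume st: "s \<le> t" "{s..t} \<subseteq> I"
    have "(LBINT x:{s..t}. w x - h' x) = (LBINT x:{s..t}. w x) - (LBINT x:{s..t}. h' x)"
      by (intro set_integral_diff L2_loc_set_integrable[OF w] int')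
    also have "(LBINT x:{s..t}. w x) = f t - f s" by (rule weak_derivative_FTC[OF f w fw st(1)])
    also have "(LBINT x:{s..t}. h' x) = h t - h s"
      unfolding set_lebesgue_integral_def
    proof (rule integral_FTC_atLeastAtMost[OF st(1)])
      show "(h has_vector_derivative h' x) (at x within {s..t})" for x
        using h by (simp add: has_real_derivative_iff_has_vector_derivative[symmetric] has_field_derivative_at_within)
    qed (rule continuous_on_subset[OF h'], simp)
    also have "f t - f s - (h t - h s) = 0" using fh[of t s] st by (simp add: subset_iff)
    finally show "(LBINT x:{s..t}. w x - h' x) = 0" .
  qed
  then show ?thesis by simp
qed

section \<open>Continuous, piecewise smooth solutions of the wave equation\<close>

lemma test_function_line_derivative:
  fixes \<phi> :: "'a::euclidean_space \<Rightarrow> real"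
  assumes "test_function U \<phi>"
  shows "((\<lambda>r. \<phi> (z + r *\<^sub>R e)) has_real_derivative partial e \<phi> (z + r *\<^sub>R e)) (at r)"
proof -
  have "((\<lambda>r. z + r *\<^sub>R e) has_derivative (\<lambda>h. h *\<^sub>R e)) (at r)"
    by (auto intro!: derivative_eq_intros)
  from has_derivative_compose[OF this test_function_has_derivative[OF assms]]
  have "((\<lambda>r. \<phi> (z + r *\<^sub>R e)) has_derivative (\<lambda>h. partial (h *\<^sub>R e) \<phi> (z + r *\<^sub>R e))) (at r)" .
  moreover have "partial (h *\<^sub>R e) \<phi> (z + r *\<^sub>R e) = partial e \<phi> (z + r *\<^sub>R e) * h" for h
    using linear_cmul[OF has_derivative_linear[OF test_function_has_derivative[OF assms]], of h e]
    by (simp add: mult.commute)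
  ultimately show ?thesis by (simp only: has_field_derivative_def)
qed

lemma test_function_x_derivative:
  fixes \<phi> :: "real \<times> real \<Rightarrow> real"
  assumes "test_function U \<phi>"
  shows "((\<lambda>x. \<phi> (x, t)) has_real_derivative partial (1, 0) \<phi> (x, t)) (at x)"
  using test_function_line_derivative[OF assms, of "(0, t)" "(1, 0)" x] by simp

lemma test_function_t_derivative:
  fixes \<phi> :: "real \<times> real \<Rightarrow> real"
  assumes "test_function U \<phi>"
  shows "((\<lambda>t. \<phi> (x, t)) has_real_derivative partial (0, 1) \<phi> (x, t)) (at t)"
  using test_function_line_derivative[OF assms, of "(x, 0)" "(0, 1)" t] by simp

lemma partial_pair:
  fixes \<phi> :: "real \<times> real \<Rightarrow> real"
  assumes "test_function U \<phi>"
  shows "partial (b, c) \<phi> z = b * partial (1, 0) \<phi> z + c * partial (0, 1) \<phi> z"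
proof -
  have lin: "linear (\<lambda>e. partial e \<phi> z)"
    by (rule has_derivative_linear[OF test_function_has_derivative[OF assms]])
  have "partial (b, c) \<phi> z = partial (b *\<^sub>R (1, 0) + c *\<^sub>R (0, 1)) \<phi> z" by simp
  also have "\<dots> = b * partial (1, 0) \<phi> z + c * partial (0, 1) \<phi> z"
    unfolding linear_add[OF lin] linear_cmul[OF lin] by simp
  finally show ?thesis .
qed

lemma test_function_bounded:
  assumes "test_function U \<phi>"
  obtains B where "\<And>z. \<bar>\<phi> z\<bar> \<le> B"
proof -
  obtain K where K: "\<And>z. norm z \<ge> K \<Longrightarrow> \<phi> z = 0" using test_function_support[OF assms] by metis
  obtain B where B: "\<And>z. norm z \<le> K \<Longrightarrow> \<bar>\<phi> z\<bar> \<le> B"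
    using continuous_bounded_cball[OF test_function_continuous[OF assms]] by metis
  have "\<bar>\<phi> z\<bar> \<le> max B 0" for z using K[of z] B[of z] by (cases "norm z \<le> K") auto
  then show ?thesis using that by blast
qed

lemma L2_loc_test_integrable:
  fixes w \<phi> :: "'a::euclidean_space \<Rightarrow> real"
  assumes "L2_loc w" "test_function U \<phi>"
  shows "integrable lborel (\<lambda>z. w z * \<phi> z)"
proof -
  obtain K where K: "\<And>z. norm z \<ge> K \<Longrightarrow> \<phi> z = 0" using test_function_support[OF assms(2)] by metis
  obtain B where B: "\<And>z. \<bar>\<phi> z\<bar> \<le> B" using test_function_bounded[OF assms(2)] by metis
  show ?thesis
    by (rule L2_loc_mult_integrable[OF assms(1) borel_measurable_continuous_onI[OF test_function_continuous[OF assms(2)]] B, of K])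
      (simp add: K)
qed

lemma abs_le_norm_Pair: "\<bar>x\<bar> \<le> norm (x, t)" "\<bar>t\<bar> \<le> norm (x, t)" for x t :: real
  using norm_fst_le[of x t] norm_snd_le[of t x] by simp_all

text \<open>By Fubini's theorem it suffices to integrate by parts on every line in the direction of the
  derivative.\<close>

lemma weak_partial_x_if_slices:
  fixes u w :: "real \<times> real \<Rightarrow> real"
  assumes u: "L2_loc u" and w: "L2_loc w"
    and slices: "\<And>t g g' K. (\<And>x. (g has_real_derivative g' x) (at x)) \<Longrightarrow> continuous_on UNIV g'
      \<Longrightarrow> (\<And>x. \<bar>x\<bar> \<ge> K \<Longrightarrow> g x = 0 \<and> g' x = 0)
      \<Longrightarrow> (LINT x|lborel. u (x, t) * g' x) = - (LINT x|lborel. w (x, t) * g x)"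
  shows "weak_partial (1, 0) u w"
  unfolding weak_partial_def
proof (intro allI impI)
  fix \<phi> :: "real \<times> real \<Rightarrow> real" assume \<phi>: "test_function UNIV \<phi>"
  note d\<phi> = test_function_partial[OF \<phi>, of "(1, 0)"]
  obtain K where K: "\<And>z. norm z \<ge> K \<Longrightarrow> \<phi> z = 0" "\<And>z e. norm z \<ge> K \<Longrightarrow> partial e \<phi> z = 0"
    using test_function_support[OF \<phi>] by metis
  have "(LINT z|lborel. u z * partial (1, 0) \<phi> z) = (LINT t|lborel. LINT x|lborel. u (x, t) * partial (1, 0) \<phi> (x, t))"
    using lborel_pair.integral_snd[of "\<lambda>x t. u (x, t) * partial (1, 0) \<phi> (x, t)"]
      L2_loc_test_integrable[OF u d\<phi>] by (simp add: lborel_prod split_beta')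
  also have "\<dots> = (LINT t|lborel. - (LINT x|lborel. w (x, t) * \<phi> (x, t)))"
  proof (rule Bochner_Integration.integral_cong[OF refl])
    fix t :: real
    show "(LINT x|lborel. u (x, t) * partial (1, 0) \<phi> (x, t)) = - (LINT x|lborel. w (x, t) * \<phi> (x, t))"
    proof (rule slices[where K = K])
      show "((\<lambda>x. \<phi> (x, t)) has_real_derivative partial (1, 0) \<phi> (x, t)) (at x)" for x
        by (rule test_function_x_derivative[OF \<phi>])
      show "continuous_on UNIV (\<lambda>x. partial (1, 0) \<phi> (x, t))"
        by (rule continuous_on_compose2[OF test_function_continuous[OF d\<phi>, of UNIV]])
          (auto intro!: continuous_intros)
      show "\<phi> (x, t) = 0 \<and> partial (1, 0) \<phi> (x, t) = 0" if "\<bar>x\<bar> \<ge> K" for x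
        using K[of "(x, t)"] that abs_le_norm_Pair(1)[of x t] by simp
    qed
  qed
  also have "\<dots> = - (LINT z|lborel. w z * \<phi> z)"
    using lborel_pair.integral_snd[of "\<lambda>x t. w (x, t) * \<phi> (x, t)"]
      L2_loc_test_integrable[OF w \<phi>] by (simp add: lborel_prod split_beta')
  finally show "(LINT z|lborel. u z * partial (1, 0) \<phi> z) = - (LINT z|lborel. w z * \<phi> z)" .
qed

lemma weak_partial_t_if_slices:
  fixes u w :: "real \<times> real \<Rightarrow> real"
  assumes u: "L2_loc u" and w: "L2_loc w"
    and slices: "\<And>x g g' K. x \<noteq> 0 \<Longrightarrow> (\<And>t. (g has_real_derivative g' t) (at t)) \<Longrightarrow> continuous_on UNIV g'
      \<Longrightarrow> (\<And>t. \<bar>t\<bar> \<ge> K \<Longrightarrow> g t = 0 \<and> g' t = 0)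
      \<Longrightarrow> (LINT t|lborel. u (x, t) * g' t) = - (LINT t|lborel. w (x, t) * g t)"
  shows "weak_partial (0, 1) u w"
  unfolding weak_partial_def
proof (intro allI impI)
  fix \<phi> :: "real \<times> real \<Rightarrow> real" assume \<phi>: "test_function UNIV \<phi>"
  note d\<phi> = test_function_partial[OF \<phi>, of "(0, 1)"]
  obtain K where K: "\<And>z. norm z \<ge> K \<Longrightarrow> \<phi> z = 0" "\<And>z e. norm z \<ge> K \<Longrightarrow> partial e \<phi> z = 0"
    using test_function_support[OF \<phi>] by metis
  have int: "integrable (lborel \<Otimes>\<^sub>M lborel) (\<lambda>z. u z * partial (0, 1) \<phi> z)"
    "integrable (lborel \<Otimes>\<^sub>M lborel) (\<lambda>z. w z * \<phi> z)"
    using L2_loc_test_integrable[OF u d\<phi>] L2_loc_test_integrable[OF w \<phi>] by (simp_all add: lborel_prod)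
  have "(LINT z|lborel. u z * partial (0, 1) \<phi> z) = (LINT x|lborel. LINT t|lborel. u (x, t) * partial (0, 1) \<phi> (x, t))"
    using lborel_pair.integral_fst'[OF int(1)] by (simp add: lborel_prod)
  also have "\<dots> = (LINT x|lborel. - (LINT t|lborel. w (x, t) * \<phi> (x, t)))"
  proof (rule integral_cong_AE)
    show "(\<lambda>x. LINT t|lborel. u (x, t) * partial (0, 1) \<phi> (x, t)) \<in> borel_measurable lborel"
      using lborel_pair.integrable_fst'[OF int(1)] by (rule borel_measurable_integrable)
    show "(\<lambda>x. - (LINT t|lborel. w (x, t) * \<phi> (x, t))) \<in> borel_measurable lborel"
      using lborel_pair.integrable_fst'[OF int(2)] by (intro borel_measurable_uminus borel_measurable_integrable)
    show "AE x in lborel. (LINT t|lborel. u (x, t) * partial (0, 1) \<phi> (x, t)) = - (LINT t|lborel. w (x, t) * \<phi> (x, t))"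
      using AE_lborel_singleton[of 0]
    proof eventually_elim
      case (elim x)
      show ?case
      proof (rule slices[OF elim, where K = K])
        show "((\<lambda>t. \<phi> (x, t)) has_real_derivative partial (0, 1) \<phi> (x, t)) (at t)" for t
          by (rule test_function_t_derivative[OF \<phi>])
        show "continuous_on UNIV (\<lambda>t. partial (0, 1) \<phi> (x, t))"
          by (rule continuous_on_compose2[OF test_function_continuous[OF d\<phi>, of UNIV]])
            (auto intro!: continuous_intros)
        show "\<phi> (x, t) = 0 \<and> partial (0, 1) \<phi> (x, t) = 0" if "\<bar>t\<bar> \<ge> K" for t
          using K[of "(x, t)"] that abs_le_norm_Pair(2)[of t x] by simp
      qed
    qed
  qed
  also have "\<dots> = - (LINT z|lborel. w z * \<phi> z)"
    using lborel_pair.integral_fst'[OF int(2)] by (simp add: lborel_prod)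
  finally show "(LINT z|lborel. u z * partial (0, 1) \<phi> z) = - (LINT z|lborel. w z * \<phi> z)" .
qed

lemma integral_split_at_0:
  fixes r1 r2 :: "real \<Rightarrow> real"
  assumes "continuous_on UNIV r1" "continuous_on UNIV r2"
    and supp: "\<And>x. \<bar>x\<bar> \<ge> K \<Longrightarrow> r1 x = 0 \<and> r2 x = 0"
  shows "(LINT x|lborel. (if x > 0 then r1 x else r2 x))
    = (LINT x|lborel. indicator {0<..} x * r1 x) + (LINT x|lborel. indicator {..<0} x * r2 x)"
proof -
  have int: "integrable lborel (\<lambda>x. indicator A x * r x)"
    if A: "A \<in> sets borel" and rc: "continuous_on UNIV r" and r0: "\<And>x. \<bar>x\<bar> \<ge> K \<Longrightarrow> r x = 0" for A and r :: "real \<Rightarrow> real"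
  proof -
    obtain B where B: "\<And>x. norm x \<le> K \<Longrightarrow> \<bar>r x\<bar> \<le> B"
      using continuous_bounded_cball[OF rc] by metis
    show ?thesis
    proof (rule integrable_bounded_support[where K = K and B = B])
      show "(\<lambda>x. indicator A x * r x) \<in> borel_measurable borel"
        using borel_measurable_times[OF borel_measurable_indicator[OF A] borel_measurable_continuous_onI[OF rc]] .
      show "\<bar>indicator A x * r x\<bar> \<le> B" if "norm x \<le> K" for x
        using B[OF that] by (auto simp: indicator_def)
    qed (use r0 in auto)
  qed
  have i1: "integrable lborel (\<lambda>x. indicator {0<..} x * r1 x)"
    and i2: "integrable lborel (\<lambda>x. indicator {..<0} x * r2 x)"
    using int[of "{0<..}" r1] int[of "{..<0}" r2] assms by auto
  have "(LINT x|lborel. (if x > 0 then r1 x else r2 x))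
      = (LINT x|lborel. indicator {0<..} x * r1 x + indicator {..<0} x * r2 x)"
  proof (rule integral_cong_AE)
    show "(\<lambda>x. if x > 0 then r1 x else r2 x) \<in> borel_measurable lborel"
      using borel_measurable_continuous_onI[OF assms(1)] borel_measurable_continuous_onI[OF assms(2)] by simp
    show "(\<lambda>x. indicator {0<..} x * r1 x + indicator {..<0} x * r2 x) \<in> borel_measurable lborel"
      using i1 i2 by (intro borel_measurable_integrable Bochner_Integration.integrable_add)
    show "AE x in lborel. (if x > 0 then r1 x else r2 x) = indicator {0<..} x * r1 x + indicator {..<0} x * r2 x"
      using AE_lborel_singleton[of 0] by eventually_elim (auto simp: indicator_def)
  qed
  then show ?thesis using Bochner_Integration.integral_add[OF i1 i2] by simp
qed

lemma integration_by_parts_glued: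
  fixes f1 f2 f1' f2' g g' :: "real \<Rightarrow> real"
  assumes f1: "\<And>x. (f1 has_real_derivative f1' x) (at x)" "continuous_on UNIV f1'"
    and f2: "\<And>x. (f2 has_real_derivative f2' x) (at x)" "continuous_on UNIV f2'"
    and g: "\<And>x. (g has_real_derivative g' x) (at x)" "continuous_on UNIV g'"
    and supp: "\<And>x. \<bar>x\<bar> \<ge> K \<Longrightarrow> g x = 0 \<and> g' x = 0"
  shows "(LINT x|lborel. (if x > 0 then f1 x else f2 x) * g' x)
    = (f2 0 - f1 0) * g 0 - (LINT x|lborel. (if x > 0 then f1' x else f2' x) * g x)"
proof -
  have c: "continuous_on UNIV h" if "\<And>x. (h has_real_derivative h' x) (at x)" for h h' :: "real \<Rightarrow> real"
    by (rule DERIV_continuous_on[OF has_field_derivative_at_within[OF that]])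
  have "(LINT x|lborel. (if x > 0 then f1 x else f2 x) * g' x)
      = (LINT x|lborel. indicator {0<..} x * (f1 x * g' x)) + (LINT x|lborel. indicator {..<0} x * (f2 x * g' x))"
    using integral_split_at_0[of "\<lambda>x. f1 x * g' x" "\<lambda>x. f2 x * g' x" K] supp
      continuous_on_mult[OF c[OF f1(1)] g(2)] continuous_on_mult[OF c[OF f2(1)] g(2)]
    by (simp add: if_distrib[of "\<lambda>y. y * _"] cong: if_cong)
  moreover have "(LINT x|lborel. (if x > 0 then f1' x else f2' x) * g x)
      = (LINT x|lborel. indicator {0<..} x * (f1' x * g x)) + (LINT x|lborel. indicator {..<0} x * (f2' x * g x))"
    using integral_split_at_0[of "\<lambda>x. f1' x * g x" "\<lambda>x. f2' x * g x" K] supp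
      continuous_on_mult[OF f1(2) c[OF g(1)]] continuous_on_mult[OF f2(2) c[OF g(1)]]
    by (simp add: if_distrib[of "\<lambda>y. y * _"] cong: if_cong)
  ultimately show ?thesis
    using integration_by_parts_half_line[OF f1 g supp] integration_by_parts_negative_half_line[OF f2 g supp]
    by (simp add: left_diff_distrib)
qed

lemma borel_measurable_glued:
  fixes r1 r2 :: "real \<times> real \<Rightarrow> real"
  assumes "continuous_on UNIV r1" "continuous_on UNIV r2"
  shows "(\<lambda>z. if fst z > 0 then r1 z else r2 z) \<in> borel_measurable borel"
proof (rule measurable_If)
  have "open {z::real \<times> real. 0 < fst z}" by (intro open_Collect_less continuous_intros)
  then show "{z \<in> space borel. 0 < fst z} \<in> sets (borel :: (real \<times> real) measure)" by simp
qed (use assms borel_measurable_continuous_onI in auto)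

lemma L2_loc_glued:
  fixes r1 r2 :: "real \<times> real \<Rightarrow> real"
  assumes r: "continuous_on UNIV r1" "continuous_on UNIV r2"
  shows "L2_loc (\<lambda>z. if fst z > 0 then r1 z else r2 z)"
proof (rule L2_locI[OF borel_measurable_glued[OF r]])
  fix K
  obtain B1 where B1: "\<And>z. norm z \<le> K \<Longrightarrow> \<bar>r1 z\<bar> \<le> B1" using continuous_bounded_cball[OF r(1)] by metis
  obtain B2 where B2: "\<And>z. norm z \<le> K \<Longrightarrow> \<bar>r2 z\<bar> \<le> B2" using continuous_bounded_cball[OF r(2)] by metis
  have "\<bar>if fst z > 0 then r1 z else r2 z\<bar> \<le> max B1 B2" if "norm z \<le> K" for z
    using B1[OF that] B2[OF that] by auto
  then show "\<exists>B. \<forall>z. norm z \<le> K \<longrightarrow> \<bar>if fst z > 0 then r1 z else r2 z\<bar> \<le> B" by blast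
qed

text \<open>A function of the characteristic coordinate \<open>x - b t\<close>, possibly different on the two sides of
  \<open>x = 0\<close>, is annihilated by the transport operator away from \<open>x = 0\<close>: in the coordinates
  \<open>(x, x - b t)\<close> the operator differentiates in \<open>x\<close> alone.\<close>

lemma transport_integral_zero:
  fixes h1 h2 :: "real \<Rightarrow> real"
  assumes h: "continuous_on UNIV h1" "continuous_on UNIV h2" and b: "b \<noteq> 0"
    and \<phi>: "test_function {z. fst z \<noteq> 0} \<phi>"
  shows "(LINT z|lborel. (if fst z > 0 then h1 (fst z - b * snd z) else h2 (fst z - b * snd z)) * partial (b, 1) \<phi> z) = 0"
proof -
  define D where "D = partial (b, 1) \<phi>"
  have D: "test_function {z. fst z \<noteq> 0} D" unfolding D_def by (rule test_function_partial[OF \<phi>])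
  have D': "test_function UNIV D" by (rule test_function_mono[OF D])
  obtain K where K: "\<And>z. norm z \<ge> K \<Longrightarrow> \<phi> z = 0" "\<And>z e. norm z \<ge> K \<Longrightarrow> partial e \<phi> z = 0"
    using test_function_support[OF \<phi>] by metis
  have DK: "D z = 0" if "norm z \<ge> K" for z unfolding D_def by (rule K(2)[OF that])
  have D_cont: "continuous_on UNIV D" by (rule test_function_continuous[OF D'])
  have shear: "continuous_on UNIV (\<lambda>z::real \<times> real. h (fst z - b * snd z))" if "continuous_on UNIV h" for h :: "real \<Rightarrow> real"
    by (rule continuous_on_compose2[OF that]) (auto intro!: continuous_intros)
  define H where "H x \<xi> = (if x > 0 then h1 \<xi> else h2 \<xi>)" for x \<xi> :: real
  have int1: "integrable (lborel \<Otimes>\<^sub>M lborel) (\<lambda>z. H (fst z) (fst z - b * snd z) * D z)"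
    unfolding lborel_prod H_def
    by (rule L2_loc_test_integrable[OF L2_loc_glued[OF shear[OF h(1)] shear[OF h(2)]] D'])
  define k where "k x \<xi> = H x \<xi> * D (x, (x - \<xi>) / b)" for x \<xi>
  have int2: "integrable (lborel \<Otimes>\<^sub>M lborel) (\<lambda>z. k (fst z) (snd z))"
  proof -
    define D2 where "D2 z = D (fst z, (fst z - snd z) / b)" for z
    have D2_cont: "continuous_on UNIV D2"
      unfolding D2_def by (rule continuous_on_compose2[OF D_cont]) (use b in \<open>auto intro!: continuous_intros\<close>)
    have D2_supp: "D2 z = 0" if "norm z > K + (K + \<bar>b\<bar> * K)" for z
    proof (rule ccontr)
      assume "D2 z \<noteq> 0"
      then have n: "norm (fst z, (fst z - snd z) / b) < K" using DK unfolding D2_def by (meson not_less)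
      have 1: "\<bar>fst z\<bar> \<le> K" using abs_le_norm_Pair(1)[of "fst z" "(fst z - snd z) / b"] n by simp
      have "\<bar>(fst z - snd z) / b\<bar> \<le> K" using abs_le_norm_Pair(2)[of "(fst z - snd z) / b" "fst z"] n by simp
      then have "\<bar>fst z - snd z\<bar> \<le> \<bar>b\<bar> * K" using b by (simp add: pos_divide_le_eq mult.commute)
      then have "\<bar>snd z\<bar> \<le> K + \<bar>b\<bar> * K" using 1 by linarith
      then have "norm (fst z, snd z) \<le> K + (K + \<bar>b\<bar> * K)"
        using norm_Pair_le[of "fst z" "snd z"] 1 by simp
      then show False using that by simp
    qed
    have "continuous_on UNIV (\<lambda>z::real \<times> real. h1 (snd z))" "continuous_on UNIV (\<lambda>z::real \<times> real. h2 (snd z))"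
      by (auto intro!: continuous_on_compose2[OF h(1)] continuous_on_compose2[OF h(2)] continuous_intros)
    from L2_loc_glued[OF this] have L: "L2_loc (\<lambda>z. H (fst z) (snd z))" by (simp add: H_def)
    obtain B where B: "\<And>z. norm z \<le> K + (K + \<bar>b\<bar> * K) \<Longrightarrow> \<bar>D2 z\<bar> \<le> B"
      using continuous_bounded_cball[OF D2_cont] by metis
    have "\<bar>D2 z\<bar> \<le> max B 0" for z
      using B[of z] D2_supp[of z] by (cases "norm z \<le> K + (K + \<bar>b\<bar> * K)") auto
    from L2_loc_mult_integrable[OF L borel_measurable_continuous_onI[OF D2_cont] this D2_supp]
    show ?thesis unfolding lborel_prod k_def D2_def .
  qed
  have "(LINT z|lborel. H (fst z) (fst z - b * snd z) * D z)
      = (LINT x|lborel. LINT t|lborel. H x (x - b * t) * D (x, t))"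
    using lborel_pair.integral_fst'[OF int1] by (simp add: lborel_prod)
  also have "\<dots> = (LINT x|lborel. \<bar>1 / b\<bar> * (LINT \<xi>|lborel. k x \<xi>))"
  proof (rule Bochner_Integration.integral_cong[OF refl])
    fix x :: real
    \<comment> \<open>The substitution \<open>\<xi> = x - b t\<close> on the line through a fixed \<open>x\<close>.\<close>
    have "(LINT t|lborel. H x (x - b * t) * D (x, t))
        = \<bar>- 1 / b\<bar> *\<^sub>R (LINT \<xi>|lborel. H x (x - b * (x / b + - 1 / b * \<xi>)) * D (x, x / b + - 1 / b * \<xi>))"
      by (rule lborel_integral_real_affine) (use b in simp)
    also have "(\<lambda>\<xi>. H x (x - b * (x / b + - 1 / b * \<xi>)) * D (x, x / b + - 1 / b * \<xi>)) = k x"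
    proof (rule ext)
      fix \<xi>
      have "x / b + - 1 / b * \<xi> = (x - \<xi>) / b" by (simp add: diff_divide_distrib)
      moreover have "x - b * ((x - \<xi>) / b) = \<xi>" using b by simp
      ultimately show "H x (x - b * (x / b + - 1 / b * \<xi>)) * D (x, x / b + - 1 / b * \<xi>) = k x \<xi>"
        by (simp only: k_def)
    qed
    finally show "(LINT t|lborel. H x (x - b * t) * D (x, t)) = \<bar>1 / b\<bar> * (LINT \<xi>|lborel. k x \<xi>)" by simp
  qed
  also have "\<dots> = \<bar>1 / b\<bar> * (LINT \<xi>|lborel. LINT x|lborel. k x \<xi>)"
    using lborel_pair.Fubini_integral[of k] int2 by (simp add: split_beta')
  finally have fubini: "(LINT z|lborel. H (fst z) (fst z - b * snd z) * D z)
      = \<bar>1 / b\<bar> * (LINT \<xi>|lborel. LINT x|lborel. k x \<xi>)" .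
  have "(LINT x|lborel. k x \<xi>) = 0" for \<xi>
  proof -
    define g where "g x = \<phi> (x, (x - \<xi>) / b)" for x
    define g' where "g' x = D (x, (x - \<xi>) / b) / b" for x
    have g: "(g has_real_derivative g' x) (at x)" for x
    proof -
      have "((\<lambda>r. \<phi> ((0, - \<xi> / b) + r *\<^sub>R (1, 1 / b))) has_real_derivative
          partial (1, 1 / b) \<phi> ((0, - \<xi> / b) + x *\<^sub>R (1, 1 / b))) (at x)"
        by (rule test_function_line_derivative[OF \<phi>])
      moreover have "(0, - \<xi> / b) + r *\<^sub>R (1, 1 / b) = (r, (r - \<xi>) / b)" for r
        by (simp add: diff_divide_distrib)
      moreover have "partial (1, 1 / b) \<phi> z = D z / b" for z
        using b unfolding D_def partial_pair[OF \<phi>, of b 1] partial_pair[OF \<phi>, of 1 "1 / b"]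
        by (simp add: add_divide_distrib)
      ultimately show ?thesis unfolding g_def g'_def by simp
    qed
    have g'_cont: "continuous_on UNIV g'"
      unfolding g'_def
      by (intro continuous_on_divide continuous_on_compose2[OF D_cont]) (use b in \<open>auto intro!: continuous_intros\<close>)
    have supp: "g x = 0 \<and> g' x = 0" if "\<bar>x\<bar> \<ge> K" for x
    proof -
      have "norm (x, (x - \<xi>) / b) \<ge> K" using that abs_le_norm_Pair(1)[of x "(x - \<xi>) / b"] by linarith
      then show ?thesis using K(1) DK by (simp add: g_def g'_def)
    qed
    have "g 0 = 0"
    proof (rule ccontr)
      assume "g 0 \<noteq> 0"
      then have "(0, (0 - \<xi>) / b) \<in> {z. \<phi> z \<noteq> 0}" by (simp add: g_def)
      then have "(0, (0 - \<xi>) / b) \<in> {z::real \<times> real. fst z \<noteq> 0}"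
        using \<phi> closure_subset[of "{z. \<phi> z \<noteq> 0}"] unfolding test_function_def by (meson subsetD)
      then show False by simp
    qed
    moreover have "(LINT x|lborel. (if x > 0 then h1 \<xi> else h2 \<xi>) * g' x)
        = (h2 \<xi> - h1 \<xi>) * g 0 - (LINT x|lborel. (if x > 0 then 0 else 0) * g x)"
      by (rule integration_by_parts_glued[OF _ _ _ _ g g'_cont supp]) auto
    ultimately have "(LINT x|lborel. H x \<xi> * g' x) = 0" by (simp add: H_def)
    moreover have "k x \<xi> = b * (H x \<xi> * g' x)" for x using b by (simp add: k_def g'_def)
    ultimately show ?thesis by simp
  qed
  then show ?thesis using fubini by (simp add: H_def D_def)
qed


definition glued_wave ::
    "real \<Rightarrow> (real \<Rightarrow> real \<Rightarrow> real) \<Rightarrow> (real \<Rightarrow> real \<Rightarrow> real) \<Rightarrow> real \<times> real \<Rightarrow> real" where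
  "glued_wave a A B z = (if fst z > 0 then A 1 (fst z - a * snd z) + B 1 (fst z + a * snd z)
     else A (- 1) (fst z - a * snd z) + B (- 1) (fst z + a * snd z))"

text \<open>Two pairs of counter-propagating \<open>C\<^sup>1\<close> waves that agree on \<open>x = 0\<close>. The second-order wave
  equation is tested by moving one derivative to \<open>u\<close>; what is left is a transport equation for each of
  the two families of waves.\<close>

lemma glued_wave_is_solution:
  fixes A B A' B' :: "real \<Rightarrow> real \<Rightarrow> real"
  assumes a: "a > 0" and \<kappa>: "\<kappa> = \<mu> * a\<^sup>2"
    and A: "\<And>s z. (A s has_real_derivative A' s z) (at z)" "\<And>s. continuous_on UNIV (A' s)"
    and B: "\<And>s z. (B s has_real_derivative B' s z) (at z)" "\<And>s. continuous_on UNIV (B' s)"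
    and match: "\<And>t. A 1 (- a * t) + B 1 (a * t) = A (- 1) (- a * t) + B (- 1) (a * t)"
  shows "glued_wave a A B \<in> E_class" "wave_equation_off_0 \<mu> \<kappa> (glued_wave a A B)"
    "dAlembert a (glued_wave a A B) A B A' B'"
proof -
  define u where "u = glued_wave a A B"
  define ut where "ut z = (if fst z > 0 then a * B' 1 (fst z + a * snd z) - a * A' 1 (fst z - a * snd z)
     else a * B' (- 1) (fst z + a * snd z) - a * A' (- 1) (fst z - a * snd z))" for z
  define ux where "ux z = (if fst z > 0 then A' 1 (fst z - a * snd z) + B' 1 (fst z + a * snd z)
     else A' (- 1) (fst z - a * snd z) + B' (- 1) (fst z + a * snd z))" for z
  have Ac: "continuous_on UNIV (A s)" and Bc: "continuous_on UNIV (B s)" for s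
    by (rule DERIV_continuous_on[OF has_field_derivative_at_within[OF A(1)]],
        rule DERIV_continuous_on[OF has_field_derivative_at_within[OF B(1)]])
  have minus: "continuous_on UNIV (\<lambda>z::real \<times> real. h (fst z - a * snd z))"
    and plus: "continuous_on UNIV (\<lambda>z::real \<times> real. h (fst z + a * snd z))"
    if "continuous_on UNIV h" for h :: "real \<Rightarrow> real"
    by (rule continuous_on_compose2[OF that], auto intro!: continuous_intros)+
  have u_L2: "L2_loc u" unfolding u_def glued_wave_def
    by (intro L2_loc_glued continuous_on_add minus plus Ac Bc)
  have ut_L2: "L2_loc ut" unfolding ut_def
    by (intro L2_loc_glued continuous_on_diff continuous_on_mult continuous_on_const minus plus A(2) B(2))
  have ux_L2: "L2_loc ux" unfolding ux_def
    by (intro L2_loc_glued continuous_on_add minus plus A(2) B(2))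
  have u_cont: "continuous_on UNIV u"
  proof -
    have "continuous_on UNIV (\<lambda>z. if fst z \<le> 0 then A (- 1) (fst z - a * snd z) + B (- 1) (fst z + a * snd z)
        else A 1 (fst z - a * snd z) + B 1 (fst z + a * snd z))"
    proof (rule continuous_on_cases_le)
      show "continuous_on UNIV (fst :: real \<times> real \<Rightarrow> real)" by (intro continuous_intros)
      show "A (- 1) (fst z - a * snd z) + B (- 1) (fst z + a * snd z) = A 1 (fst z - a * snd z) + B 1 (fst z + a * snd z)"
        if "fst z = 0" for z using match[of "snd z"] that by simp
    qed (rule continuous_on_subset[OF _ subset_UNIV], intro continuous_on_add minus plus Ac Bc)+
    moreover have "(\<lambda>z. if fst z \<le> 0 then A (- 1) (fst z - a * snd z) + B (- 1) (fst z + a * snd z)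
        else A 1 (fst z - a * snd z) + B 1 (fst z + a * snd z)) = u"
      by (auto simp: u_def glued_wave_def fun_eq_iff)
    ultimately show ?thesis by (simp only:)
  qed
  have wx: "weak_partial (1, 0) u ux"
  proof (rule weak_partial_x_if_slices[OF u_L2 ux_L2])
    fix t K :: real and g g' :: "real \<Rightarrow> real"
    assume g: "\<And>x. (g has_real_derivative g' x) (at x)" "continuous_on UNIV g'"
      and supp: "\<And>x. \<bar>x\<bar> \<ge> K \<Longrightarrow> g x = 0 \<and> g' x = 0"
    have d: "((\<lambda>x. A s (x - a * t) + B s (x + a * t)) has_real_derivative A' s (x - a * t) + B' s (x + a * t)) (at x)" for s x
    proof -
      have "((\<lambda>x. A s (x - a * t) + B s (x + a * t)) has_real_derivative A' s (x - a * t) * 1 + B' s (x + a * t) * 1) (at x)"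
        by (intro DERIV_add DERIV_chain2[OF A(1)] DERIV_chain2[OF B(1)]) (auto intro!: derivative_eq_intros)
      then show ?thesis by simp
    qed
    have c: "continuous_on UNIV (\<lambda>x. A' s (x - a * t) + B' s (x + a * t))" for s
      by (intro continuous_on_add continuous_on_compose2[OF A(2)] continuous_on_compose2[OF B(2)])
        (auto intro!: continuous_intros)
    show "(LINT x|lborel. u (x, t) * g' x) = - (LINT x|lborel. ux (x, t) * g x)"
      unfolding u_def glued_wave_def ux_def fst_conv snd_conv
      using integration_by_parts_glued[where K = K, OF d[of 1] c d[of "-1"] c g supp] match[of t]
      by simp
  qed
  have wt: "weak_partial (0, 1) u ut"
  proof (rule weak_partial_t_if_slices[OF u_L2 ut_L2])
    fix x K :: real and g g' :: "real \<Rightarrow> real"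
    assume g: "\<And>t. (g has_real_derivative g' t) (at t)" "continuous_on UNIV g'"
      and supp: "\<And>t. \<bar>t\<bar> \<ge> K \<Longrightarrow> g t = 0 \<and> g' t = 0"
    have d: "((\<lambda>t. A s (x - a * t) + B s (x + a * t)) has_real_derivative a * B' s (x + a * t) - a * A' s (x - a * t)) (at t)" for s t
    proof -
      have "((\<lambda>t. A s (x - a * t) + B s (x + a * t)) has_real_derivative A' s (x - a * t) * (- a) + B' s (x + a * t) * a) (at t)"
        by (intro DERIV_add DERIV_chain2[OF A(1)] DERIV_chain2[OF B(1)]) (auto intro!: derivative_eq_intros)
      then show ?thesis by (simp add: mult.commute)
    qed
    have c: "continuous_on UNIV (\<lambda>t. a * B' s (x + a * t) - a * A' s (x - a * t))" for s
      by (intro continuous_on_diff continuous_on_mult continuous_on_const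
          continuous_on_compose2[OF A(2)] continuous_on_compose2[OF B(2)]) (auto intro!: continuous_intros)
    show "(LINT t|lborel. u (x, t) * g' t) = - (LINT t|lborel. ut (x, t) * g t)"
      using integration_by_parts_line[where K = K, OF d c g supp]
      by (cases "x > 0") (simp_all add: u_def glued_wave_def ut_def)
  qed
  show "glued_wave a A B \<in> E_class"
    unfolding E_class_def u_def[symmetric] using u_cont ut_L2 wt ux_L2 wx by blast
  show "dAlembert a (glued_wave a A B) A B A' B'"
    unfolding dAlembert_def
    using Ac Bc L2_loc_continuous[OF A(2)] L2_loc_continuous[OF B(2)] weak_partial_C1[OF A] weak_partial_C1[OF B]
    by (auto simp: glued_wave_def)
  show "wave_equation_off_0 \<mu> \<kappa> (glued_wave a A B)"
    unfolding wave_equation_off_0_def u_def[symmetric]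
  proof (intro allI impI)
    fix \<phi> :: "real \<times> real \<Rightarrow> real" assume \<phi>: "test_function {z. fst z \<noteq> 0} \<phi>"
    define \<phi>t where "\<phi>t = partial (0, 1) \<phi>"
    define \<phi>x where "\<phi>x = partial (1, 0) \<phi>"
    have tests: "test_function UNIV \<phi>t" "test_function UNIV \<phi>x"
      unfolding \<phi>t_def \<phi>x_def using test_function_mono[OF test_function_partial[OF \<phi>]] by auto
    note i1 = L2_loc_test_integrable[OF u_L2 test_function_partial[OF tests(1)], of "(0, 1)"]
      and i2 = L2_loc_test_integrable[OF u_L2 test_function_partial[OF tests(2)], of "(1, 0)"]
      and j1 = L2_loc_test_integrable[OF ut_L2 tests(1)]
      and j2 = L2_loc_test_integrable[OF ux_L2 tests(2)]
    have "(LINT z|lborel. u z * (\<mu> * partial (0, 1) \<phi>t z - \<kappa> * partial (1, 0) \<phi>x z))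
        = (LINT z|lborel. \<mu> * (u z * partial (0, 1) \<phi>t z) - \<kappa> * (u z * partial (1, 0) \<phi>x z))"
      by (rule Bochner_Integration.integral_cong) (simp_all add: algebra_simps)
    also have "\<dots> = \<mu> * (LINT z|lborel. u z * partial (0, 1) \<phi>t z) - \<kappa> * (LINT z|lborel. u z * partial (1, 0) \<phi>x z)"
      using i1 i2 by simp
    also have "\<dots> = \<mu> * (- (LINT z|lborel. ut z * \<phi>t z)) - \<kappa> * (- (LINT z|lborel. ux z * \<phi>x z))"
      using wt wx tests unfolding weak_partial_def by simp
    also have "\<dots> = (LINT z|lborel. - \<mu> * (ut z * \<phi>t z) + \<kappa> * (ux z * \<phi>x z))"
      using j1 j2 by simp
    also have "\<dots> = (LINT z|lborel. \<mu> * a * ((if fst z > 0 then A' 1 (fst z - a * snd z) else A' (-1) (fst z - a * snd z)) * partial (a, 1) \<phi> z)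
        - \<mu> * a * ((if fst z > 0 then B' 1 (fst z - (- a) * snd z) else B' (-1) (fst z - (- a) * snd z)) * partial (- a, 1) \<phi> z))"
    proof (rule Bochner_Integration.integral_cong[OF refl])
      fix z
      show "- \<mu> * (ut z * \<phi>t z) + \<kappa> * (ux z * \<phi>x z)
        = \<mu> * a * ((if fst z > 0 then A' 1 (fst z - a * snd z) else A' (-1) (fst z - a * snd z)) * partial (a, 1) \<phi> z)
        - \<mu> * a * ((if fst z > 0 then B' 1 (fst z - (- a) * snd z) else B' (-1) (fst z - (- a) * snd z)) * partial (- a, 1) \<phi> z)"
        unfolding partial_pair[OF \<phi>, of a 1] partial_pair[OF \<phi>, of "- a" 1] \<phi>t_def[symmetric] \<phi>x_def[symmetric]
        by (simp add: ut_def ux_def \<kappa> power2_eq_square algebra_simps)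
    qed
    also have "\<dots> = 0"
    proof -
      have t: "test_function UNIV (partial (b, 1) \<phi>)" for b
        by (rule test_function_mono[OF test_function_partial[OF \<phi>]])
      have "integrable lborel (\<lambda>z. (if fst z > 0 then A' 1 (fst z - a * snd z) else A' (-1) (fst z - a * snd z)) * partial (a, 1) \<phi> z)"
        by (intro L2_loc_test_integrable[OF L2_loc_glued t] minus A(2))
      moreover have "integrable lborel (\<lambda>z. (if fst z > 0 then B' 1 (fst z - (- a) * snd z) else B' (-1) (fst z - (- a) * snd z)) * partial (- a, 1) \<phi> z)"
        using plus[OF B(2)] by (intro L2_loc_test_integrable[OF L2_loc_glued t]) simp_all
      ultimately show ?thesis
        using transport_integral_zero[OF A(2) A(2) _ \<phi>, of a 1 "-1"] transport_integral_zero[OF B(2) B(2) _ \<phi>, of "- a" 1 "-1"] a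
        by (simp only: Bochner_Integration.integral_diff integrable_mult_right integral_mult_right_zero
            less_imp_neq[symmetric] neg_equal_0_iff_equal mult_zero_right diff_self) simp
    qed
    finally show "(LINT z|lborel. u z * (\<mu> * partial (0, 1) (partial (0, 1) \<phi>) z - \<kappa> * partial (1, 0) (partial (1, 0) \<phi>) z)) = 0"
      unfolding \<phi>t_def \<phi>x_def .
  qed
qed

section \<open>The point mass driven by a given solution of the string equation\<close>

text \<open>Any two values of one coordinate share an admissible value of the other, so neither function can
  vary.\<close>

lemma characteristic_sum_zero:
  fixes \<phi> \<gamma> :: "real \<Rightarrow> real"
  assumes s: "s \<in> {1, -1}" and sum: "\<And>\<alpha> \<beta>. s * (\<alpha> + \<beta>) > 0 \<Longrightarrow> \<phi> \<alpha> + \<gamma> \<beta> = 0"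
  obtains c where "\<And>z. \<phi> z = c" "\<And>z. \<gamma> z = - c"
proof -
  have *: "\<phi> \<alpha> = \<phi> 0 \<and> \<gamma> \<alpha> = - \<phi> 0" for \<alpha>
  proof -
    define \<beta> where "\<beta> = s * (\<bar>\<alpha>\<bar> + 1)"
    have "s * (\<alpha> + \<beta>) > 0" "s * (0 + \<beta>) > 0" "s * (\<beta> + \<alpha>) > 0" "s * (\<beta> + 0) > 0" "s * (\<beta> + \<beta>) > 0"
      using s by (auto simp: \<beta>_def)
    note sum[OF this(1)] sum[OF this(2)] sum[OF this(3)] sum[OF this(4)] sum[OF this(5)]
    then show ?thesis by linarith
  qed
  show ?thesis by (rule that[of "\<phi> 0"]) (use * in blast)+
qed

lemma dAlembertD:
  assumes "dAlembert a u f g df dg" "s \<in> {1, -1}"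
  shows "continuous_on UNIV (f s)" "continuous_on UNIV (g s)" "L2_loc (df s)" "weak_partial 1 (f s) (df s)"
    "L2_loc (dg s)" "weak_partial 1 (g s) (dg s)"
    "\<And>x t. s * x > 0 \<Longrightarrow> u (x, t) = f s (x - a * t) + g s (x + a * t)"
  using assms unfolding dAlembert_def by blast+

text \<open>\<open>\<alpha>\<close> and \<open>\<beta>\<close> are the characteristic coordinates \<open>x - a t\<close> and \<open>x + a t\<close>.\<close>

lemma dAlembert_characteristic:
  assumes dA: "dAlembert a u f g df dg" and s: "s \<in> {1, -1}" and a: "a > 0" and pos: "s * (\<alpha> + \<beta>) > 0"
  shows "u ((\<alpha> + \<beta>) / 2, (\<beta> - \<alpha>) / (2 * a)) = f s \<alpha> + g s \<beta>"
proof -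
  have "s * ((\<alpha> + \<beta>) / 2) > 0" using pos by simp
  from dAlembertD(7)[OF dA s this, of "(\<beta> - \<alpha>) / (2 * a)"] show ?thesis
    using a by (simp add: field_simps)
qed

lemma dAlembert_unique:
  assumes "dAlembert a u f g df dg" "dAlembert a u f2 g2 df2 dg2" and s: "s \<in> {1, -1}" and a: "a > 0"
  obtains c where "\<And>z. f2 s z = f s z + c" "\<And>z. g2 s z = g s z - c"
proof -
  have "(f2 s \<alpha> - f s \<alpha>) + (g2 s \<beta> - g s \<beta>) = 0" if "s * (\<alpha> + \<beta>) > 0" for \<alpha> \<beta>
    using dAlembert_characteristic[OF assms(1) s a that] dAlembert_characteristic[OF assms(2) s a that] by simp
  from characteristic_sum_zero[of s "\<lambda>z. f2 s z - f s z" "\<lambda>z. g2 s z - g s z", OF s this]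
  obtain c where c: "\<And>z. f2 s z - f s z = c" "\<And>z. g2 s z - g s z = - c" by blast
  have "f2 s z = f s z + c" "g2 s z = g s z - c" for z using c[of z] by linarith+
  then show ?thesis using that by blast
qed

text \<open>The representation holds off the mass; both sides are continuous up to \<open>x = 0\<close>.\<close>

lemma dAlembert_trace:
  assumes dA: "dAlembert a u f g df dg" and s: "s \<in> {1, -1}" and u: "continuous_on UNIV u"
  shows "u (0, t) = f s (- a * t) + g s (a * t)"
proof -
  define x where "x n = s / real (Suc n)" for n
  have x: "x \<longlonglongrightarrow> 0" unfolding x_def by (rule LIMSEQ_Suc[OF lim_const_over_n])
  have "s * x n > 0" for n using s by (auto simp: x_def)
  then have eq: "u (x n, t) = f s (x n - a * t) + g s (x n + a * t)" for n
    by (rule dAlembertD(7)[OF dA s])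
  have "isCont u (0, t)" using u by (simp add: continuous_on_eq_continuous_at)
  then have 1: "(\<lambda>n. u (x n, t)) \<longlonglongrightarrow> u (0, t)"
    by (rule isCont_tendsto_compose) (intro tendsto_Pair x tendsto_const)
  have "isCont (f s) (0 - a * t)" "isCont (g s) (0 + a * t)"
    using dAlembertD(1,2)[OF dA s] by (simp_all add: continuous_on_eq_continuous_at)
  then have "(\<lambda>n. f s (x n - a * t) + g s (x n + a * t)) \<longlonglongrightarrow> f s (0 - a * t) + g s (0 + a * t)"
    by (intro tendsto_add isCont_tendsto_compose[of _ "f s"] isCont_tendsto_compose[of _ "g s"]
        tendsto_diff x tendsto_const)
  then have "u (0, t) = f s (0 - a * t) + g s (0 + a * t)"
    using LIMSEQ_unique[OF 1] unfolding eq by blast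
  then show ?thesis by simp
qed

text \<open>The rate \<open>s = 1\<close> is that of the wave arriving at the mass from the right, \<open>s = - 1\<close> from the
  left; each is read off from the initial data on its half-line and continued periodically.\<close>

definition incoming_rate :: "real \<Rightarrow> real \<Rightarrow> (real \<Rightarrow> real) \<Rightarrow> (real \<Rightarrow> real) \<Rightarrow> real \<Rightarrow> real \<Rightarrow> real" where
  "incoming_rate a \<omega> u0 u1 s = periodic_ext \<omega> (\<lambda>z. (s * deriv u0 (s * z) + u1 (s * z) / a) / 2)"

definition incoming :: "real \<Rightarrow> real \<Rightarrow> (real \<Rightarrow> real) \<Rightarrow> (real \<Rightarrow> real) \<Rightarrow> real \<Rightarrow> real \<Rightarrow> real" where
  "incoming a \<omega> u0 u1 s = primitive (incoming_rate a \<omega> u0 u1 s)"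

context
  fixes a \<omega> :: real and u0 u1 :: "real \<Rightarrow> real"
  assumes a: "a > 0" and \<omega>: "\<omega> > 0" and H: "(u0, u1) \<in> H_class \<omega>"
begin

lemma initial_data:
  shows "u0 C1_differentiable_on UNIV" "continuous_on UNIV u1"
    "deriv u0 \<in> P_class \<omega>" "u1 \<in> P_class \<omega>"
  using H by (auto simp: H_class_def)

lemma rate_periodic:
  assumes s: "s \<in> {1, -1}" and z: "z > 0"
  shows "(s * deriv u0 (s * (z + \<omega>)) + u1 (s * (z + \<omega>)) / a) / 2 = (s * deriv u0 (s * z) + u1 (s * z) / a) / 2"
proof -
  have "deriv u0 (s * (z + \<omega>)) = deriv u0 (s * z) \<and> u1 (s * (z + \<omega>)) = u1 (s * z)"
  proof (cases "s = 1")
    case True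
    then show ?thesis using initial_data(3,4) z by (simp add: P_class_def)
  next
    case False
    then have "s = -1" using s by simp
    moreover have "deriv u0 (- z - \<omega>) = deriv u0 (- z)" "u1 (- z - \<omega>) = u1 (- z)"
      using initial_data(3,4) z unfolding P_class_def by auto
    ultimately show ?thesis by simp
  qed
  then show ?thesis by simp
qed

lemma incoming_rate_continuous:
  assumes s: "s \<in> {1, -1}"
  shows "continuous_on UNIV (incoming_rate a \<omega> u0 u1 s)"
  unfolding incoming_rate_def
proof (rule continuous_on_periodic_ext[of \<omega> "\<lambda>z. (s * deriv u0 (s * z) + u1 (s * z) / a) / 2", OF \<omega> rate_periodic[OF s]])
  have "continuous_on UNIV (\<lambda>z. deriv u0 (s * z))" "continuous_on UNIV (\<lambda>z. u1 (s * z))"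
    by (rule continuous_on_compose2[OF C1_on_UNIV_D(2)[OF initial_data(1), of UNIV]],
        auto intro!: continuous_intros)
      (rule continuous_on_compose2[OF initial_data(2)], auto intro!: continuous_intros)
  then have "continuous_on UNIV (\<lambda>z. (s * deriv u0 (s * z) + u1 (s * z) / a) / 2)"
    using a by (intro continuous_on_divide continuous_on_add continuous_on_mult continuous_on_const) auto
  then show "isCont (\<lambda>z. (s * deriv u0 (s * z) + u1 (s * z) / a) / 2) z" for z
    by (simp add: continuous_on_eq_continuous_at)
qed

lemma incoming_derivative:
  assumes s: "s \<in> {1, -1}"
  shows "(incoming a \<omega> u0 u1 s has_real_derivative incoming_rate a \<omega> u0 u1 s z) (at z)"
  unfolding incoming_def by (rule primitive_has_real_derivative[OF incoming_rate_continuous[OF s]])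

text \<open>The rate is periodic, so the wave itself is periodic up to a constant increment, which cancels in
  the differences that enter the solution.\<close>

lemma incoming_shift_const:
  assumes s: "s \<in> {1, -1}"
  shows "incoming a \<omega> u0 u1 s (x + \<omega>) - incoming a \<omega> u0 u1 s x
    = incoming a \<omega> u0 u1 s (y + \<omega>) - incoming a \<omega> u0 u1 s y"
proof (rule DERIV_isconst_all[of "\<lambda>z. incoming a \<omega> u0 u1 s (z + \<omega>) - incoming a \<omega> u0 u1 s z"], rule allI)
  fix z
  have "((\<lambda>z. incoming a \<omega> u0 u1 s (z + \<omega>) - incoming a \<omega> u0 u1 s z) has_real_derivative
      incoming_rate a \<omega> u0 u1 s (z + \<omega>) - incoming_rate a \<omega> u0 u1 s z) (at z)"
    using incoming_derivative[OF s, of "z + \<omega>"] incoming_derivative[OF s, of z]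
    by (intro DERIV_diff) (simp_all add: DERIV_shift)
  then show "((\<lambda>z. incoming a \<omega> u0 u1 s (z + \<omega>) - incoming a \<omega> u0 u1 s z) has_real_derivative 0) (at z)"
    using periodic_ext_shift[OF \<omega>] by (simp add: incoming_rate_def)
qed

lemma incoming_explicit:
  assumes s: "s \<in> {1, -1}" and pos: "\<alpha> > 0" "\<beta> > 0"
  shows "incoming a \<omega> u0 u1 s \<beta> - incoming a \<omega> u0 u1 s \<alpha>
    = (u0 (s * \<beta>) - u0 (s * \<alpha>)) / 2 + s * (primitive u1 (s * \<beta>) - primitive u1 (s * \<alpha>)) / (2 * a)"
proof -
  define h where "h z = incoming a \<omega> u0 u1 s z - (u0 (s * z) / 2 + s * primitive u1 (s * z) / (2 * a))" for z
  have "\<exists>c. \<forall>z\<in>{0<..}. h z = c"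
  proof (rule has_field_derivative_zero_constant)
    fix z :: real assume z: "z \<in> {0<..}"
    have m: "((\<lambda>z. s * z) has_real_derivative s) (at z)" by (auto intro!: derivative_eq_intros)
    have "(h has_real_derivative incoming_rate a \<omega> u0 u1 s z
        - (deriv u0 (s * z) * s / 2 + s * (u1 (s * z) * s) / (2 * a))) (at z)"
      unfolding h_def
      by (intro DERIV_diff incoming_derivative[OF s] DERIV_add DERIV_cdivide DERIV_cmult
          DERIV_chain2[OF C1_on_UNIV_D(1)[OF initial_data(1)] m]
          DERIV_chain2[OF primitive_has_real_derivative[OF initial_data(2)] m])
    moreover have "incoming_rate a \<omega> u0 u1 s z = (s * deriv u0 (s * z) + u1 (s * z) / a) / 2"
      unfolding incoming_rate_def using periodic_ext_pos[of \<omega> "\<lambda>z. (s * deriv u0 (s * z) + u1 (s * z) / a) / 2" z, OF \<omega> rate_periodic[OF s]] z by simp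
    moreover have "(s * d + v / a) / 2 - (d * s / 2 + s * (v * s) / (2 * a)) = 0" for d v
      using s by (auto simp: add_divide_distrib)
    ultimately have "(h has_real_derivative 0) (at z)" by (simp only:)
    then show "(h has_real_derivative 0) (at z within {0<..})" by (rule has_field_derivative_at_within)
  qed simp
  then have "h \<alpha> = h \<beta>" using pos by auto
  then show ?thesis by (simp add: h_def diff_divide_distrib right_diff_distrib)
qed

text \<open>The two incoming waves together exert the force of the incident wave.\<close>

lemma incoming_rate_sum:
  assumes "p = incident_wave a u0 u1"
  shows "incoming_rate a \<omega> u0 u1 1 z + incoming_rate a \<omega> u0 u1 (- 1) z = periodic_ext \<omega> (deriv p) z"
  unfolding incoming_rate_def periodic_ext_def incident_force_properties(1)[OF a H assms]
  using a by (simp add: field_simps)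

text \<open>Integrating the prescribed velocity over an interval and eliminating the outgoing wave by the
  prescribed displacement.\<close>

lemma initial_conditions_incoming:
  assumes dA: "dAlembert a u f g df dg"
    and init: "\<And>s. s \<in> {1, -1} \<Longrightarrow> (\<forall>x. s * x > 0 \<longrightarrow> f s x + g s x = u0 x)
             \<and> (AE x in lborel. s * x > 0 \<longrightarrow> - a * df s x + a * dg s x = u1 x)"
    and pos: "0 < \<alpha>" "\<alpha> \<le> \<beta>"
  shows "g 1 \<beta> - g 1 \<alpha> = incoming a \<omega> u0 u1 1 \<beta> - incoming a \<omega> u0 u1 1 \<alpha>"
    "f (- 1) (- \<beta>) - f (- 1) (- \<alpha>) = incoming a \<omega> u0 u1 (- 1) \<beta> - incoming a \<omega> u0 u1 (- 1) \<alpha>"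
proof -
  have int: "- a * (f s y - f s x) + a * (g s y - g s x) = primitive u1 y - primitive u1 x"
    if s: "s \<in> {1, -1}" and xy: "x \<le> y" "\<And>z. x \<le> z \<Longrightarrow> z \<le> y \<Longrightarrow> s * z > 0" for s x y
  proof -
    note D = dAlembertD[OF dA s]
    have I1: "set_integrable lborel {x..y} (\<lambda>z. - a * df s z)" and I2: "set_integrable lborel {x..y} (\<lambda>z. a * dg s z)"
      using L2_loc_set_integrable[OF D(3)] L2_loc_set_integrable[OF D(5)] by (simp_all only: set_integrable_mult_right)
    have "- a * (f s y - f s x) + a * (g s y - g s x)
        = (LBINT z:{x..y}. - a * df s z) + (LBINT z:{x..y}. a * dg s z)"
      using weak_derivative_FTC[OF D(1,3,4) xy(1)] weak_derivative_FTC[OF D(2,5,6) xy(1)]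
      by (simp only: set_integral_mult_right)
    also have "\<dots> = (LBINT z:{x..y}. - a * df s z + a * dg s z)"
      using set_integral_add(2)[OF I1 I2] by simp
    also have "\<dots> = (LBINT z:{x..y}. u1 z)"
      unfolding set_lebesgue_integral_def
    proof (rule integral_cong_AE)
      show "(\<lambda>z. indicator {x..y} z *\<^sub>R (- a * df s z + a * dg s z)) \<in> borel_measurable lborel"
        using set_integral_add(1)[OF I1 I2] unfolding set_integrable_def by (rule borel_measurable_integrable)
      show "(\<lambda>z. indicator {x..y} z *\<^sub>R u1 z) \<in> borel_measurable lborel"
        using borel_measurable_continuous_onI[OF initial_data(2)] by simp
      have "AE z in lborel. s * z > 0 \<longrightarrow> - a * df s z + a * dg s z = u1 z" using init[OF s] by blast
      then show "AE z in lborel. indicator {x..y} z *\<^sub>R (- a * df s z + a * dg s z) = indicator {x..y} z *\<^sub>R u1 z"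
        by eventually_elim (use xy(2) in \<open>auto simp: indicator_def\<close>)
    qed
    also have "\<dots> = primitive u1 y - primitive u1 x"
      unfolding set_lebesgue_integral_def
      by (rule integral_FTC_atLeastAtMost[OF xy(1) has_vector_derivative_at_within[OF primitive_has_vector_derivative[OF initial_data(2)]]])
        (rule continuous_on_subset[OF initial_data(2)], simp)
    finally show ?thesis .
  qed
  have solve: "x = p / 2 + q / (2 * a)" if "2 * a * x = a * p + q" for x p q
    using that a by (simp add: field_simps)
  have f1: "f 1 \<alpha> = u0 \<alpha> - g 1 \<alpha>" "f 1 \<beta> = u0 \<beta> - g 1 \<beta>"
    using init[of 1] pos by (auto simp: eq_diff_eq)
  have g1: "g (-1) (-\<alpha>) = u0 (-\<alpha>) - f (-1) (-\<alpha>)" "g (-1) (-\<beta>) = u0 (-\<beta>) - f (-1) (-\<beta>)"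
    using init[of "-1"] pos by (auto simp: eq_diff_eq add.commute)
  have "2 * a * (g 1 \<beta> - g 1 \<alpha>) = a * (u0 \<beta> - u0 \<alpha>) + (primitive u1 \<beta> - primitive u1 \<alpha>)"
    using int[of 1 \<alpha> \<beta>] pos unfolding f1 by (simp add: algebra_simps)
  then show "g 1 \<beta> - g 1 \<alpha> = incoming a \<omega> u0 u1 1 \<beta> - incoming a \<omega> u0 u1 1 \<alpha>"
    using incoming_explicit[of 1 \<alpha> \<beta>] pos solve by simp
  have "- a * (f (-1) (-\<alpha>) - f (-1) (-\<beta>)) + a * (g (-1) (-\<alpha>) - g (-1) (-\<beta>)) = primitive u1 (-\<alpha>) - primitive u1 (-\<beta>)"
    using int[of "-1" "-\<beta>" "-\<alpha>"] pos by simp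
  then have "2 * a * (f (-1) (-\<beta>) - f (-1) (-\<alpha>)) = a * (u0 (-\<beta>) - u0 (-\<alpha>)) + (primitive u1 (-\<alpha>) - primitive u1 (-\<beta>))"
    unfolding g1 by (simp add: algebra_simps)
  then show "f (- 1) (- \<beta>) - f (- 1) (- \<alpha>) = incoming a \<omega> u0 u1 (- 1) \<beta> - incoming a \<omega> u0 u1 (- 1) \<alpha>"
    using incoming_explicit[of "-1" \<alpha> \<beta>] pos solve by simp
qed

end

lemma weak_dilation_integrable:
  fixes w :: "real \<Rightarrow> real"
  assumes w: "L2_loc w" and c: "c \<noteq> 0" and \<phi>: "test_function UNIV \<phi>"
  shows "integrable lborel (\<lambda>t. w (c * t) * \<phi> t)"
proof -
  obtain K where K: "\<And>z. norm z \<ge> K \<Longrightarrow> \<phi> z = 0" using test_function_support[OF \<phi>] by metis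
  obtain B where B: "\<And>z. \<bar>\<phi> z\<bar> \<le> B" using test_function_bounded[OF \<phi>] by metis
  have cont: "continuous_on UNIV (\<lambda>x. \<phi> (x / c))"
    by (rule continuous_on_compose2[OF test_function_continuous[OF \<phi>, of UNIV]])
      (use c in \<open>auto intro!: continuous_intros\<close>)
  have "integrable lborel (\<lambda>x. w x * \<phi> (x / c))"
  proof (rule L2_loc_mult_integrable[OF w borel_measurable_continuous_onI[OF cont] B])
    fix x :: real assume "norm x > \<bar>c\<bar> * \<bar>K\<bar>"
    then have "\<bar>K\<bar> \<le> \<bar>x\<bar> / \<bar>c\<bar>" using c by (simp add: pos_le_divide_eq mult.commute)
    then show "\<phi> (x / c) = 0" by (intro K) simp
  qed
  from lborel_integrable_real_affine[OF this c, of 0] show ?thesis using c by simp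
qed

text \<open>Moving all derivatives to the test function turns the equation of the mass into the statement
  that a continuous function has vanishing second derivative on \<open>t > 0\<close>. This function is therefore
  affine, which exhibits the displacement of the mass as twice differentiable.\<close>

lemma string_trace_solves_reduced_equation:
  fixes F J1 J2 I1 I2 :: "real \<Rightarrow> real"
  assumes pos: "m > 0" "a > 0" and F: "continuous_on UNIV F" and u: "continuous_on UNIV u"
    and dA: "dAlembert a u f g df dg"
    and eq: "\<And>\<phi>. test_function UNIV \<phi> \<Longrightarrow> m * (LINT t|lborel. u (0, t) * partial 1 (partial 1 \<phi>) t)
        = (LINT t|lborel. (F (u (0, t)) + \<kappa> * (trace_deriv a df dg 1 t - trace_deriv a df dg (- 1) t)) * \<phi> t)"
    and g1: "\<And>z. z > 0 \<Longrightarrow> g 1 z = I1 z + C1" and f1: "\<And>z. z > 0 \<Longrightarrow> f (- 1) (- z) = I2 z + C2"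
    and I1: "\<And>z. (I1 has_real_derivative J1 z) (at z)" and I2: "\<And>z. (I2 has_real_derivative J2 z) (at z)"
    and J: "\<And>z. z > 0 \<Longrightarrow> J1 z + J2 z = deriv p z"
  obtains Y V where "\<And>t. (Y has_real_derivative V t) (at t)" "continuous_on UNIV V"
    "\<And>t. t > 0 \<Longrightarrow> u (0, t) = Y t"
    "forced_system (1 / m) (2 * \<kappa> / (a * m)) F (\<lambda>t. 2 * \<kappa> / (a * m) * a * deriv p (a * t)) Y V"
proof -
  define y where "y t = u (0, t)" for t
  have y: "continuous_on UNIV y"
    unfolding y_def by (rule continuous_on_compose2[OF u]) (auto intro!: continuous_intros)
  have Fy: "continuous_on UNIV (\<lambda>t. F (y t))" by (rule continuous_on_compose2[OF F y]) simp
  define q where "q t = I1 (a * t) + I2 (a * t) + (C1 + C2)" for t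
  have q: "(q has_real_derivative a * (J1 (a * t) + J2 (a * t))) (at t)" for t
  proof -
    have "(q has_real_derivative J1 (a * t) * a + J2 (a * t) * a + 0) (at t)"
      unfolding q_def
      by (intro DERIV_add DERIV_const DERIV_chain2[OF I1] DERIV_chain2[OF I2]) (auto intro!: derivative_eq_intros)
    then show ?thesis by (simp add: algebra_simps)
  qed
  have qc: "continuous_on UNIV q" by (rule DERIV_continuous_on[OF has_field_derivative_at_within[OF q]])
  define A1 where "A1 = primitive (\<lambda>t. F (y t))"
  have A1: "(A1 has_real_derivative F (y t)) (at t)" for t
    unfolding A1_def by (rule primitive_has_real_derivative[OF Fy])
  have A1c: "continuous_on UNIV A1" unfolding A1_def by (rule continuous_on_primitive[OF Fy])
  define A2 where "A2 = primitive A1"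
  have A2: "(A2 has_real_derivative A1 t) (at t)" for t
    unfolding A2_def by (rule primitive_has_real_derivative[OF A1c])
  define Yi where "Yi = primitive y"
  have Yi: "(Yi has_real_derivative y t) (at t)" for t
    unfolding Yi_def by (rule primitive_has_real_derivative[OF y])
  define Qi where "Qi = primitive q"
  have Qi: "(Qi has_real_derivative q t) (at t)" for t
    unfolding Qi_def by (rule primitive_has_real_derivative[OF qc])
  have dc: "continuous_on UNIV h" if "\<And>t. (h has_real_derivative h' t) (at t)" for h h' :: "real \<Rightarrow> real"
    by (rule DERIV_continuous_on[OF has_field_derivative_at_within[OF that]])
  define b where "b = 2 * \<kappa> / a"
  define W where "W t = m * y t + b * Yi t - b * Qi t - A2 t" for t
  have W: "continuous_on UNIV W"
    unfolding W_def using y dc[OF Yi] dc[OF Qi] dc[OF A2] by (intro continuous_intros)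
  have "(LINT t|lborel. W t * partial 1 (partial 1 \<phi>) t) = 0"
    if \<phi>: "test_function UNIV \<phi>" and left: "\<And>t. t \<le> 0 \<Longrightarrow> \<phi> t = 0" for \<phi>
  proof -
    define \<phi>1 where "\<phi>1 = partial 1 \<phi>"
    define \<phi>2 where "\<phi>2 = partial 1 \<phi>1"
    have T1: "test_function UNIV \<phi>1" unfolding \<phi>1_def by (rule test_function_partial[OF \<phi>])
    have T2: "test_function UNIV \<phi>2" unfolding \<phi>2_def by (rule test_function_partial[OF T1])
    have left1: "\<phi>1 t = 0" if "t < 0" for t
    proof -
      have "(\<phi> has_real_derivative 0) (at t)"
        by (rule has_field_derivative_transform_within_open[of "\<lambda>_. 0" _ _ "{..<0}"]) (use that left in auto)
      from partial_eq_deriv[OF this, of 1] show ?thesis by (simp add: \<phi>1_def)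
    qed
    have int: "integrable lborel (\<lambda>t. h t * \<psi> t)" if "continuous_on UNIV h" "test_function UNIV \<psi>" for h \<psi> :: "real \<Rightarrow> real"
      by (rule L2_loc_test_integrable[OF L2_loc_continuous[OF that(1)] that(2)])
    have C1: "(LINT t|lborel. h t * partial 1 \<psi> t) = - (LINT t|lborel. h' t * \<psi> t)"
      if "\<And>t. (h has_real_derivative h' t) (at t)" "continuous_on UNIV h'" "test_function UNIV \<psi>" for h h' \<psi> :: "real \<Rightarrow> real"
      using weak_partial_C1[OF that(1,2)] that(3) unfolding weak_partial_def by blast
    note D = dAlembertD[OF dA, of 1, simplified] and D' = dAlembertD[OF dA, of "-1", simplified]
    have na: "- a \<noteq> 0" "a \<noteq> 0" using pos by auto
    note i = weak_dilation_integrable[OF D(3) na(1) \<phi>] weak_dilation_integrable[OF D(5) na(2) \<phi>]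
      weak_dilation_integrable[OF D'(3) na(1) \<phi>] weak_dilation_integrable[OF D'(5) na(2) \<phi>]
    have comp: "continuous_on UNIV (\<lambda>t. h (c * t))" if "continuous_on UNIV h" for h and c :: real
      by (rule continuous_on_compose2[OF that]) (auto intro!: continuous_intros)
    note j = int[OF comp[OF D(1)] T1, of "- a"] int[OF comp[OF D(2)] T1, of a]
      int[OF comp[OF D'(1)] T1, of "- a"] int[OF comp[OF D'(2)] T1, of a]
    have jump: "(LINT t|lborel. (trace_deriv a df dg 1 t - trace_deriv a df dg (- 1) t) * \<phi> t)
        = (LINT t|lborel. (f 1 (- a * t) - g 1 (a * t) - f (- 1) (- a * t) + g (- 1) (a * t)) * \<phi>1 t) / a"
    proof -
      have "(LINT t|lborel. (trace_deriv a df dg 1 t - trace_deriv a df dg (- 1) t) * \<phi> t)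
          = (LINT t|lborel. (df 1 (- a * t) * \<phi> t + dg 1 (a * t) * \<phi> t) - (df (- 1) (- a * t) * \<phi> t + dg (- 1) (a * t) * \<phi> t))"
        by (rule Bochner_Integration.integral_cong) (simp_all add: trace_deriv_def algebra_simps)
      also have "\<dots> = ((LINT t|lborel. df 1 (- a * t) * \<phi> t) + (LINT t|lborel. dg 1 (a * t) * \<phi> t))
          - ((LINT t|lborel. df (- 1) (- a * t) * \<phi> t) + (LINT t|lborel. dg (- 1) (a * t) * \<phi> t))"
        using i by simp
      also have "\<dots> = ((LINT t|lborel. f 1 (- a * t) * \<phi>1 t) - (LINT t|lborel. g 1 (a * t) * \<phi>1 t)
          - (LINT t|lborel. f (- 1) (- a * t) * \<phi>1 t) + (LINT t|lborel. g (- 1) (a * t) * \<phi>1 t)) / a"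
        unfolding weak_derivative_dilation[OF D(4) na(1) \<phi>] weak_derivative_dilation[OF D(6) na(2) \<phi>]
          weak_derivative_dilation[OF D'(4) na(1) \<phi>] weak_derivative_dilation[OF D'(6) na(2) \<phi>] \<phi>1_def[symmetric]
        using na by (simp add: add_divide_distrib diff_divide_distrib)
      also have "(LINT t|lborel. f 1 (- a * t) * \<phi>1 t) - (LINT t|lborel. g 1 (a * t) * \<phi>1 t)
          - (LINT t|lborel. f (- 1) (- a * t) * \<phi>1 t) + (LINT t|lborel. g (- 1) (a * t) * \<phi>1 t)
          = (LINT t|lborel. f 1 (- a * t) * \<phi>1 t - g 1 (a * t) * \<phi>1 t - f (- 1) (- a * t) * \<phi>1 t + g (- 1) (a * t) * \<phi>1 t)"
        using j by simp
      also have "\<dots> = (LINT t|lborel. (f 1 (- a * t) - g 1 (a * t) - f (- 1) (- a * t) + g (- 1) (a * t)) * \<phi>1 t)"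
        by (rule Bochner_Integration.integral_cong) (simp_all add: algebra_simps)
      finally show ?thesis .
    qed
    also have "(LINT t|lborel. (f 1 (- a * t) - g 1 (a * t) - f (- 1) (- a * t) + g (- 1) (a * t)) * \<phi>1 t)
        = (LINT t|lborel. 2 * (y t * \<phi>1 t) - 2 * (q t * \<phi>1 t))"
    proof (rule integral_cong_AE)
      have "continuous_on UNIV (\<lambda>t. (f 1 (- a * t) - g 1 (a * t) - f (- 1) (- a * t) + g (- 1) (a * t)) * \<phi>1 t)"
        by (intro continuous_on_mult continuous_on_add continuous_on_diff comp D D' test_function_continuous[OF T1])
      then show "(\<lambda>t. (f 1 (- a * t) - g 1 (a * t) - f (- 1) (- a * t) + g (- 1) (a * t)) * \<phi>1 t) \<in> borel_measurable lborel"
        using borel_measurable_continuous_onI by simp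
      have "continuous_on UNIV (\<lambda>t. 2 * (y t * \<phi>1 t) - 2 * (q t * \<phi>1 t))"
        by (intro continuous_intros y qc test_function_continuous[OF T1])
      then show "(\<lambda>t. 2 * (y t * \<phi>1 t) - 2 * (q t * \<phi>1 t)) \<in> borel_measurable lborel"
        using borel_measurable_continuous_onI by simp
      show "AE t in lborel. (f 1 (- a * t) - g 1 (a * t) - f (- 1) (- a * t) + g (- 1) (a * t)) * \<phi>1 t
          = 2 * (y t * \<phi>1 t) - 2 * (q t * \<phi>1 t)"
        using AE_lborel_singleton[of 0]
      proof eventually_elim
        case (elim t)
        show ?case
        proof (cases "t > 0")
          case True
          then have at: "a * t > 0" using pos by simp
          have "y t = f 1 (- a * t) + g 1 (a * t)" "y t = f (- 1) (- a * t) + g (- 1) (a * t)"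
            unfolding y_def using dAlembert_trace[OF dA _ u, of 1] dAlembert_trace[OF dA _ u, of "-1"] by auto
          moreover have "q t = g 1 (a * t) + f (- 1) (- a * t)"
            using g1[OF at] f1[OF at] by (simp add: q_def)
          ultimately have "f 1 (- a * t) - g 1 (a * t) - f (- 1) (- a * t) + g (- 1) (a * t) = 2 * y t - 2 * q t"
            by linarith
          then show ?thesis by (simp only: left_diff_distrib mult.assoc)
        next
          case False
          then have "\<phi>1 t = 0" using elim left1 by simp
          then show ?thesis by simp
        qed
      qed
    qed
    finally have jump': "(LINT t|lborel. (trace_deriv a df dg 1 t - trace_deriv a df dg (- 1) t) * \<phi> t)
        = (2 * (LINT t|lborel. y t * \<phi>1 t) - 2 * (LINT t|lborel. q t * \<phi>1 t)) / a"
      using int[OF y T1] int[OF qc T1] by simp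
    have "integrable lborel (\<lambda>t. (trace_deriv a df dg 1 t - trace_deriv a df dg (- 1) t) * \<phi> t)"
    proof -
      have "integrable lborel (\<lambda>t. (df 1 (- a * t) * \<phi> t + dg 1 (a * t) * \<phi> t) - (df (- 1) (- a * t) * \<phi> t + dg (- 1) (a * t) * \<phi> t))"
        using i by (intro Bochner_Integration.integrable_diff Bochner_Integration.integrable_add)
      then show ?thesis by (simp add: trace_deriv_def algebra_simps)
    qed
    then have ik: "integrable lborel (\<lambda>t. \<kappa> * ((trace_deriv a df dg 1 t - trace_deriv a df dg (- 1) t) * \<phi> t))"
      by (rule integrable_mult_right)
    have "m * (LINT t|lborel. y t * \<phi>2 t)
        = (LINT t|lborel. F (y t) * \<phi> t + \<kappa> * ((trace_deriv a df dg 1 t - trace_deriv a df dg (- 1) t) * \<phi> t))"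
      using eq[OF \<phi>] unfolding y_def[symmetric] \<phi>2_def \<phi>1_def by (simp only: distrib_right mult.assoc)
    also have "\<dots> = (LINT t|lborel. F (y t) * \<phi> t)
        + \<kappa> * (LINT t|lborel. (trace_deriv a df dg 1 t - trace_deriv a df dg (- 1) t) * \<phi> t)"
      unfolding Bochner_Integration.integral_add[OF int[OF Fy \<phi>] ik] by (simp only: integral_mult_right_zero)
    finally have "m * (LINT t|lborel. y t * \<phi>2 t) = (LINT t|lborel. F (y t) * \<phi> t)
        + \<kappa> * (LINT t|lborel. (trace_deriv a df dg 1 t - trace_deriv a df dg (- 1) t) * \<phi> t)" .
    then have main: "m * (LINT t|lborel. y t * \<phi>2 t) = (LINT t|lborel. F (y t) * \<phi> t)
        + b * (LINT t|lborel. y t * \<phi>1 t) - b * (LINT t|lborel. q t * \<phi>1 t)"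
      unfolding jump' b_def by (simp add: diff_divide_distrib algebra_simps)
    have "(LINT t|lborel. W t * \<phi>2 t)
        = (LINT t|lborel. m * (y t * \<phi>2 t) + b * (Yi t * \<phi>2 t) - b * (Qi t * \<phi>2 t) - A2 t * \<phi>2 t)"
      by (rule Bochner_Integration.integral_cong) (simp_all add: W_def algebra_simps)
    also have "\<dots> = m * (LINT t|lborel. y t * \<phi>2 t) + b * (LINT t|lborel. Yi t * \<phi>2 t)
        - b * (LINT t|lborel. Qi t * \<phi>2 t) - (LINT t|lborel. A2 t * \<phi>2 t)"
      using int[OF y T2] int[OF dc[OF Yi] T2] int[OF dc[OF Qi] T2] int[OF dc[OF A2] T2] by simp
    also have "(LINT t|lborel. Yi t * \<phi>2 t) = - (LINT t|lborel. y t * \<phi>1 t)"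
      unfolding \<phi>2_def by (rule C1[OF Yi y T1])
    also have "(LINT t|lborel. Qi t * \<phi>2 t) = - (LINT t|lborel. q t * \<phi>1 t)"
      unfolding \<phi>2_def by (rule C1[OF Qi qc T1])
    also have "(LINT t|lborel. A2 t * \<phi>2 t) = (LINT t|lborel. F (y t) * \<phi> t)"
      using C1[OF A2 A1c T1] C1[OF A1 Fy \<phi>] unfolding \<phi>2_def \<phi>1_def by simp
    finally show ?thesis using main unfolding \<phi>2_def \<phi>1_def by simp
  qed
  from weak_second_derivative_zero_affine[OF W this]
  obtain \<alpha> \<beta> where aff: "\<And>t. t > 0 \<Longrightarrow> W t = \<alpha> + \<beta> * t" by blast
  define Y where "Y t = (\<alpha> + \<beta> * t - b * Yi t + b * Qi t + A2 t) / m" for t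
  define V where "V t = (\<beta> - b * y t + b * q t + A1 t) / m" for t
  have Yd: "(Y has_real_derivative V t) (at t)" for t
    unfolding Y_def V_def using Yi[of t] Qi[of t] A2[of t] by (auto intro!: derivative_eq_intros DERIV_cdivide)
  have Vc: "continuous_on UNIV V" unfolding V_def using pos by (intro continuous_intros y qc A1c) auto
  have yY: "y t = Y t" if "t > 0" for t
    using aff[OF that] pos unfolding W_def Y_def by (simp add: field_simps)
  have "forced_system (1 / m) (2 * \<kappa> / (a * m)) F (\<lambda>t. 2 * \<kappa> / (a * m) * a * deriv p (a * t)) Y V"
    unfolding forced_system_def
  proof (intro allI impI conjI Yd)
    fix t :: real assume t: "t > 0"
    have yd: "(y has_real_derivative V t) (at t)"
      by (rule has_field_derivative_transform_within_open[OF Yd open_greaterThan[of 0]]) (use t yY in auto)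
    have "(V has_real_derivative (0 - b * V t + b * (a * (J1 (a * t) + J2 (a * t))) + F (y t)) / m) (at t)"
      unfolding V_def[abs_def]
      by (intro DERIV_cdivide DERIV_add DERIV_diff DERIV_const DERIV_cmult yd[unfolded V_def] q A1)
    moreover have "(0 - b * V t + b * (a * (J1 (a * t) + J2 (a * t))) + F (y t)) / m
        = 1 / m * F (Y t) - 2 * \<kappa> / (a * m) * V t + 2 * \<kappa> / (a * m) * a * deriv p (a * t)"
      using J[of "a * t"] t pos yY[OF t] by (simp add: b_def field_simps)
    ultimately show "(V has_real_derivative 1 / m * F (Y t) - 2 * \<kappa> / (a * m) * V t
        + 2 * \<kappa> / (a * m) * a * deriv p (a * t)) (at t)" by simp
  qed
  then show ?thesis using that Yd Vc yY unfolding y_def by blast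
qed

section \<open>Comparison of two solutions of the string equation\<close>

lemma L2_loc_diff:
  fixes v w :: "real \<Rightarrow> real"
  assumes v: "L2_loc v" and w: "L2_loc w"
  shows "L2_loc (\<lambda>z. v z - w z)"
  unfolding L2_loc_def
proof (intro conjI allI impI)
  have m: "v \<in> borel_measurable borel" "w \<in> borel_measurable borel" using v w by (auto simp: L2_loc_def)
  then show d: "(\<lambda>z. v z - w z) \<in> borel_measurable borel" by (rule borel_measurable_diff)
  fix K :: "real set" assume K: "compact K"
  have s: "set_integrable lborel K (\<lambda>z. 2 * (v z)\<^sup>2 + 2 * (w z)\<^sup>2)"
    using v w K unfolding L2_loc_def by (intro set_integral_add set_integrable_mult_right) auto
  show "set_integrable lborel K (\<lambda>z. (v z - w z)\<^sup>2)"
  proof (rule set_integrable_bound[OF s])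
    show "set_borel_measurable lborel K (\<lambda>z. (v z - w z)\<^sup>2)"
      unfolding set_borel_measurable_def
      using d borel_compact[OF K] by (intro borel_measurable_scaleR borel_measurable_indicator borel_measurable_power) auto
    have "norm ((v z - w z)\<^sup>2) \<le> norm (2 * (v z)\<^sup>2 + 2 * (w z)\<^sup>2)" for z
    proof -
      have "2 * (v z)\<^sup>2 + 2 * (w z)\<^sup>2 - (v z - w z)\<^sup>2 = (v z + w z)\<^sup>2" by (simp add: power2_eq_square algebra_simps)
      then have "(v z - w z)\<^sup>2 \<le> 2 * (v z)\<^sup>2 + 2 * (w z)\<^sup>2" using zero_le_power2[of "v z + w z"] by linarith
      then show ?thesis by simp
    qed
    then show "AE x in lborel. x \<in> K \<longrightarrow> norm ((v x - w x)\<^sup>2) \<le> norm (2 * (v x)\<^sup>2 + 2 * (w x)\<^sup>2)" by simp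
  qed
qed

lemma weak_partial_diff:
  fixes f g v w :: "real \<Rightarrow> real"
  assumes f: "continuous_on UNIV f" "L2_loc v" "weak_partial 1 f v"
    and g: "continuous_on UNIV g" "L2_loc w" "weak_partial 1 g w"
  shows "weak_partial 1 (\<lambda>z. f z - g z) (\<lambda>z. v z - w z)"
  unfolding weak_partial_def
proof (intro allI impI)
  fix \<phi> :: "real \<Rightarrow> real" assume \<phi>: "test_function UNIV \<phi>"
  note T = test_function_partial[OF \<phi>, of 1]
  note i = L2_loc_test_integrable[OF L2_loc_continuous[OF f(1)] T] L2_loc_test_integrable[OF L2_loc_continuous[OF g(1)] T]
    L2_loc_test_integrable[OF f(2) \<phi>] L2_loc_test_integrable[OF g(2) \<phi>]
  show "(LINT z|lborel. (f z - g z) * partial 1 \<phi> z) = - (LINT z|lborel. (v z - w z) * \<phi> z)"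
    using f(3) g(3) \<phi> i unfolding weak_partial_def left_diff_distrib by simp
qed

text \<open>The two families of waves of a solution are determined by the solution, and so is the way in
  which they differ between two solutions whose difference is an outgoing wave.\<close>

lemma outgoing_difference_derivatives:
  assumes a: "a > 0" and dA: "dAlembert a u f g df dg" and dB: "dAlembert a v fp gp dfp dgp"
    and E: "\<And>t. (E has_real_derivative E' t) (at t)" and E': "continuous_on UNIV E'"
    and diff: "\<And>x t. \<bar>x\<bar> < a * t \<Longrightarrow> u (x, t) - v (x, t) = E (t - \<bar>x\<bar> / a)"
  shows "AE z in lborel. z < 0 \<longrightarrow> df 1 z - dfp 1 z = - (E' (- z / a) / a)"
    "AE z in lborel. z > 0 \<longrightarrow> dg 1 z - dgp 1 z = 0"
    "AE z in lborel. z < 0 \<longrightarrow> df (- 1) z - dfp (- 1) z = 0"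
    "AE z in lborel. z > 0 \<longrightarrow> dg (- 1) z - dgp (- 1) z = E' (z / a) / a"
proof -
  have char: "(f s \<alpha> - fp s \<alpha>) + (g s \<beta> - gp s \<beta>) = E (if s = 1 then - \<alpha> / a else \<beta> / a)"
    if s: "s \<in> {1, -1}" and \<alpha>: "\<alpha> < 0" and \<beta>: "\<beta> > 0" and pos: "s * (\<alpha> + \<beta>) > 0" for s \<alpha> \<beta>
  proof -
    define x where "x = (\<alpha> + \<beta>) / 2"
    define t where "t = (\<beta> - \<alpha>) / (2 * a)"
    have at: "a * t = (\<beta> - \<alpha>) / 2" using a by (simp add: t_def)
    have "\<bar>x\<bar> < a * t" unfolding at x_def using \<alpha> \<beta> by (auto simp: abs_less_iff)
    then have "u (x, t) - v (x, t) = E (t - \<bar>x\<bar> / a)" by (rule diff)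
    moreover have "t - \<bar>x\<bar> / a = (if s = 1 then - \<alpha> / a else \<beta> / a)"
    proof (cases "s = 1")
      case True
      then have "\<bar>x\<bar> = (\<alpha> + \<beta>) / 2" using pos by (simp add: x_def)
      then show ?thesis using True a by (simp add: t_def field_simps)
    next
      case False
      then have "s = -1" using s by simp
      then have "x < 0" using pos by (simp add: x_def)
      then have abs_x: "\<bar>x\<bar> = - ((\<alpha> + \<beta>) / 2)" unfolding x_def by (rule abs_of_neg)
      show ?thesis unfolding abs_x t_def using False a by (simp add: field_simps)
    qed
    ultimately show ?thesis
      using dAlembert_characteristic[OF dA s a pos] dAlembert_characteristic[OF dB s a pos]
      by (simp add: x_def t_def)
  qed
  note DA = dAlembertD[OF dA] and DB = dAlembertD[OF dB]
  have s1: "(1::real) \<in> {1, -1}" "(-1::real) \<in> {1, -1}" by auto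
  note cf = continuous_on_diff[OF DA(1) DB(1)] and cg = continuous_on_diff[OF DA(2) DB(2)]
  note lf = L2_loc_diff[OF DA(3) DB(3)] and lg = L2_loc_diff[OF DA(5) DB(5)]
  have wf: "weak_partial 1 (\<lambda>z. f s z - fp s z) (\<lambda>z. df s z - dfp s z)" if s: "s \<in> {1, -1}" for s
    by (rule weak_partial_diff[OF DA(1,3,4)[OF s] DB(1,3,4)[OF s]])
  have wg: "weak_partial 1 (\<lambda>z. g s z - gp s z) (\<lambda>z. dg s z - dgp s z)" if s: "s \<in> {1, -1}" for s
    by (rule weak_partial_diff[OF DA(2,5,6)[OF s] DB(2,5,6)[OF s]])
  have neg: "z \<in> {..<0::real} \<longleftrightarrow> z < 0" and posi: "z \<in> {0::real<..} \<longleftrightarrow> z > 0" for z by auto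
  show "AE z in lborel. z < 0 \<longrightarrow> df 1 z - dfp 1 z = - (E' (- z / a) / a)"
  proof -
    have "AE z in lborel. z \<in> {..<0} \<longrightarrow> df 1 z - dfp 1 z = E' (- z / a) * (- 1 / a)"
    proof (rule weak_derivative_eq_classical[OF cf[OF s1(1) s1(1)] lf[OF s1(1) s1(1)] wf[OF s1(1)] open_lessThan])
      show "f 1 x - fp 1 x - (f 1 y - fp 1 y) = E (- x / a) - E (- y / a)" if "x \<in> {..<0}" "y \<in> {..<0}" for x y
        using char[of 1 x "- x - y"] char[of 1 y "- x - y"] that by simp
      show "((\<lambda>z. E (- z / a)) has_real_derivative E' (- z / a) * (- 1 / a)) (at z)" for z
        by (rule DERIV_chain2[OF E]) (use a in \<open>auto intro!: derivative_eq_intros\<close>)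
      show "continuous_on UNIV (\<lambda>z. E' (- z / a) * (- 1 / a))"
        by (intro continuous_on_mult continuous_on_const continuous_on_compose2[OF E']) (use a in \<open>auto intro!: continuous_intros\<close>)
    qed
    then show ?thesis by simp
  qed
  show "AE z in lborel. z > 0 \<longrightarrow> dg (- 1) z - dgp (- 1) z = E' (z / a) / a"
  proof -
    have "AE z in lborel. z \<in> {0<..} \<longrightarrow> dg (- 1) z - dgp (- 1) z = E' (z / a) * (1 / a)"
    proof (rule weak_derivative_eq_classical[OF cg[OF s1(2) s1(2)] lg[OF s1(2) s1(2)] wg[OF s1(2)] open_greaterThan])
      show "g (- 1) x - gp (- 1) x - (g (- 1) y - gp (- 1) y) = E (x / a) - E (y / a)" if "x \<in> {0<..}" "y \<in> {0<..}" for x y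
        using char[of "-1" "- x - y" x] char[of "-1" "- x - y" y] that by simp
      show "((\<lambda>z. E (z / a)) has_real_derivative E' (z / a) * (1 / a)) (at z)" for z
        by (rule DERIV_chain2[OF E]) (use a in \<open>auto intro!: derivative_eq_intros\<close>)
      show "continuous_on UNIV (\<lambda>z. E' (z / a) * (1 / a))"
        by (intro continuous_on_mult continuous_on_const continuous_on_compose2[OF E']) (use a in \<open>auto intro!: continuous_intros\<close>)
    qed
    then show ?thesis by simp
  qed
  show "AE z in lborel. z > 0 \<longrightarrow> dg 1 z - dgp 1 z = 0"
  proof -
    have "AE z in lborel. z \<in> {0<..} \<longrightarrow> dg 1 z - dgp 1 z = 0"
    proof (rule weak_derivative_eq_classical[OF cg[OF s1(1) s1(1)] lg[OF s1(1) s1(1)] wg[OF s1(1)] open_greaterThan])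
      show "g 1 x - gp 1 x - (g 1 y - gp 1 y) = (\<lambda>_. 0) x - (\<lambda>_. 0) y" if "x \<in> {0<..}" "y \<in> {0<..}" for x y
      proof -
        define c where "c = min x y / 2"
        have "c > 0" "c < x" "c < y" using that by (auto simp: c_def min_def)
        then show ?thesis using char[of 1 "- c" x] char[of 1 "- c" y] by simp
      qed
    qed simp_all
    then show ?thesis by simp
  qed
  show "AE z in lborel. z < 0 \<longrightarrow> df (- 1) z - dfp (- 1) z = 0"
  proof -
    have "AE z in lborel. z \<in> {..<0} \<longrightarrow> df (- 1) z - dfp (- 1) z = 0"
    proof (rule weak_derivative_eq_classical[OF cf[OF s1(2) s1(2)] lf[OF s1(2) s1(2)] wf[OF s1(2)] open_lessThan])
      show "f (- 1) x - fp (- 1) x - (f (- 1) y - fp (- 1) y) = (\<lambda>_. 0) x - (\<lambda>_. 0) y" if "x \<in> {..<0}" "y \<in> {..<0}" for x y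
      proof -
        define c where "c = - (max x y / 2)"
        have "c > 0" "x + c < 0" "y + c < 0" using that by (auto simp: c_def max_def)
        then show ?thesis using char[of "-1" x c] char[of "-1" y c] that by simp
      qed
    qed simp_all
    then show ?thesis by simp
  qed
qed

lemma tendsto_0_at_top_bound:
  fixes e :: "real \<Rightarrow> real"
  assumes "(e \<longlongrightarrow> 0) at_top" "\<delta> > 0"
  obtains T where "\<And>t. t \<ge> T \<Longrightarrow> \<bar>e t\<bar> \<le> \<delta>"
proof -
  obtain T where "\<forall>t\<ge>T. dist (e t) 0 < \<delta>"
    using tendstoD[OF assms] unfolding eventually_at_top_linorder by blast
  then show ?thesis using that[of T] by (simp add: less_imp_le)
qed

lemma AE_lborel_shift:
  assumes "AE z in lborel. P z"
  shows "AE x in lborel. P (x - c :: real)"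
proof -
  obtain N where N: "{z \<in> space lborel. \<not> P z} \<subseteq> N" "N \<in> null_sets lborel"
    using assms by (auto elim: AE_E simp: null_sets_def)
  show ?thesis
    by (rule AE_I'[OF null_sets_translation[OF N(2), of c]]) (use N(1) in auto)
qed

text \<open>Once \<open>a t \<ge> R\<close>, the set \<open>\<bar>x\<bar> < R\<close> lies inside the cone, where the time derivatives differ by
  \<open>E' (t - \<bar>x\<bar>/a)\<close> and the space derivatives by the same quantity divided by \<open>a\<close>, up to sign and
  null sets.\<close>

lemma outgoing_difference_local_convergence:
  assumes a: "a > 0" and dA: "dAlembert a u f g df dg" and dB: "dAlembert a v fp gp dfp dgp"
    and E: "\<And>t. (E has_real_derivative E' t) (at t)" and E': "continuous_on UNIV E'"
    and diff: "\<And>x t. \<bar>x\<bar> < a * t \<Longrightarrow> u (x, t) - v (x, t) = E (t - \<bar>x\<bar> / a)"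
    and lim: "(E \<longlongrightarrow> 0) at_top" "(E' \<longlongrightarrow> 0) at_top" and R: "R > 0"
  shows "((\<lambda>t. (LBINT x:{x. \<bar>x\<bar> < R}. (time_deriv a df dg x t - time_deriv a dfp dgp x t)\<^sup>2
              + (space_deriv a df dg x t - space_deriv a dfp dgp x t)\<^sup>2)
           + (SUP x\<in>{x. \<bar>x\<bar> < R}. \<bar>u (x, t) - v (x, t)\<bar>)) \<longlongrightarrow> 0) at_top"
proof (rule tendsto_integral_plus_SUP[where C = "2 * R"])
  have ball: "{x::real. \<bar>x\<bar> < R} = {-R<..<R}" by auto
  show "{x. \<bar>x\<bar> < R} \<in> sets lborel" "emeasure lborel {x. \<bar>x\<bar> < R} \<le> ennreal (2 * R)"
    unfolding ball using R by auto
  show "{x. \<bar>x\<bar> < R} \<noteq> {}" unfolding ball using R by auto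
  fix \<delta> :: real assume \<delta>: "\<delta> > 0"
  have AE: "AE z in lborel. z < 0 \<longrightarrow> df 1 z - dfp 1 z = - (E' (- z / a) / a)"
    "AE z in lborel. z > 0 \<longrightarrow> dg 1 z - dgp 1 z = 0"
    "AE z in lborel. z < 0 \<longrightarrow> df (- 1) z - dfp (- 1) z = 0"
    "AE z in lborel. z > 0 \<longrightarrow> dg (- 1) z - dgp (- 1) z = E' (z / a) / a"
    using outgoing_difference_derivatives[OF a dA dB E E'] diff by blast+
  define \<eta> where "\<eta> = sqrt (\<delta> / (1 + 1 / a\<^sup>2))"
  have c: "1 + 1 / a\<^sup>2 > 0" by (simp add: add_pos_nonneg)
  have \<eta>: "\<eta> > 0" "(1 + 1 / a\<^sup>2) * \<eta>\<^sup>2 = \<delta>" using \<delta> c by (simp_all add: \<eta>_def)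
  obtain T1 where T1: "\<And>t. t \<ge> T1 \<Longrightarrow> \<bar>E t\<bar> \<le> \<delta>"
    using tendsto_0_at_top_bound[OF lim(1) \<delta>] by metis
  obtain T2 where T2: "\<And>t. t \<ge> T2 \<Longrightarrow> \<bar>E' t\<bar> \<le> \<eta>"
    using tendsto_0_at_top_bound[OF lim(2) \<eta>(1)] by metis
  show "\<forall>\<^sub>F t in at_top. (AE x in lborel. x \<in> {x. \<bar>x\<bar> < R} \<longrightarrow>
      0 \<le> (time_deriv a df dg x t - time_deriv a dfp dgp x t)\<^sup>2 + (space_deriv a df dg x t - space_deriv a dfp dgp x t)\<^sup>2
      \<and> (time_deriv a df dg x t - time_deriv a dfp dgp x t)\<^sup>2 + (space_deriv a df dg x t - space_deriv a dfp dgp x t)\<^sup>2 \<le> \<delta>)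
      \<and> (\<forall>x\<in>{x. \<bar>x\<bar> < R}. \<bar>u (x, t) - v (x, t)\<bar> \<le> \<delta>)"
  proof (rule eventually_at_top_linorderI[of "max (max T1 T2) 0 + R / a"])
    fix t assume t: "max (max T1 T2) 0 + R / a \<le> t"
    have "R / a \<le> t" using t by linarith
    then have Rt: "R \<le> a * t" using a by (simp add: field_simps)
    have late: "t - \<bar>x\<bar> / a \<ge> T1" "t - \<bar>x\<bar> / a \<ge> T2" if "\<bar>x\<bar> < R" for x
    proof -
      have "\<bar>x\<bar> / a \<le> R / a" using that a by (simp add: divide_right_mono)
      then show "t - \<bar>x\<bar> / a \<ge> T1" "t - \<bar>x\<bar> / a \<ge> T2" using t by linarith+
    qed
    have "\<bar>u (x, t) - v (x, t)\<bar> \<le> \<delta>" if "\<bar>x\<bar> < R" for x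
      using diff[of x t] T1[OF late(1)[OF that]] that Rt by simp
    moreover have "AE x in lborel. x \<in> {x. \<bar>x\<bar> < R} \<longrightarrow>
      0 \<le> (time_deriv a df dg x t - time_deriv a dfp dgp x t)\<^sup>2 + (space_deriv a df dg x t - space_deriv a dfp dgp x t)\<^sup>2
      \<and> (time_deriv a df dg x t - time_deriv a dfp dgp x t)\<^sup>2 + (space_deriv a df dg x t - space_deriv a dfp dgp x t)\<^sup>2 \<le> \<delta>"
      using AE_lborel_shift[OF AE(1), of "a * t"] AE_lborel_shift[OF AE(2), of "- a * t"]
        AE_lborel_shift[OF AE(3), of "a * t"] AE_lborel_shift[OF AE(4), of "- a * t"] AE_lborel_singleton[of 0]
    proof eventually_elim
      case (elim x)
      define e where "e = E' (t - \<bar>x\<bar> / a)"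
      show ?case
      proof
        assume "x \<in> {x. \<bar>x\<bar> < R}"
        then have xR: "\<bar>x\<bar> < R" by simp
        have signs: "x - a * t < 0" "x - - a * t > 0" using xR Rt by auto
        have d: "time_deriv a df dg x t - time_deriv a dfp dgp x t = e
          \<and> (space_deriv a df dg x t - space_deriv a dfp dgp x t)\<^sup>2 = (e / a)\<^sup>2"
        proof (cases "x > 0")
          case True
          have "- (x - a * t) / a = t - \<bar>x\<bar> / a" using True a by (simp add: field_simps)
          then have "df 1 (x - a * t) - dfp 1 (x - a * t) = - (e / a)" "dg 1 (x + a * t) - dgp 1 (x + a * t) = 0"
            using elim(1,2) signs by (simp_all add: e_def)
          then have k: "df 1 (x - a * t) = dfp 1 (x - a * t) - e / a" "dg 1 (x + a * t) = dgp 1 (x + a * t)" by linarith+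
          show ?thesis using True a unfolding time_deriv_def space_deriv_def by (simp add: k algebra_simps)
        next
          case False
          then have x: "x < 0" using elim(5) by simp
          have "(x - - a * t) / a = t - \<bar>x\<bar> / a" using x a by (simp add: field_simps)
          then have "df (- 1) (x - a * t) - dfp (- 1) (x - a * t) = 0" "dg (- 1) (x + a * t) - dgp (- 1) (x + a * t) = e / a"
            using elim(3,4) signs by (simp_all add: e_def)
          then have k: "df (- 1) (x - a * t) = dfp (- 1) (x - a * t)" "dg (- 1) (x + a * t) = dgp (- 1) (x + a * t) + e / a" by linarith+
          show ?thesis using x a unfolding time_deriv_def space_deriv_def by (simp add: k algebra_simps)
        qed
        have "e\<^sup>2 \<le> \<eta>\<^sup>2" using T2[OF late(2)[OF xR]] \<eta>(1) by (simp add: e_def abs_le_square_iff[symmetric])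
        then have "(1 + 1 / a\<^sup>2) * e\<^sup>2 \<le> (1 + 1 / a\<^sup>2) * \<eta>\<^sup>2" using c by (intro mult_left_mono) auto
        then have "e\<^sup>2 + (e / a)\<^sup>2 \<le> \<delta>" unfolding \<eta>(2) by (simp add: distrib_right power_divide)
        then show "0 \<le> (time_deriv a df dg x t - time_deriv a dfp dgp x t)\<^sup>2 + (space_deriv a df dg x t - space_deriv a dfp dgp x t)\<^sup>2
          \<and> (time_deriv a df dg x t - time_deriv a dfp dgp x t)\<^sup>2 + (space_deriv a df dg x t - space_deriv a dfp dgp x t)\<^sup>2 \<le> \<delta>"
          using d by simp
      qed
    qed
    ultimately show "(AE x in lborel. x \<in> {x. \<bar>x\<bar> < R} \<longrightarrow>
      0 \<le> (time_deriv a df dg x t - time_deriv a dfp dgp x t)\<^sup>2 + (space_deriv a df dg x t - space_deriv a dfp dgp x t)\<^sup>2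
      \<and> (time_deriv a df dg x t - time_deriv a dfp dgp x t)\<^sup>2 + (space_deriv a df dg x t - space_deriv a dfp dgp x t)\<^sup>2 \<le> \<delta>)
      \<and> (\<forall>x\<in>{x. \<bar>x\<bar> < R}. \<bar>u (x, t) - v (x, t)\<bar> \<le> \<delta>)" by auto
  qed
qed

text \<open>Convergence on a window that moves to infinity.\<close>

lemma trajectory_local_convergence:
  fixes e d :: "real \<Rightarrow> real"
  assumes lim: "(e \<longlongrightarrow> 0) at_top" "(d \<longlongrightarrow> 0) at_top" and R: "R > 0"
  shows "((\<lambda>t. (LBINT s:{t..t + R}. (d s)\<^sup>2) + (SUP s\<in>{t..t + R}. \<bar>e s\<bar>)) \<longlongrightarrow> 0) at_top"
proof (rule tendsto_integral_plus_SUP[where C = R])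
  fix \<delta> :: real assume \<delta>: "\<delta> > 0"
  obtain T1 where T1: "\<And>t. t \<ge> T1 \<Longrightarrow> \<bar>e t\<bar> \<le> \<delta>"
    using tendsto_0_at_top_bound[OF lim(1) \<delta>] by metis
  have "sqrt \<delta> > 0" using \<delta> by simp
  from tendsto_0_at_top_bound[OF lim(2) this]
  obtain T2 where T2: "\<And>t. t \<ge> T2 \<Longrightarrow> \<bar>d t\<bar> \<le> sqrt \<delta>" by metis
  have sq: "(d s)\<^sup>2 \<le> \<delta>" if "s \<ge> T2" for s
  proof -
    have "\<bar>d s\<bar>\<^sup>2 \<le> (sqrt \<delta>)\<^sup>2" by (rule power_mono[OF T2[OF that]]) simp
    then show ?thesis using \<delta> by simp
  qed
  show "\<forall>\<^sub>F t in at_top. (AE x in lborel. x \<in> {t..t + R} \<longrightarrow> 0 \<le> (d x)\<^sup>2 \<and> (d x)\<^sup>2 \<le> \<delta>)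
      \<and> (\<forall>x\<in>{t..t + R}. \<bar>e x\<bar> \<le> \<delta>)"
    by (rule eventually_at_top_linorderI[of "max T1 T2"]) (use T1 sq in auto)
qed (use R in auto)

section \<open>The periodic solution of the string equation\<close>

text \<open>The displacement \<open>Y\<close> of the mass and the incoming waves \<open>I1\<close>, \<open>I2\<close> determine the outgoing
  waves: on either side the outgoing wave is what is missing at \<open>x = 0\<close>.\<close>

lemma string_solution_from_trace:
  fixes Y V V' I1 I2 J1 J2 F :: "real \<Rightarrow> real"
  assumes pos: "\<mu> > 0" "\<kappa> > 0" and a: "a = sqrt (\<kappa> / \<mu>)"
    and F: "continuous_on UNIV F"
    and Y: "\<And>t. (Y has_real_derivative V t) (at t)" and V: "\<And>t. (V has_real_derivative V' t) (at t)"
    and V': "continuous_on UNIV V'"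
    and I1: "\<And>z. (I1 has_real_derivative J1 z) (at z)" "continuous_on UNIV J1"
    and I2: "\<And>z. (I2 has_real_derivative J2 z) (at z)" "continuous_on UNIV J2"
    and ode: "\<And>t. m * V' t = F (Y t) - 2 * \<kappa> / a * V t + 2 * \<kappa> * (J1 (a * t) + J2 (a * t))"
  obtains u where "u \<in> E_class" "string_solution m \<mu> \<kappa> F u" "\<exists>f g df dg. dAlembert a u f g df dg"
    "\<And>x t. u (x, t) = Y (t - \<bar>x\<bar> / a) + (if x > 0 then I1 (a * t + \<bar>x\<bar>) - I1 (a * t - \<bar>x\<bar>)
        else I2 (a * t + \<bar>x\<bar>) - I2 (a * t - \<bar>x\<bar>))"
proof -
  have apos: "a > 0" using pos by (simp add: a)
  have \<kappa>: "\<kappa> = \<mu> * a\<^sup>2" using pos by (simp add: a)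
  define A where "A s z = (if s = 1 then Y (- z / a) - I1 (- z) else I2 (- z))" for s z :: real
  define B where "B s z = (if s = 1 then I1 z else Y (z / a) - I2 z)" for s z :: real
  define A' where "A' s z = (if s = 1 then J1 (- z) - V (- z / a) / a else - J2 (- z))" for s z :: real
  define B' where "B' s z = (if s = 1 then J1 z else V (z / a) / a - J2 z)" for s z :: real
  have mirror: "(uminus has_real_derivative - 1) (at z)" for z :: real by (auto intro!: derivative_eq_intros)
  have scale: "((\<lambda>z. z / a) has_real_derivative 1 / a) (at z)" "((\<lambda>z. - z / a) has_real_derivative - 1 / a) (at z)" for z
    using apos by (auto intro!: derivative_eq_intros)
  have A: "(A s has_real_derivative A' s z) (at z)" for s z
  proof (cases "s = 1")
    case True
    have "((\<lambda>z. Y (- z / a) - I1 (- z)) has_real_derivative V (- z / a) * (- 1 / a) - J1 (- z) * (- 1)) (at z)"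
      by (intro DERIV_diff DERIV_chain2[OF Y scale(2)] DERIV_chain2[OF I1(1) mirror])
    then show ?thesis using True by (simp add: A_def[abs_def] A'_def)
  next
    case False
    have "((\<lambda>z. I2 (- z)) has_real_derivative J2 (- z) * (- 1)) (at z)"
      by (rule DERIV_chain2[OF I2(1) mirror])
    then show ?thesis using False by (simp add: A_def[abs_def] A'_def)
  qed
  have B: "(B s has_real_derivative B' s z) (at z)" for s z
  proof (cases "s = 1")
    case True
    then show ?thesis using I1(1) by (simp add: B_def[abs_def] B'_def)
  next
    case False
    have "((\<lambda>z. Y (z / a) - I2 z) has_real_derivative V (z / a) * (1 / a) - J2 z) (at z)"
      by (intro DERIV_diff DERIV_chain2[OF Y scale(1)] I2(1))
    then show ?thesis using False by (simp add: B_def[abs_def] B'_def)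
  qed
  have dc: "continuous_on UNIV h" if "\<And>t. (h has_real_derivative h' t) (at t)" for h h' :: "real \<Rightarrow> real"
    by (rule DERIV_continuous_on[OF has_field_derivative_at_within[OF that]])
  note Vc = dc[OF V] and Yc = dc[OF Y]
  have comp: "continuous_on UNIV (\<lambda>z. h (r z))" if "continuous_on UNIV h" "continuous_on UNIV r" for h r :: "real \<Rightarrow> real"
    by (rule continuous_on_compose2[OF that]) simp
  have r: "continuous_on UNIV (\<lambda>z::real. - z)" "continuous_on UNIV (\<lambda>z. z / a)" "continuous_on UNIV (\<lambda>z. - z / a)"
    "continuous_on UNIV (\<lambda>z. a * z)"
    using apos by (auto intro!: continuous_intros)
  have A'c: "continuous_on UNIV (A' s)" for s
    using apos comp[OF I1(2) r(1)] comp[OF I2(2) r(1)] comp[OF Vc r(3)]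
    by (cases "s = 1") (auto simp: A'_def[abs_def] intro!: continuous_on_diff continuous_on_divide continuous_on_minus)
  have B'c: "continuous_on UNIV (B' s)" for s
    using apos I1(2) I2(2) comp[OF Vc r(2)]
    by (cases "s = 1") (auto simp: B'_def[abs_def] intro!: continuous_on_diff continuous_on_divide)
  have match: "A 1 (- a * t) + B 1 (a * t) = A (- 1) (- a * t) + B (- 1) (a * t)" for t
    using apos by (simp add: A_def B_def)
  define u where "u = glued_wave a A B"
  note sol = glued_wave_is_solution[OF apos \<kappa> A A'c B B'c match, folded u_def]
  have formula: "u (x, t) = Y (t - \<bar>x\<bar> / a) + (if x > 0 then I1 (a * t + \<bar>x\<bar>) - I1 (a * t - \<bar>x\<bar>)
        else I2 (a * t + \<bar>x\<bar>) - I2 (a * t - \<bar>x\<bar>))" for x t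
  proof (cases "x > 0")
    case True
    have "- (x - a * t) / a = t - x / a" using apos by (simp add: field_simps)
    then show ?thesis using True by (simp add: u_def glued_wave_def A_def B_def add.commute)
  next
    case False
    have "(x + a * t) / a = t + x / a" using apos by (simp add: field_simps)
    then show ?thesis using False by (simp add: u_def glued_wave_def A_def B_def add.commute)
  qed
  have u0: "u (0, t) = Y t" for t using formula[of 0 t] by simp
  have "string_solution m \<mu> \<kappa> F u"
    unfolding string_solution_def Let_def a[symmetric]
  proof (intro conjI exI allI impI)
    show "wave_equation_off_0 \<mu> \<kappa> u" by (rule sol(2))
    show "dAlembert a u A B A' B'" by (rule sol(3))
    fix \<phi> :: "real \<Rightarrow> real" assume \<phi>: "test_function UNIV \<phi>"
    note T = test_function_partial[OF \<phi>, of 1]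
    have "(LINT t|lborel. Y t * partial 1 (partial 1 \<phi>) t) = - (LINT t|lborel. V t * partial 1 \<phi> t)"
      using weak_partial_C1[OF Y Vc] T unfolding weak_partial_def by blast
    also have "(LINT t|lborel. V t * partial 1 \<phi> t) = - (LINT t|lborel. V' t * \<phi> t)"
      using weak_partial_C1[OF V V'] \<phi> unfolding weak_partial_def by blast
    finally have "m * (LINT t|lborel. u (0, t) * partial 1 (partial 1 \<phi>) t) = (LINT t|lborel. (m * V' t) * \<phi> t)"
      by (simp add: u0 mult.assoc)
    also have "(\<lambda>t. m * V' t) = (\<lambda>t. F (u (0, t)) + \<kappa> * (trace_deriv a A' B' 1 t - trace_deriv a A' B' (- 1) t))"
      using apos by (simp add: fun_eq_iff ode u0 trace_deriv_def A'_def B'_def algebra_simps)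
    finally show "m * (LINT t|lborel. u (0, t) * partial 1 (partial 1 \<phi>) t)
        = (LINT t|lborel. (F (u (0, t)) + \<kappa> * (trace_deriv a A' B' 1 t - trace_deriv a A' B' (- 1) t)) * \<phi> t)" .
  qed
  then show ?thesis using that[of u] sol(1,3) formula by blast
qed

text \<open>Inside the cone the outgoing wave reached \<open>x\<close> from the mass at time \<open>t - \<bar>x\<bar>/a > 0\<close>, and all
  arguments of the incoming wave are positive.\<close>

lemma dAlembert_inside_light_cone:
  assumes dA: "dAlembert a u f g df dg" and u: "continuous_on UNIV u" and a: "a > 0"
    and g1: "\<And>z. z > 0 \<Longrightarrow> g 1 z = I1 z + C1" and f1: "\<And>z. z > 0 \<Longrightarrow> f (- 1) (- z) = I2 z + C2"
    and cone: "\<bar>x\<bar> < a * t"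
  shows "u (x, t) = u (0, t - \<bar>x\<bar> / a) + (if x > 0 then I1 (a * t + \<bar>x\<bar>) - I1 (a * t - \<bar>x\<bar>)
        else I2 (a * t + \<bar>x\<bar>) - I2 (a * t - \<bar>x\<bar>))"
proof -
  have at: "a * (t - \<bar>x\<bar> / a) = a * t - \<bar>x\<bar>" using a by (simp add: right_diff_distrib)
  consider "x > 0" | "x < 0" | "x = 0" by linarith
  then show ?thesis
  proof cases
    case 1
    have "u (x, t) = f 1 (x - a * t) + g 1 (x + a * t)" using dAlembertD(7)[OF dA, of 1 x t] 1 by simp
    moreover have "u (0, t - \<bar>x\<bar> / a) = f 1 (x - a * t) + g 1 (a * t - x)"
      using dAlembert_trace[OF dA _ u, of 1 "t - \<bar>x\<bar> / a"] at 1 by simp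
    moreover have "g 1 (x + a * t) = I1 (a * t + \<bar>x\<bar>) + C1" "g 1 (a * t - x) = I1 (a * t - \<bar>x\<bar>) + C1"
      using g1[of "x + a * t"] g1[of "a * t - x"] 1 cone by (simp_all add: add.commute)
    ultimately show ?thesis using 1 by simp
  next
    case 2
    have "u (x, t) = f (- 1) (x - a * t) + g (- 1) (x + a * t)" using dAlembertD(7)[OF dA, of "-1" x t] 2 by simp
    moreover have "u (0, t - \<bar>x\<bar> / a) = f (- 1) (- (a * t + x)) + g (- 1) (x + a * t)"
      using dAlembert_trace[OF dA _ u, of "-1" "t - \<bar>x\<bar> / a"] at 2 by (simp add: add.commute)
    moreover have "f (- 1) (x - a * t) = I2 (a * t + \<bar>x\<bar>) + C2" "f (- 1) (- (a * t + x)) = I2 (a * t - \<bar>x\<bar>) + C2"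
      using f1[of "a * t - x"] f1[of "a * t + x"] 2 cone by simp_all
    ultimately show ?thesis using 2 by simp
  qed simp
qed

section \<open>Periodic attractors of the reduced equation and of the string\<close>

theorem corollary3p8:
  fixes m \<mu> \<kappa> a \<omega> \<omega>0 y1 :: real
    and F u0 u1 p :: "real \<Rightarrow> real"
  assumes "m > 0" and "\<mu> > 0" and "\<kappa> > 0" and "a = sqrt (\<kappa> / \<mu>)"
    and "\<omega> > 0" and "\<omega>0 = \<omega> / a"
    and "F C1_differentiable_on UNIV"
    and "filterlim F at_bot at_top" and "filterlim F at_top at_bot"
    and "(u0, u1) \<in> H_class \<omega>"
    and "p = incident_wave a u0 u1"
    and "condition_F2 (1 / m) (2 * \<kappa> / (a * m)) F
         \<or> condition_F3 (1 / m) (2 * \<kappa> / (a * m)) a F p"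
  shows
    "(\<exists>yp. reduced_solution m \<kappa> a F p yp \<and> (\<forall>t>0. yp (t + \<omega>0) = yp t)
        \<and> (\<forall>z. reduced_solution m \<kappa> a F p z \<and> (\<forall>t>0. z (t + \<omega>0) = z t)
               \<longrightarrow> (\<forall>t>0. z t = yp t))
        \<and> (\<forall>y. reduced_solution m \<kappa> a F p y \<longrightarrow>
             (\<forall>R>0. ((\<lambda>t. (LBINT s:{t..t + R}. (deriv y s - deriv yp s)\<^sup>2)
                         + (SUP s\<in>{t..t + R}. \<bar>y s - yp s\<bar>)) \<longlongrightarrow> 0) at_top)))
     \<and>
     (\<forall>u\<in>E_class. string_solution m \<mu> \<kappa> F u \<and> initial_conditions a u u0 u1 y1 \<longrightarrow>
        (\<exists>up\<in>E_class. string_solution m \<mu> \<kappa> F up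
           \<and> (\<forall>x t. \<bar>t\<bar> > \<bar>x\<bar> / a \<longrightarrow> up (x, t + \<omega> / a) = up (x, t))
           \<and> (\<forall>f g df dg fp gp dfp dgp.
                dAlembert a u f g df dg \<and> dAlembert a up fp gp dfp dgp \<longrightarrow>
                (\<forall>R>0. ((\<lambda>t.
                   (LBINT x:{x. \<bar>x\<bar> < R}.
                      (time_deriv a df dg x t - time_deriv a dfp dgp x t)\<^sup>2
                      + (space_deriv a df dg x t - space_deriv a dfp dgp x t)\<^sup>2)
                   + (SUP x\<in>{x. \<bar>x\<bar> < R}. \<bar>u (x, t) - up (x, t)\<bar>)) \<longlongrightarrow> 0) at_top))))"
proof (rule conjI)
  note mpos = assms(1) and \<mu> = assms(2) and \<kappa> = assms(3) and a_eq = assms(4) and \<omega> = assms(5) and \<omega>0 = assms(6)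
    and F = assms(7) and Flim = assms(8,9) and H = assms(10) and p = assms(11) and F23 = assms(12)
  have a: "a > 0" using \<mu> \<kappa> by (simp add: a_eq)
  define c where "c = 1 / m"
  define k where "k = 2 * \<kappa> / (a * m)"
  have ck: "c > 0" "k > 0" using mpos \<kappa> a by (auto simp: c_def k_def)
  define force where "force t = k * a * deriv p (a * t)" for t
  have force: "(\<lambda>t. k * a * deriv p (a * t)) = force" by (simp add: fun_eq_iff force_def)
  note sys_sol = forced_system_imp_reduced_solution[OF mpos a, of \<kappa> F p, folded c_def k_def, unfolded force]
  note sol_sys = reduced_solution_imp_forced_system[OF mpos a, of \<kappa> F p, folded c_def k_def, unfolded force]
  obtain yp vp where yp: "forced_system c k F force yp vp"
    and per: "\<And>t. t > 0 \<Longrightarrow> yp (t + \<omega>0) = yp t" "\<And>t. t > 0 \<Longrightarrow> vp (t + \<omega>0) = vp t"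
    and attr: "\<And>y v. forced_system c k F force y v \<Longrightarrow> exp_close y v yp vp"
    using periodic_attractor[OF ck a \<omega> F Flim H p F23[folded c_def k_def]] unfolding force \<omega>0 by metis
  have \<omega>0_pos: "\<omega>0 > 0" using \<omega> a by (simp add: \<omega>0)
  show "\<exists>yp. reduced_solution m \<kappa> a F p yp \<and> (\<forall>t>0. yp (t + \<omega>0) = yp t)
        \<and> (\<forall>z. reduced_solution m \<kappa> a F p z \<and> (\<forall>t>0. z (t + \<omega>0) = z t) \<longrightarrow> (\<forall>t>0. z t = yp t))
        \<and> (\<forall>y. reduced_solution m \<kappa> a F p y \<longrightarrow>
             (\<forall>R>0. ((\<lambda>t. (LBINT s:{t..t + R}. (deriv y s - deriv yp s)\<^sup>2)
                         + (SUP s\<in>{t..t + R}. \<bar>y s - yp s\<bar>)) \<longlongrightarrow> 0) at_top))"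
  proof (intro exI[of _ yp] conjI allI impI)
    show "reduced_solution m \<kappa> a F p yp" by (rule sys_sol(1)[OF yp])
    show "yp (t + \<omega>0) = yp t" if "t > 0" for t by (rule per(1)[OF that])
    show "z t = yp t" if z: "reduced_solution m \<kappa> a F p z \<and> (\<forall>t>0. z (t + \<omega>0) = z t)" and "t > 0" for z t
    proof (rule periodic_eq_if_asymptotic[OF \<omega>0_pos _ _ _ \<open>t > 0\<close>])
      show "((\<lambda>t. z t - yp t) \<longlongrightarrow> 0) at_top"
        using exp_close_tendsto(1)[OF attr[OF sol_sys]] z by blast
    qed (use z per in auto)
    fix y and R :: real assume y: "reduced_solution m \<kappa> a F p y" and R: "R > 0"
    note close = exp_close_tendsto[OF attr[OF sol_sys[OF y]]]
    have "((\<lambda>t. deriv y t - deriv yp t) \<longlongrightarrow> 0) at_top"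
      by (rule Lim_transform_eventually[OF close(2) eventually_at_top_linorderI[of 1]])
        (simp add: sys_sol(2)[OF yp])
    then show "((\<lambda>t. (LBINT s:{t..t + R}. (deriv y s - deriv yp s)\<^sup>2)
        + (SUP s\<in>{t..t + R}. \<bar>y s - yp s\<bar>)) \<longlongrightarrow> 0) at_top"
      by (rule trajectory_local_convergence[OF close(1) _ R])
  qed
  define I where "I = incoming a \<omega> u0 u1"
  define J where "J = incoming_rate a \<omega> u0 u1"
  have s1: "(1::real) \<in> {1, -1}" "(-1::real) \<in> {1, -1}" by auto
  have I: "(I s has_real_derivative J s z) (at z)" and Jc: "continuous_on UNIV (J s)"
    if "s \<in> {1, -1}" for s z
    unfolding I_def J_def by (rule incoming_derivative[OF a \<omega> H that], rule incoming_rate_continuous[OF a \<omega> H that])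
  \<comment> \<open>The periodic continuations serve all times, including negative ones; the initial data determine
    them for positive times.\<close>
  have J_sum: "J 1 z + J (- 1) z = periodic_ext \<omega> (deriv p) z" for z
    unfolding J_def by (rule incoming_rate_sum[OF a \<omega> H p])
  have J_pos: "J 1 z + J (- 1) z = deriv p z" if "z > 0" for z
    unfolding J_sum by (rule periodic_ext_pos[of \<omega> "deriv p", OF \<omega> incident_force_properties(4)[OF a H p] that])
  define Y where "Y = periodic_ext \<omega>0 yp"
  define V where "V = periodic_ext \<omega>0 vp"
  define V' where "V' t = c * F (Y t) - k * V t + k * a * (J 1 (a * t) + J (- 1) (a * t))" for t
  have Y: "(Y has_real_derivative V t) (at t)" for t
    unfolding Y_def V_def
    by (rule has_derivative_periodic_ext[OF \<omega>0_pos]) (use per yp in \<open>auto simp: forced_system_def\<close>)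
  have force_per: "force (t + \<omega>0) = force t" if "t > 0" for t
    using incident_force_properties(4)[OF a H p, of "a * t"] that a by (simp add: force_def \<omega>0 distrib_left)
  have V: "(V has_real_derivative V' t) (at t)" for t
  proof -
    have "(V has_real_derivative periodic_ext \<omega>0 (\<lambda>t. c * F (yp t) - k * vp t + force t) t) (at t)"
      unfolding V_def
      by (rule has_derivative_periodic_ext[OF \<omega>0_pos])
        (use per yp force_per in \<open>auto simp: forced_system_def\<close>)
    moreover have "a * t - \<omega> * real_of_int \<lfloor>a * t / \<omega>\<rfloor> + \<omega> = a * (t - \<omega>0 * real_of_int \<lfloor>t / \<omega>0\<rfloor> + \<omega>0)"
      using a by (simp add: \<omega>0 algebra_simps)
    then have "periodic_ext \<omega>0 (\<lambda>t. c * F (yp t) - k * vp t + force t) t = V' t"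
      unfolding V'_def J_sum by (simp add: periodic_ext_def Y_def V_def force_def)
    ultimately show ?thesis by simp
  qed
  have Fc: "continuous_on UNIV F" by (rule C1_on_UNIV_D(3)[OF F])
  have dc: "continuous_on UNIV h" if "\<And>t. (h has_real_derivative h' t) (at t)" for h h' :: "real \<Rightarrow> real"
    by (rule DERIV_continuous_on[OF has_field_derivative_at_within[OF that]])
  have Jac: "continuous_on UNIV (\<lambda>t. J s (a * t))" if "s \<in> {1, -1}" for s
    by (rule continuous_on_compose2[OF Jc[OF that]]) (auto intro!: continuous_intros)
  have V'c: "continuous_on UNIV V'"
    unfolding V'_def
    by (intro continuous_intros continuous_on_compose2[OF Fc dc[OF Y]] dc[OF V] Jac[OF s1(1)] Jac[OF s1(2)]) auto
  have ode: "m * V' t = F (Y t) - 2 * \<kappa> / a * V t + 2 * \<kappa> * (J 1 (a * t) + J (- 1) (a * t))" for t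
    using mpos a by (simp add: V'_def c_def k_def field_simps)
  \<comment> \<open>This solution depends on the given one only through the common initial data \<open>u0\<close>, \<open>u1\<close>.\<close>
  obtain up where up: "up \<in> E_class" "string_solution m \<mu> \<kappa> F up"
    and up_eq: "\<And>x t. up (x, t) = Y (t - \<bar>x\<bar> / a) + (if x > 0 then I 1 (a * t + \<bar>x\<bar>) - I 1 (a * t - \<bar>x\<bar>)
        else I (- 1) (a * t + \<bar>x\<bar>) - I (- 1) (a * t - \<bar>x\<bar>))"
    using string_solution_from_trace[OF \<mu> \<kappa> a_eq Fc Y V V'c I[OF s1(1)] Jc[OF s1(1)] I[OF s1(2)] Jc[OF s1(2)] ode] by metis
  have up_per: "up (x, t + \<omega> / a) = up (x, t)" for x t
  proof -
    have Y_shift: "Y (t + \<omega> / a - \<bar>x\<bar> / a) = Y (t - \<bar>x\<bar> / a)"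
      using periodic_ext_shift[OF \<omega>0_pos, of yp "t - \<bar>x\<bar> / a"] by (simp add: Y_def \<omega>0 algebra_simps)
    have I_shift: "I s (a * t + \<omega> + \<bar>x\<bar>) - I s (a * t + \<omega> - \<bar>x\<bar>) = I s (a * t + \<bar>x\<bar>) - I s (a * t - \<bar>x\<bar>)"
      if "s \<in> {1, -1}" for s
      using incoming_shift_const[OF a \<omega> H that, of "a * t + \<bar>x\<bar>" "a * t - \<bar>x\<bar>"] by (simp add: I_def algebra_simps)
    have "a * (t + \<omega> / a) = a * t + \<omega>" using a by (simp add: distrib_left)
    then show ?thesis unfolding up_eq by (simp only: Y_shift I_shift[OF s1(1)] I_shift[OF s1(2)])
  qed
  show "\<forall>u\<in>E_class. string_solution m \<mu> \<kappa> F u \<and> initial_conditions a u u0 u1 y1 \<longrightarrow>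
        (\<exists>up\<in>E_class. string_solution m \<mu> \<kappa> F up
           \<and> (\<forall>x t. \<bar>t\<bar> > \<bar>x\<bar> / a \<longrightarrow> up (x, t + \<omega> / a) = up (x, t))
           \<and> (\<forall>f g df dg fp gp dfp dgp.
                dAlembert a u f g df dg \<and> dAlembert a up fp gp dfp dgp \<longrightarrow>
                (\<forall>R>0. ((\<lambda>t.
                   (LBINT x:{x. \<bar>x\<bar> < R}.
                      (time_deriv a df dg x t - time_deriv a dfp dgp x t)\<^sup>2
                      + (space_deriv a df dg x t - space_deriv a dfp dgp x t)\<^sup>2)
                   + (SUP x\<in>{x. \<bar>x\<bar> < R}. \<bar>u (x, t) - up (x, t)\<bar>)) \<longlongrightarrow> 0) at_top)))"
  proof (intro ballI impI bexI[OF _ up(1)] conjI up(2) allI up_per, elim conjE)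
    fix u f g df dg fp gp dfp dgp and R :: real
    assume uE: "u \<in> E_class" and uS: "string_solution m \<mu> \<kappa> F u" and uI: "initial_conditions a u u0 u1 y1"
      and dA: "dAlembert a u f g df dg" and dB: "dAlembert a up fp gp dfp dgp" and R: "R > 0"
    have uc: "continuous_on UNIV u" using uE by (simp add: E_class_def)
    obtain f1 g1 df1 dg1 where d1: "dAlembert a u f1 g1 df1 dg1"
      and eq: "\<And>\<phi>. test_function UNIV \<phi> \<Longrightarrow> m * (LINT t|lborel. u (0, t) * partial 1 (partial 1 \<phi>) t)
        = (LINT t|lborel. (F (u (0, t)) + \<kappa> * (trace_deriv a df1 dg1 1 t - trace_deriv a df1 dg1 (- 1) t)) * \<phi> t)"
      using uS unfolding string_solution_def Let_def a_eq[symmetric] by blast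
    obtain f2 g2 df2 dg2 where d2: "dAlembert a u f2 g2 df2 dg2"
      and init: "\<And>s. s \<in> {1, -1} \<Longrightarrow> (\<forall>x. s * x > 0 \<longrightarrow> f2 s x + g2 s x = u0 x)
             \<and> (AE x in lborel. s * x > 0 \<longrightarrow> - a * df2 s x + a * dg2 s x = u1 x)"
      using uI unfolding initial_conditions_def by blast
    \<comment> \<open>The equation of the mass and the initial conditions come with two representations, which differ
      by constants.\<close>
    obtain e1 where e1: "\<And>z. g1 1 z = g2 1 z - e1" using dAlembert_unique[OF d2 d1 s1(1) a] by metis
    obtain e2 where e2: "\<And>z. f1 (- 1) z = f2 (- 1) z + e2" using dAlembert_unique[OF d2 d1 s1(2) a] by metis
    have inc: "g2 1 \<beta> - g2 1 \<alpha> = I 1 \<beta> - I 1 \<alpha> \<and> f2 (- 1) (- \<beta>) - f2 (- 1) (- \<alpha>) = I (- 1) \<beta> - I (- 1) \<alpha>"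
      if "0 < \<alpha>" "\<alpha> \<le> \<beta>" for \<alpha> \<beta>
      unfolding I_def using initial_conditions_incoming[OF a \<omega> H d2 init that] by blast
    \<comment> \<open>Comparison with the point \<open>z = 1\<close> fixes the constants.\<close>
    define C1 where "C1 = g2 1 1 - e1 - I 1 1"
    define C2 where "C2 = f2 (- 1) (- 1) + e2 - I (- 1) 1"
    have g1: "g1 1 z = I 1 z + C1" and f1: "f1 (- 1) (- z) = I (- 1) z + C2" if "z > 0" for z
      using inc[of 1 z] inc[of z 1] that unfolding e1 e2 C1_def C2_def by (cases "z \<ge> 1"; simp)+
    obtain Yu Vu where Yu: "\<And>t. (Yu has_real_derivative Vu t) (at t)" "continuous_on UNIV Vu"
        "\<And>t. t > 0 \<Longrightarrow> u (0, t) = Yu t" and sys: "forced_system c k F force Yu Vu"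
      using string_trace_solves_reduced_equation[OF mpos a Fc uc d1 eq g1 f1 I[OF s1(1)] I[OF s1(2)] J_pos]
      unfolding c_def[symmetric] k_def[symmetric] force by metis
    have Yp: "Y t = yp t" and Vp: "V t = vp t" if "t > 0" for t
      unfolding Y_def V_def using periodic_ext_pos[OF \<omega>0_pos _ that] per by auto
    note close = exp_close_tendsto[OF attr[OF sys]]
    show "((\<lambda>t. (LBINT x:{x. \<bar>x\<bar> < R}. (time_deriv a df dg x t - time_deriv a dfp dgp x t)\<^sup>2
              + (space_deriv a df dg x t - space_deriv a dfp dgp x t)\<^sup>2)
           + (SUP x\<in>{x. \<bar>x\<bar> < R}. \<bar>u (x, t) - up (x, t)\<bar>)) \<longlongrightarrow> 0) at_top"
    proof (rule outgoing_difference_local_convergence[OF a dA dB _ _ _ _ _ R])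
      show "((\<lambda>t. Yu t - Y t) has_real_derivative Vu t - V t) (at t)" for t
        by (intro DERIV_diff Yu(1) Y)
      show "continuous_on UNIV (\<lambda>t. Vu t - V t)" by (intro continuous_on_diff Yu(2) dc[OF V])
      show "((\<lambda>t. Yu t - Y t) \<longlongrightarrow> 0) at_top"
        by (rule Lim_transform_eventually[OF close(1) eventually_at_top_linorderI[of 1]]) (simp add: Yp)
      show "((\<lambda>t. Vu t - V t) \<longlongrightarrow> 0) at_top"
        by (rule Lim_transform_eventually[OF close(2) eventually_at_top_linorderI[of 1]]) (simp add: Vp)
      show "u (x, t) - up (x, t) = Yu (t - \<bar>x\<bar> / a) - Y (t - \<bar>x\<bar> / a)" if cone: "\<bar>x\<bar> < a * t" for x t
      proof -
        have "\<bar>x\<bar> / a < t" using cone a by (simp add: pos_divide_less_eq mult.commute)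
        then have "u (0, t - \<bar>x\<bar> / a) = Yu (t - \<bar>x\<bar> / a)" by (intro Yu(3)) simp
        then show ?thesis
          using dAlembert_inside_light_cone[OF d1 uc a g1 f1 cone] unfolding up_eq by simp
      qed
    qed
  qed
qed

end
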